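(* Let $d$ be a positive integer. In the algebra $MU_{\mathbf{v}}(2,d)$, the Chevalley generators $$ e:=\sum_{r=0}^{d-1}\mathbf{v}^{-r}e_r,\quad f:=\sum_{r=0}^{d-1}\mathbf{v}^{1+r-d}f_r,\quad k:=\sum_{r=0}^d\mathbf{v}^{2r-d}1_r,\quad k^{-1}:=\sum_{r=0}^d\mathbf{v}^{d-2r}1_r,\quad \ell:=1_0+\sum_{r=1}^d \mathbf{v}^{-2r}(1_r+x_r)$$ satisfy the following relations: $$kk^{-1}=1,\qquad kek^{-1}=\mathbf{v}^2 e,\qquad kfk^{-1}=\mathbf{v}^{-2}f,\qquad ef-fe=\frac{k-k^{-1}}{\mathbf{v}-\mathbf{v}^{-1}},$$ $$\ell^2=\ell,\qquad k\ell=\ell k,\qquad \ell e\ell=\ell e,\qquad \ell f\ell=f\ell,$$ $$[2]\,e\ell e=\mathbf{v}^{-1}e^2\ell+\mathbf{v}\,\ell e^2,\qquad [2]\,f\ell f=\mathbf{v}^{-1}\ell f^2+\mathbf{v}f^2\ell.$$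
   Context: For $m\in\mathbb{N}$, $[m]=\frac{\mathbf{v}^m-\mathbf{v}^{-m}}{\mathbf{v}-\mathbf{v}^{-1}}$, so $[2]=\mathbf{v}+\mathbf{v}^{-1}$. For a prime power $q$ let $\mathbb{F}_q$ be the field with $q$ elements, $G_d=\mathrm{GL}_d(\mathbb{F}_q)$, and let $\mathcal{F}(2,d)$ be the set of 2-step flags $F=(0=F_0\subseteq F_1\subseteq F_2=\mathbb{F}_q^d)$. $G_d$ acts diagonally on $\mathcal{F}(2,d)\times\mathcal{F}(2,d)\times\mathbb{F}_q^d$. Let $\mathcal{MU}_q(2,d)$ be the $\mathbb{C}$-algebra of $G_d$-invariant complex functions on this set, with convolution product $$(\alpha*\beta)(F,F',v)=\sum_{H\in\mathcal{F}(2,d),\,u\in\mathbb{F}_q^d}\alpha(F,H,u)\,\beta(H,F',v-u).$$ Orbits. Let $\Xi_{2,d}$ be the set of pairs $(A,\Delta)$ where $A=(a_{ij})$ is a $2\times 2$ matrix of nonnegative integers with entries summing to $d$ and $\Delta=\{(i_1,j_1),\dots,(i_k,j_k)\}$ is a (possibly empty) set of positions with $1\le i_1<\dots<i_k\le 2$, $1\le j_k<\dots<j_1\le 2$ and $a_{ij}>0$ for all $(i,j)\in\Delta$. The $G_d$-orbits are in bijection with $\Xi_{2,d}$: $(F,F',v)\in\mathcal{O}_{A,\Delta}$ iff there is a basis $\{e_{ijm}: 1\le i,j\le 2,\ 0<m\le a_{ij}\}$ of $\mathbb{F}_q^d$ such that $F_r=\langle e_{ijm}: i\le r\rangle$, $F'_s=\langle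 e_{ijm}: j\le s\rangle$ and $v=\sum_{(i,j)\in\Delta}e_{ij1}$. Let $T_{A,\Delta}$ be the characteristic function of $\mathcal{O}_{A,\Delta}$; these form a basis of $\mathcal{MU}_q(2,d)$. Generic algebra. The structure constants of $\mathcal{MU}_q(2,d)$ in the basis $T_{A,\Delta}$ are given by polynomials with integer coefficients (independent of $q$) evaluated at $q$. $MU_{\mathbf{v}}(2,d)$ is the $\mathbb{C}(\mathbf{v})$-algebra ($\mathbf{v}$ an indeterminate) with basis $\{T_{A,\Delta}:(A,\Delta)\in\Xi_{2,d}\}$ whose structure constants are these polynomials evaluated at $\mathbf{v}^2$. The unit is $1=\sum_{r=0}^d 1_r$. Elements. Let $E_{i,j}$ be the elementary $2\times2$ matrix and $D(r,s)=\begin{pmatrix} r&0\\0&s\end{pmatrix}$. Put $e_r=T_{D(r,d-r-1)+E_{1,2},\emptyset}$ and $f_r=T_{D(r,d-r-1)+E_{2,1},\emptyset}$ for $0\le r\le d-1$; $1_r=T_{D(r,d-r),\emptyset}$ for $0\le r\le d$; $x_r=T_{D(r,d-r),\{(1,1)\}}$ for $1\le r\le d$. *)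

theory Defs
  imports
    "Jordan_Normal_Form.Missing_VectorSpace"
    "HOL-Computational_Algebra.Fraction_Field"
    "HOL-Computational_Algebra.Polynomial"
    "HOL-Library.Poly_Mapping"
    "HOL-Library.Indicator_Function"
begin

section \<open>Labels of the orbits\<close>

text \<open>A \<open>2 \<times> 2\<close> matrix is a function with row and column indices in \<open>{1, 2}\<close> that vanishes
  at all other indices, so that equality of matrices is equality of functions.\<close>

type_synonym mat2 = "nat \<Rightarrow> nat \<Rightarrow> nat"
type_synonym label = "mat2 \<times> (nat \<times> nat) set"

definition diag_mat2 :: "nat \<Rightarrow> nat \<Rightarrow> mat2" where
  "diag_mat2 r s = (\<lambda>i j. if i = 1 \<and> j = 1 then r else if i = 2 \<and> j = 2 then s else 0)"

definition elem_mat2 :: "nat \<Rightarrow> nat \<Rightarrow> mat2" where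
  "elem_mat2 i0 j0 = (\<lambda>i j. if i = i0 \<and> j = j0 then 1 else 0)"

definition add_mat2 :: "mat2 \<Rightarrow> mat2 \<Rightarrow> mat2" where
  "add_mat2 A B = (\<lambda>i j. A i j + B i j)"

text \<open>The last condition on \<open>\<Delta>\<close> says that its elements can be listed as
  \<open>(i\<^sub>1, j\<^sub>1), \<dots>, (i\<^sub>k, j\<^sub>k)\<close> with \<open>i\<^sub>1 < \<dots> < i\<^sub>k\<close> and \<open>j\<^sub>k < \<dots> < j\<^sub>1\<close>.\<close>

definition Xi :: "nat \<Rightarrow> label set" where
  "Xi d = {(A, \<Delta>).
     (\<forall>i j. (i, j) \<notin> {1, 2} \<times> {1, 2} \<longrightarrow> A i j = 0) \<and>
     (\<Sum>i\<in>{1, 2}. \<Sum>j\<in>{1, 2}. A i j) = d \<and>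
     \<Delta> \<subseteq> {1, 2} \<times> {1, 2} \<and>
     (\<forall>(i, j)\<in>\<Delta>. A i j > 0) \<and>
     (\<forall>(i, j)\<in>\<Delta>. \<forall>(i', j')\<in>\<Delta>. (i, j) \<noteq> (i', j') \<longrightarrow> i < i' \<and> j' < j \<or> i' < i \<and> j < j')}"


section \<open>The convolution algebra over a finite field\<close>

text \<open>\<open>K\<close> is meant to be a finite field in the sense of \<open>HOL-Algebra\<close>. A 2-step flag \<open>F\<close> is the
  extensional function on \<open>{0, 1, 2}\<close> with the subspaces \<open>F 0 \<subseteq> F 1 \<subseteq> F 2\<close> as its values.\<close>

abbreviation coord_space :: "('a, 'b) ring_scheme \<Rightarrow> nat \<Rightarrow> ('a, nat \<Rightarrow> 'a) module" where
  "coord_space K d \<equiv> ring.func_space K {..<d}"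

definition flags :: "('a, 'b) ring_scheme \<Rightarrow> nat \<Rightarrow> (nat \<Rightarrow> (nat \<Rightarrow> 'a) set) set" where
  "flags K d = {F \<in> {0, 1, 2} \<rightarrow>\<^sub>E {W. VectorSpace.subspace K W (coord_space K d)}.
     F 0 = {\<zero>\<^bsub>coord_space K d\<^esub>} \<and> F 0 \<subseteq> F 1 \<and> F 1 \<subseteq> F 2 \<and> F 2 = carrier (coord_space K d)}"

type_synonym 'a triple = "(nat \<Rightarrow> (nat \<Rightarrow> 'a) set) \<times> (nat \<Rightarrow> (nat \<Rightarrow> 'a) set) \<times> (nat \<Rightarrow> 'a)"

definition basis_index :: "mat2 \<Rightarrow> (nat \<times> nat \<times> nat) set" where
  "basis_index A = {(i, j, m). i \<in> {1, 2} \<and> j \<in> {1, 2} \<and> 0 < m \<and> m \<le> A i j}"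

definition orbit :: "('a, 'b) ring_scheme \<Rightarrow> nat \<Rightarrow> label \<Rightarrow> 'a triple set" where
  "orbit K d = (\<lambda>(A, \<Delta>). {(F, F', v).
     F \<in> flags K d \<and> F' \<in> flags K d \<and> v \<in> carrier (coord_space K d) \<and>
     (\<exists>b. inj_on b (basis_index A) \<and>
          vectorspace.basis K (coord_space K d) (b ` basis_index A) \<and>
          (\<forall>r\<in>{0, 1, 2}. F r =
             LinearCombinations.module.span K (coord_space K d) (b ` {(i, j, m) \<in> basis_index A. i \<le> r})) \<and>
          (\<forall>s\<in>{0, 1, 2}. F' s =
             LinearCombinations.module.span K (coord_space K d) (b ` {(i, j, m) \<in> basis_index A. j \<le> s})) \<and>
          v = (\<Oplus>\<^bsub>coord_space K d\<^esub> p\<in>\<Delta>. b (fst p, snd p, 1)))})"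

definition T_fin :: "('a, 'b) ring_scheme \<Rightarrow> nat \<Rightarrow> label \<Rightarrow> 'a triple \<Rightarrow> complex" where
  "T_fin K d X = indicator (orbit K d X)"

definition convolution ::
  "('a, 'b) ring_scheme \<Rightarrow> nat \<Rightarrow>
   ('a triple \<Rightarrow> complex) \<Rightarrow> ('a triple \<Rightarrow> complex) \<Rightarrow> 'a triple \<Rightarrow> complex"
  where
  "convolution K d \<alpha> \<beta> = (\<lambda>(F, F', v).
     \<Sum>H\<in>flags K d. \<Sum>u\<in>carrier (coord_space K d).
       \<alpha> (F, H, u) * \<beta> (H, F', v \<ominus>\<^bsub>coord_space K d\<^esub> u))"

text \<open>The coefficient of \<open>T\<^sub>Z\<close> in \<open>T\<^sub>X * T\<^sub>Y\<close> is the value of this invariant function at the points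
  of the orbit of \<open>Z\<close>, and it is given by an integer polynomial in the order of the field. The
  polynomial is unique because orbits are nonempty and there are infinitely many finite fields. Up
  to isomorphism every finite field has its carrier in \<open>nat\<close>, so that quantifying over
  \<open>K :: nat ring\<close> covers the fields of all prime power orders.\<close>

definition structure_poly :: "nat \<Rightarrow> label \<Rightarrow> label \<Rightarrow> label \<Rightarrow> int poly" where
  "structure_poly d X Y Z = (THE p. \<forall>K :: nat ring. field K \<longrightarrow> finite (carrier K) \<longrightarrow>
     (\<forall>t\<in>orbit K d Z. convolution K d (T_fin K d X) (T_fin K d Y) t =
        of_int (poly p (int (card (carrier K))))))"


section \<open>The generic algebra\<close>

type_synonym ratfun = "complex poly fract"

definition vv :: ratfun where
  "vv = Fraction_Field.Fract [:0, 1:] 1"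

definition qint :: "nat \<Rightarrow> ratfun" where
  "qint m = (vv powi int m - vv powi (- int m)) / (vv - vv powi (-1))"

text \<open>The elements of the generic algebra are the finitely supported functions with support
  in \<open>Xi d\<close>; addition is that of the type of finitely supported functions.\<close>

type_synonym generic = "label \<Rightarrow>\<^sub>0 ratfun"

definition T :: "label \<Rightarrow> generic" where
  "T X = Poly_Mapping.single X 1"

definition scale :: "ratfun \<Rightarrow> generic \<Rightarrow> generic" (infixr "*\<^sub>v" 75) where
  "c *\<^sub>v x = Poly_Mapping.map ((*) c) x"

definition MU_mult :: "nat \<Rightarrow> generic \<Rightarrow> generic \<Rightarrow> generic" where
  "MU_mult d x y = (\<Sum>X\<in>Xi d. \<Sum>Y\<in>Xi d. \<Sum>Z\<in>Xi d.
     (Poly_Mapping.lookup x X * Poly_Mapping.lookup y Y *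
      poly (map_poly of_int (structure_poly d X Y Z)) (vv ^ 2)) *\<^sub>v T Z)"

definition e_elt :: "nat \<Rightarrow> nat \<Rightarrow> generic" where
  "e_elt d r = T (add_mat2 (diag_mat2 r (d - r - 1)) (elem_mat2 1 2), {})"

definition f_elt :: "nat \<Rightarrow> nat \<Rightarrow> generic" where
  "f_elt d r = T (add_mat2 (diag_mat2 r (d - r - 1)) (elem_mat2 2 1), {})"

definition one_elt :: "nat \<Rightarrow> nat \<Rightarrow> generic" where
  "one_elt d r = T (diag_mat2 r (d - r), {})"

definition x_elt :: "nat \<Rightarrow> nat \<Rightarrow> generic" where
  "x_elt d r = T (diag_mat2 r (d - r), {(1, 1)})"

definition MU_one :: "nat \<Rightarrow> generic" where
  "MU_one d = (\<Sum>r=0..d. one_elt d r)"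

abbreviation MU_mult_syntax :: "generic \<Rightarrow> nat \<Rightarrow> generic \<Rightarrow> generic"
    ("(_ \<star>\<^bsub>_\<^esub> _)" [77, 0, 78] 77) where
  "x \<star>\<^bsub>d\<^esub> y \<equiv> MU_mult d x y"


section \<open>The Chevalley generators\<close>

definition chev_e :: "nat \<Rightarrow> generic" where
  "chev_e d = (\<Sum>r=0..d-1. (vv powi (- int r)) *\<^sub>v e_elt d r)"

definition chev_f :: "nat \<Rightarrow> generic" where
  "chev_f d = (\<Sum>r=0..d-1. (vv powi (1 + int r - int d)) *\<^sub>v f_elt d r)"

definition chev_k :: "nat \<Rightarrow> generic" where
  "chev_k d = (\<Sum>r=0..d. (vv powi (2 * int r - int d)) *\<^sub>v one_elt d r)"

definition chev_kinv :: "nat \<Rightarrow> generic" where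
  "chev_kinv d = (\<Sum>r=0..d. (vv powi (int d - 2 * int r)) *\<^sub>v one_elt d r)"

definition chev_l :: "nat \<Rightarrow> generic" where
  "chev_l d = one_elt d 0 + (\<Sum>r=1..d. (vv powi (- 2 * int r)) *\<^sub>v (one_elt d r + x_elt d r))"

end

theory Submission
  imports Defs "HOL-Number_Theory.Residues" "HOL-Algebra.QuotRing"
begin

text \<open>The idea is to see an invariant function as a function of \<open>(W, W', v)\<close>, where \<open>W\<close> and \<open>W'\<close> are the
middle terms of the two flags. Over a field with \<open>q = \<^bold>v\<^sup>2\<close> elements the function \<open>1\<^sub>r + x\<^sub>r\<close> is the
indicator of \<open>W = W'\<close>, \<open>dim W = r\<close>, \<open>v \<in> W\<close>, and \<open>\<^bold>v\<^sup>-\<^sup>2\<^sup>r = 1 / |W|\<close>. Hence \<open>\<ell>\<close> is an averaging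
operator: multiplication by \<open>\<ell>\<close> from the left averages a function over the translates of \<open>v\<close> by \<open>W\<close>,
multiplication from the right averages over the translates by \<open>W'\<close>. The relations then read as
follows.

\<^item> Averaging twice over the same space is averaging once, so \<open>\<ell>\<^sup>2 = \<ell>\<close>. The function \<open>e\<close> lives on
  \<open>W' \<subseteq> W\<close>, where averaging over \<open>W'\<close> is absorbed by averaging over \<open>W\<close>: this is \<open>\<ell>e\<ell> = \<ell>e\<close>.
  For \<open>f\<close> the inclusion is reversed, and so is the relation.

\<^item> In \<open>e\<ell>e\<close>, for \<open>W' \<subseteq> W\<close> of codimension two, one sums the averages over the \<open>q + 1\<close> intermediate
  spaces \<open>H\<close>. A vector of \<open>W'\<close> lies in all of them and a vector of \<open>W\<close> outside \<open>W'\<close> in exactly one,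
  so the sum of the indicators of the \<open>H\<close> is \<open>q\<close> times that of \<open>W'\<close> plus that of \<open>W\<close>. These two
  indicators are, up to factors, \<open>e\<^sup>2\<ell>\<close> and \<open>\<ell>e\<^sup>2\<close>, and comparing the factors gives the Serre relation.

\<^item> At \<open>W \<noteq> W'\<close> the product \<open>ef\<close> counts common hyperplanes of \<open>W\<close> and \<open>W'\<close> and \<open>fe\<close> counts common
  extensions by one dimension; there is at most one of either kind, and one exists iff the other
  does, so these terms cancel. At \<open>W = W'\<close> of dimension \<open>r\<close> the counts are
  \<open>1 + q + \<dots> + q\<^bsup>r-1\<^esup>\<close> and \<open>1 + q + \<dots> + q\<^bsup>d-r-1\<^esup>\<close>, and their difference gives \<open>k - k\<^sup>-\<^sup>1\<close>.

The passage to the generic algebra rests on the uniqueness of the structure polynomials: orbits are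
nonempty and disjoint, and there are infinitely many finite fields. Their existence is shown only
for the products that occur. Since the convenient functions are not those of single orbits but the
indicators of \<open>v = 0\<close>, \<open>v \<in> W'\<close> and \<open>v \<in> W\<close>, the transfer theorem \<open>prefix_sum_mult\<close> works with partial
sums of orbit functions: if all partial sums multiply by polynomial formulas, then so do their
differences, the orbit functions, and the formulas carry over to the generic algebra.

The relations for \<open>e\<close> are proved for \<open>\<Sum> c\<^sub>r e\<^sub>r\<close> with arbitrary coefficients. Exchanging the two flags
induces an anti-automorphism that fixes \<open>1\<^sub>r\<close> and \<open>x\<^sub>r\<close> and sends \<open>e\<^sub>r\<close> to \<open>f\<^sub>r\<close>, so that they imply the
relations for \<open>f\<close>. Dimensions are expressed throughout by cardinalities: \<open>dim W = n\<close> is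
\<open>card W = q ^ n\<close>.\<close>

section \<open>Subspaces of a finite vector space\<close>

locale finite_vectorspace = vectorspace K V
  for K :: "('a, 'b) ring_scheme" and V :: "('a, 'c, 'e) module_scheme" +
  assumes finite_scalars: "finite (carrier K)"
    and finite_vectors: "finite (carrier V)"
begin

abbreviation q :: nat where "q \<equiv> card (carrier K)"

definition subspaces :: "'c set set" where
  "subspaces = {W. VectorSpace.subspace K W V}"

definition adjoin :: "'c set \<Rightarrow> 'c \<Rightarrow> 'c set" where
  "adjoin W v = (\<lambda>(w, c). w \<oplus>\<^bsub>V\<^esub> c \<odot>\<^bsub>V\<^esub> v) ` (W \<times> carrier K)"

lemma subspacesI:
  assumes "W \<subseteq> carrier V" "\<zero>\<^bsub>V\<^esub> \<in> W" "\<And>v w. v \<in> W \<Longrightarrow> w \<in> W \<Longrightarrow> v \<oplus>\<^bsub>V\<^esub> w \<in> W"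
    "\<And>c v. c \<in> carrier K \<Longrightarrow> v \<in> W \<Longrightarrow> c \<odot>\<^bsub>V\<^esub> v \<in> W"
  shows "W \<in> subspaces"
  unfolding subspaces_def mem_Collect_eq
  by (intro VectorSpace.subspace.intro submodule.intro vectorspace_axioms module_axioms assms)

lemma subspaces_submodule: "W \<in> subspaces \<Longrightarrow> submodule K W V"
  by (simp add: subspaces_def)

lemma subspaces_subset: "W \<in> subspaces \<Longrightarrow> W \<subseteq> carrier V"
  by (drule subspaces_submodule) (rule submodule.subset)

lemma subspaces_carrier: "W \<in> subspaces \<Longrightarrow> w \<in> W \<Longrightarrow> w \<in> carrier V"
  using subspaces_subset by auto

lemma subspaces_zero: "W \<in> subspaces \<Longrightarrow> \<zero>\<^bsub>V\<^esub> \<in> W"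
  by (drule subspaces_submodule) (rule submodule.zero_closed)

lemma subspaces_add: "W \<in> subspaces \<Longrightarrow> v \<in> W \<Longrightarrow> w \<in> W \<Longrightarrow> v \<oplus>\<^bsub>V\<^esub> w \<in> W"
  by (drule subspaces_submodule) (rule submodule.m_closed)

lemma subspaces_smult: "W \<in> subspaces \<Longrightarrow> c \<in> carrier K \<Longrightarrow> v \<in> W \<Longrightarrow> c \<odot>\<^bsub>V\<^esub> v \<in> W"
  by (drule subspaces_submodule) (rule submodule.smult_closed)

lemma subspaces_neg:
  assumes "W \<in> subspaces" "v \<in> W" shows "\<ominus>\<^bsub>V\<^esub> v \<in> W"
proof -
  have "(\<ominus>\<^bsub>K\<^esub> \<one>\<^bsub>K\<^esub>) \<odot>\<^bsub>V\<^esub> v \<in> W" using assms by (intro subspaces_smult) auto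
  then show ?thesis using assms by (simp add: smult_minus_1 subspaces_carrier)
qed

lemma subspaces_minus: "W \<in> subspaces \<Longrightarrow> v \<in> W \<Longrightarrow> w \<in> W \<Longrightarrow> v \<ominus>\<^bsub>V\<^esub> w \<in> W"
  unfolding a_minus_def by (intro subspaces_add subspaces_neg)

lemma subspaces_inter: "W \<in> subspaces \<Longrightarrow> W' \<in> subspaces \<Longrightarrow> W \<inter> W' \<in> subspaces"
  by (rule subspacesI) (auto simp: subspaces_zero subspaces_add subspaces_smult subspaces_carrier)

lemma subspaces_carrier_V: "carrier V \<in> subspaces"
  by (rule subspacesI) auto

lemma subspaces_zero_space: "{\<zero>\<^bsub>V\<^esub>} \<in> subspaces"
  by (rule subspacesI) auto

lemma finite_subspaces: "finite subspaces"
  by (rule finite_subset[of _ "Pow (carrier V)"]) (auto simp: finite_vectors subspaces_carrier)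

lemma subspaces_finite: "W \<in> subspaces \<Longrightarrow> finite W"
  using finite_subset[OF subspaces_subset finite_vectors] .

lemma subspaces_card_pos: "W \<in> subspaces \<Longrightarrow> card W > 0"
  using subspaces_finite subspaces_zero by (auto simp: card_gt_0_iff)

lemma span_subspaces: "S \<subseteq> carrier V \<Longrightarrow> span S \<in> subspaces"
  unfolding subspaces_def using span_is_subspace by auto

lemma span_least: "S \<subseteq> W \<Longrightarrow> W \<in> subspaces \<Longrightarrow> span S \<subseteq> W"
  by (rule span_is_subset) (auto simp: subspaces_submodule)

lemma q_ge_2: "q \<ge> 2"
proof -
  have "card {\<zero>\<^bsub>K\<^esub>, \<one>\<^bsub>K\<^esub>} \<le> q"
    by (rule card_mono) (auto simp: finite_scalars)
  then show ?thesis by simp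
qed

lemma q_pow_inj: "q ^ m = q ^ n \<longleftrightarrow> m = n"
  using q_ge_2 by (simp add: power_inject_exp)

subsection \<open>Adjoining a vector\<close>

lemma adjoin_subspaces:
  assumes W: "W \<in> subspaces" and v: "v \<in> carrier V"
  shows "adjoin W v \<in> subspaces"
proof (rule subspacesI)
  show "adjoin W v \<subseteq> carrier V"
    using W v by (auto simp: adjoin_def subspaces_carrier)
  have "\<zero>\<^bsub>V\<^esub> = \<zero>\<^bsub>V\<^esub> \<oplus>\<^bsub>V\<^esub> \<zero>\<^bsub>K\<^esub> \<odot>\<^bsub>V\<^esub> v" using v by simp
  then show "\<zero>\<^bsub>V\<^esub> \<in> adjoin W v"
    unfolding adjoin_def using subspaces_zero[OF W] by (intro image_eqI[where x = "(\<zero>\<^bsub>V\<^esub>, \<zero>\<^bsub>K\<^esub>)"]) auto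
next
  fix x y assume "x \<in> adjoin W v" "y \<in> adjoin W v"
  then obtain w c w' c' where x: "x = w \<oplus>\<^bsub>V\<^esub> c \<odot>\<^bsub>V\<^esub> v" "y = w' \<oplus>\<^bsub>V\<^esub> c' \<odot>\<^bsub>V\<^esub> v"
    and m: "w \<in> W" "w' \<in> W" "c \<in> carrier K" "c' \<in> carrier K"
    by (auto simp: adjoin_def)
  have "x \<oplus>\<^bsub>V\<^esub> y = (w \<oplus>\<^bsub>V\<^esub> w') \<oplus>\<^bsub>V\<^esub> (c \<oplus>\<^bsub>K\<^esub> c') \<odot>\<^bsub>V\<^esub> v"
    unfolding x using m v W by (simp add: smult_l_distr subspaces_carrier a_ac)
  then show "x \<oplus>\<^bsub>V\<^esub> y \<in> adjoin W v"
    unfolding adjoin_def using m W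
    by (intro image_eqI[where x = "(w \<oplus>\<^bsub>V\<^esub> w', c \<oplus>\<^bsub>K\<^esub> c')"]) (auto simp: subspaces_add)
next
  fix a x assume a: "a \<in> carrier K" and "x \<in> adjoin W v"
  then obtain w c where x: "x = w \<oplus>\<^bsub>V\<^esub> c \<odot>\<^bsub>V\<^esub> v" and m: "w \<in> W" "c \<in> carrier K"
    by (auto simp: adjoin_def)
  have "a \<odot>\<^bsub>V\<^esub> x = (a \<odot>\<^bsub>V\<^esub> w) \<oplus>\<^bsub>V\<^esub> (a \<otimes>\<^bsub>K\<^esub> c) \<odot>\<^bsub>V\<^esub> v"
    unfolding x using m a v W by (simp add: smult_r_distr smult_assoc1 subspaces_carrier)
  then show "a \<odot>\<^bsub>V\<^esub> x \<in> adjoin W v"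
    unfolding adjoin_def using m W a
    by (intro image_eqI[where x = "(a \<odot>\<^bsub>V\<^esub> w, a \<otimes>\<^bsub>K\<^esub> c)"]) (auto simp: subspaces_smult)
qed

lemma adjoin_superset:
  assumes "W \<in> subspaces" "v \<in> carrier V" shows "W \<subseteq> adjoin W v"
proof
  fix w assume w: "w \<in> W"
  then have "w = w \<oplus>\<^bsub>V\<^esub> \<zero>\<^bsub>K\<^esub> \<odot>\<^bsub>V\<^esub> v" using assms by (simp add: subspaces_carrier)
  then show "w \<in> adjoin W v"
    unfolding adjoin_def using w by (intro image_eqI[where x = "(w, \<zero>\<^bsub>K\<^esub>)"]) auto
qed

lemma adjoin_self:
  assumes "W \<in> subspaces" "v \<in> carrier V" shows "v \<in> adjoin W v"
proof -
  have "v = \<zero>\<^bsub>V\<^esub> \<oplus>\<^bsub>V\<^esub> \<one>\<^bsub>K\<^esub> \<odot>\<^bsub>V\<^esub> v" using assms by simp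
  then show ?thesis
    unfolding adjoin_def using subspaces_zero[OF assms(1)] by (intro image_eqI[where x = "(\<zero>\<^bsub>V\<^esub>, \<one>\<^bsub>K\<^esub>)"]) auto
qed

lemma adjoin_least:
  assumes "W \<subseteq> X" "v \<in> X" "X \<in> subspaces" shows "adjoin W v \<subseteq> X"
  using assms by (auto simp: adjoin_def intro!: subspaces_add subspaces_smult)

lemma smult_in_subspaces_cancel:
  assumes W: "W \<in> subspaces" and c: "c \<in> carrier K" "c \<noteq> \<zero>\<^bsub>K\<^esub>" and v: "v \<in> carrier V" "c \<odot>\<^bsub>V\<^esub> v \<in> W"
  shows "v \<in> W"
proof -
  have u: "c \<in> Units K" using c by (simp add: field_Units)
  have "inv\<^bsub>K\<^esub> c \<odot>\<^bsub>V\<^esub> (c \<odot>\<^bsub>V\<^esub> v) \<in> W"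
    by (rule subspaces_smult[OF W Units_inv_closed[OF u] v(2)])
  moreover have "(inv\<^bsub>K\<^esub> c \<otimes>\<^bsub>K\<^esub> c) \<odot>\<^bsub>V\<^esub> v = inv\<^bsub>K\<^esub> c \<odot>\<^bsub>V\<^esub> (c \<odot>\<^bsub>V\<^esub> v)"
    by (rule smult_assoc1[OF Units_inv_closed[OF u] c(1) v(1)])
  ultimately show ?thesis using u v by simp
qed

text \<open>The map \<open>(w, c) \<mapsto> w + c v\<close> is injective on \<open>W \<times> K\<close>: two pairs with the same image and different
  \<open>c\<close> would place a nonzero multiple of \<open>v\<close>, hence \<open>v\<close> itself, in \<open>W\<close>.\<close>

lemma card_adjoin:
  assumes W: "W \<in> subspaces" and v: "v \<in> carrier V" "v \<notin> W"
  shows "card (adjoin W v) = q * card W"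
proof -
  have "inj_on (\<lambda>(w, c). w \<oplus>\<^bsub>V\<^esub> c \<odot>\<^bsub>V\<^esub> v) (W \<times> carrier K)"
  proof (rule inj_onI, clarify)
    fix w c w' c'
    assume m: "w \<in> W" "c \<in> carrier K" "w' \<in> W" "c' \<in> carrier K"
      and eq: "w \<oplus>\<^bsub>V\<^esub> c \<odot>\<^bsub>V\<^esub> v = w' \<oplus>\<^bsub>V\<^esub> c' \<odot>\<^bsub>V\<^esub> v"
    have car: "w \<in> carrier V" "w' \<in> carrier V" "c \<odot>\<^bsub>V\<^esub> v \<in> carrier V" "c' \<odot>\<^bsub>V\<^esub> v \<in> carrier V"
      using m W v by (auto simp: subspaces_carrier)
    have "(c \<ominus>\<^bsub>K\<^esub> c') \<odot>\<^bsub>V\<^esub> v = c \<odot>\<^bsub>V\<^esub> v \<ominus>\<^bsub>V\<^esub> c' \<odot>\<^bsub>V\<^esub> v"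
      using m v by (simp add: a_minus_def smult_l_distr smult_l_minus)
    also have "\<dots> = w' \<ominus>\<^bsub>V\<^esub> w"
    proof -
      have "w' \<ominus>\<^bsub>V\<^esub> w = (w' \<oplus>\<^bsub>V\<^esub> c' \<odot>\<^bsub>V\<^esub> v) \<ominus>\<^bsub>V\<^esub> w \<ominus>\<^bsub>V\<^esub> c' \<odot>\<^bsub>V\<^esub> v"
        using car by (simp add: a_minus_def a_ac r_neg)
      also have "\<dots> = c \<odot>\<^bsub>V\<^esub> v \<ominus>\<^bsub>V\<^esub> c' \<odot>\<^bsub>V\<^esub> v"
        unfolding eq[symmetric] using car by (simp add: a_minus_def a_ac r_neg r_neg2)
      finally show ?thesis by simp
    qed
    also have "\<dots> \<in> W" using m W by (simp add: subspaces_minus)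
    finally have "c \<ominus>\<^bsub>K\<^esub> c' = \<zero>\<^bsub>K\<^esub>"
      using smult_in_subspaces_cancel[OF W _ _ v(1)] m v(2) by (metis R.minus_closed)
    then have "c = c'" using m by simp
    with eq show "w = w' \<and> c = c'" using car by auto
  qed
  then show ?thesis
    by (simp add: adjoin_def card_image card_cartesian_product mult.commute)
qed

lemma proper_subspaces_card:
  assumes "W \<in> subspaces" "W' \<in> subspaces" "W' \<subset> W"
  shows "q * card W' \<le> card W"
proof -
  obtain v where v: "v \<in> W" "v \<notin> W'" using assms by auto
  have vc: "v \<in> carrier V" using v assms subspaces_carrier by auto
  have "adjoin W' v \<subseteq> W" using assms v by (intro adjoin_least) auto
  then have "card (adjoin W' v) \<le> card W"
    using assms by (intro card_mono subspaces_finite) auto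
  then show ?thesis using card_adjoin[OF assms(2) vc v(2)] by simp
qed

lemma subspaces_eqI:
  assumes "W \<in> subspaces" "W' \<subseteq> W" "card W = card W'"
  shows "W' = W"
  using card_subset_eq[OF subspaces_finite[OF assms(1)] assms(2)] assms(3) by simp

text \<open>A subspace of codimension one and a vector outside it generate the whole space, by cardinality.
  This is the source of all the uniqueness statements below.\<close>

lemma adjoin_eq:
  assumes "W \<in> subspaces" "W' \<in> subspaces" "W' \<subseteq> W" "card W = q * card W'" "v \<in> W" "v \<notin> W'"
  shows "adjoin W' v = W"
proof (rule subspaces_eqI[OF assms(1)])
  show "adjoin W' v \<subseteq> W" using assms by (intro adjoin_least) auto
  show "card W = card (adjoin W' v)"
    using assms by (subst card_adjoin) (auto simp: subspaces_carrier)
qed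

lemma no_subspaces_strictly_between:
  assumes "W \<in> subspaces" "W' \<in> subspaces" "U \<in> subspaces" "W' \<subseteq> U" "U \<subset> W" "card W = q * card W'"
  shows "U = W'"
proof (rule ccontr)
  assume "U \<noteq> W'"
  then have "q * card W' \<le> card U" using assms by (intro proper_subspaces_card) auto
  then have "q * card W \<le> q * card U" using assms by simp
  moreover have "card U < card W" using assms by (intro psubset_card_mono subspaces_finite) auto
  moreover have "0 < q" using q_ge_2 by simp
  ultimately show False by simp
qed

subsection \<open>Linearly independent sets\<close>

lemma span_insert:
  assumes "B \<subseteq> carrier V" "v \<in> carrier V"
  shows "span (insert v B) = adjoin (span B) v"
proof
  have s: "span B \<in> subspaces" "span (insert v B) \<in> subspaces" using assms by (auto intro!: span_subspaces)
  have m: "B \<subseteq> span B" "insert v B \<subseteq> span (insert v B)" using assms span_mem by auto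
  show "span (insert v B) \<subseteq> adjoin (span B) v"
    using adjoin_superset[OF s(1) assms(2)] adjoin_self[OF s(1) assms(2)] m(1)
    by (intro span_least adjoin_subspaces s assms) auto
  show "adjoin (span B) v \<subseteq> span (insert v B)"
  proof (rule adjoin_least[OF _ _ s(2)])
    show "span B \<subseteq> span (insert v B)" by (rule span_is_monotone) auto
    show "v \<in> span (insert v B)" using m(2) by auto
  qed
qed

lemma lin_indpt_subset: "lin_indpt B \<Longrightarrow> A \<subseteq> B \<Longrightarrow> lin_indpt A"
  unfolding lin_dep_def by (blast intro: subset_trans)

lemma lin_indpt_insert:
  assumes "B \<subseteq> carrier V" "lin_indpt B" "v \<in> carrier V" "v \<notin> span B"
  shows "lin_indpt (insert v B)"
proof -
  have "v \<notin> B" using assms span_mem by auto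
  then show ?thesis using lin_dep_iff_in_span[OF assms(1,2,3)] assms(4) by auto
qed

lemma lin_indpt_empty: "lin_indpt {}"
  by (auto simp: lin_dep_def)

lemma lin_indpt_notin_span:
  assumes "B \<subseteq> carrier V" "lin_indpt B" "S \<subseteq> B" "v \<in> B" "v \<notin> S"
  shows "v \<notin> span S"
proof -
  have li: "lin_indpt S" "lin_indpt (S \<union> {v})"
    using lin_indpt_subset[OF assms(2)] assms(3,4) by auto
  have "S \<subseteq> carrier V" "v \<in> carrier V" using assms by auto
  from lin_dep_iff_in_span[OF this(1) li(1) this(2) assms(5)] li(2) show ?thesis by simp
qed

text \<open>Independence means that every new vector lies outside the span of the previous ones, so each
  multiplies the cardinality by \<open>q\<close>.\<close>

lemma card_span:
  assumes "B \<subseteq> carrier V" "lin_indpt B"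
  shows "card (span B) = q ^ card B"
proof -
  have "finite B" using assms finite_vectors finite_subset by auto
  then show ?thesis using assms
  proof (induction B rule: finite_induct)
    case empty
    then show ?case by (simp add: span_empty)
  next
    case (insert v B)
    have "lin_indpt B" using insert.prems(2) lin_indpt_subset by blast
    moreover have "v \<notin> span B"
      using lin_indpt_notin_span[of "insert v B" B v] insert by auto
    ultimately show ?case
      using insert by (simp add: span_insert card_adjoin span_subspaces)
  qed
qed

lemma basis_extension:
  assumes W: "W \<in> subspaces" and B: "B \<subseteq> W" "lin_indpt B"
  obtains C where "B \<subseteq> C" "C \<subseteq> W" "lin_indpt C" "span C = W"
proof -
  let ?P = "\<lambda>C. B \<subseteq> C \<and> C \<subseteq> W \<and> lin_indpt C"
  have "finite {C. ?P C}"
    by (rule finite_subset[of _ "Pow W"]) (auto simp: subspaces_finite[OF W])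
  moreover have "B \<in> {C. ?P C}" using B by auto
  ultimately have "\<exists>C\<in>{C. ?P C}. B \<subseteq> C \<and> (\<forall>C'\<in>{C. ?P C}. C \<subseteq> C' \<longrightarrow> C = C')"
    by (rule finite_has_maximal2)
  then obtain C where "C \<in> {C. ?P C}" and m: "\<forall>C'\<in>{C. ?P C}. C \<subseteq> C' \<longrightarrow> C = C'"
    by (elim bexE conjE)
  then have C: "?P C" and max: "\<And>C'. ?P C' \<Longrightarrow> C \<subseteq> C' \<Longrightarrow> C' = C"
    by blast+
  have car: "C \<subseteq> carrier V" using C W subspaces_subset by auto
  have "span C = W"
  proof (rule ccontr)
    assume "span C \<noteq> W"
    then obtain v where v: "v \<in> W" "v \<notin> span C" using span_least[of C W] C W by auto
    then have "v \<in> carrier V" using W subspaces_carrier by auto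
    then have "lin_indpt (insert v C)"
      using C v car by (intro lin_indpt_insert) auto
    then have "?P (insert v C)" using C v by auto
    then have "insert v C = C" using max by auto
    then show False using v span_mem[OF car] by auto
  qed
  with C that show thesis by auto
qed

text \<open>If a summand lies outside \<open>S\<close>, then it would be in the span of the other basis vectors, since the sum and
  all other summands are.\<close>

lemma finsum_subset_in_span:
  assumes B: "B \<subseteq> carrier V" "lin_indpt B" and I: "finite I" "w ` I \<subseteq> B" "inj_on w I" and S: "S \<subseteq> B"
  shows "(\<Oplus>\<^bsub>V\<^esub> p\<in>I. w p) \<in> span S \<longleftrightarrow> w ` I \<subseteq> S"
proof
  have Sc: "S \<subseteq> carrier V" using S B by auto
  have sum_in: "(\<Oplus>\<^bsub>V\<^esub> p\<in>J. w p) \<in> span X" if "finite J" "w ` J \<subseteq> X" "X \<subseteq> carrier V" for J X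
    using that
  proof (induction J rule: finite_induct)
    case (insert j J)
    then have "w j \<in> span X" "w j \<in> carrier V" "w \<in> J \<rightarrow> carrier V"
      using span_mem by auto
    with insert show ?case
      by (simp add: finsum_insert span_add1)
  qed (auto simp: span_zero)
  show "w ` I \<subseteq> S \<Longrightarrow> (\<Oplus>\<^bsub>V\<^esub> p\<in>I. w p) \<in> span S" using sum_in[OF I(1) _ Sc] .
  assume mem: "(\<Oplus>\<^bsub>V\<^esub> p\<in>I. w p) \<in> span S"
  show "w ` I \<subseteq> S"
  proof (rule ccontr)
    assume "\<not> w ` I \<subseteq> S"
    then obtain i where i: "i \<in> I" "w i \<notin> S" by auto
    let ?X = "B - {w i}"
    have X: "?X \<subseteq> carrier V" using B by auto
    have r: "(\<Oplus>\<^bsub>V\<^esub> p\<in>I - {i}. w p) \<in> span ?X"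
      using I i by (intro sum_in X) (auto simp: inj_on_def)
    have "I = insert i (I - {i})" using i by auto
    then have "(\<Oplus>\<^bsub>V\<^esub> p\<in>I. w p) = (\<Oplus>\<^bsub>V\<^esub> p\<in>insert i (I - {i}). w p)" by simp
    also have "\<dots> = w i \<oplus>\<^bsub>V\<^esub> (\<Oplus>\<^bsub>V\<^esub> p\<in>I - {i}. w p)"
      using I i B by (subst finsum_insert) auto
    finally have e: "(\<Oplus>\<^bsub>V\<^esub> p\<in>I. w p) = w i \<oplus>\<^bsub>V\<^esub> (\<Oplus>\<^bsub>V\<^esub> p\<in>I - {i}. w p)" .
    have "(\<Oplus>\<^bsub>V\<^esub> p\<in>I. w p) \<in> span ?X"
      using mem span_is_monotone[of S ?X] S i by auto
    then have "(\<Oplus>\<^bsub>V\<^esub> p\<in>I - {i}. w p) \<oplus>\<^bsub>V\<^esub> w i \<in> span ?X"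
      unfolding e using r X I i B by (subst a_comm) auto
    then have "w i \<in> span ?X"
      using span_add[OF X r, of "w i"] B I i by auto
    then show False
      using lin_indpt_notin_span[OF B, of ?X "w i"] I i by auto
  qed
qed

subsection \<open>Numbers of subspaces and of vectors\<close>

definition extensions :: "'c set \<Rightarrow> 'c set \<Rightarrow> 'c set set" where
  "extensions W Y = {H \<in> subspaces. W \<subseteq> H \<and> H \<subseteq> Y \<and> card H = q * card W}"

definition hyperplanes :: "'c set \<Rightarrow> 'c set set" where
  "hyperplanes W = {H \<in> subspaces. H \<subseteq> W \<and> card W = q * card H}"

lemma q_geometric_sum: "(q - 1) * (\<Sum>i<n. q ^ i) + 1 = q ^ n"
proof (induction n)
  case (Suc n)
  have "(q - 1) * (\<Sum>i<Suc n. q ^ i) + 1 = ((q - 1) * (\<Sum>i<n. q ^ i) + 1) + (q - 1) * q ^ n"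
    by (simp add: algebra_simps)
  also have "\<dots> = q ^ Suc n"
    unfolding Suc.IH using q_ge_2 by (cases q) (auto simp: algebra_simps)
  finally show ?case .
qed simp

text \<open>The sets \<open>H - W\<close>, for \<open>H\<close> an extension of \<open>W\<close> by one dimension, partition \<open>Y - W\<close>: a vector \<open>v\<close>
  outside \<open>W\<close> lies in exactly one such \<open>H\<close>, the space generated by \<open>W\<close> and \<open>v\<close>. Each of them has
  \<open>(q - 1) |W|\<close> elements.\<close>

lemma card_extensions:
  assumes W: "W \<in> subspaces" and Y: "Y \<in> subspaces" and sub: "W \<subseteq> Y" and c: "card Y = q ^ n * card W"
  shows "card (extensions W Y) = (\<Sum>i<n. q ^ i)"
proof -
  have fin: "finite (extensions W Y)" unfolding extensions_def using finite_subspaces by simp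
  \<comment> \<open>Every vector outside \<open>W\<close> lies in an extension, namely the one that it generates.\<close>
  have decomp: "Y - W = (\<Union>H\<in>extensions W Y. H - W)"
  proof (intro equalityI subsetI)
    fix v assume v: "v \<in> Y - W"
    then have vc: "v \<in> carrier V" using Y subspaces_carrier by auto
    have "adjoin W v \<in> extensions W Y"
      using v vc W Y sub by (auto simp: extensions_def adjoin_subspaces card_adjoin
          intro: adjoin_superset[THEN subsetD] adjoin_least[THEN subsetD])
    then show "v \<in> (\<Union>H\<in>extensions W Y. H - W)" using adjoin_self[OF W vc] v by auto
  qed (auto simp: extensions_def)
  have "card (Y - W) = (\<Sum>H\<in>extensions W Y. card (H - W))"
    unfolding decomp
  proof (rule card_UN_disjoint[OF fin])
    show "\<forall>H\<in>extensions W Y. finite (H - W)" by (auto simp: extensions_def subspaces_finite)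
    show "\<forall>H\<in>extensions W Y. \<forall>H'\<in>extensions W Y. H \<noteq> H' \<longrightarrow> (H - W) \<inter> (H' - W) = {}"
    proof (intro ballI impI, rule ccontr)
      fix H H' assume H: "H \<in> extensions W Y" "H' \<in> extensions W Y" "H \<noteq> H'" "(H - W) \<inter> (H' - W) \<noteq> {}"
      then obtain v where "v \<in> H" "v \<in> H'" "v \<notin> W" by auto
      then have "adjoin W v = X" if "X \<in> {H, H'}" for X
        using that H W by (intro adjoin_eq) (auto simp: extensions_def)
      from this[of H] this[of H'] H(3) show False by simp
    qed
  qed
  also have "\<dots> = (\<Sum>H\<in>extensions W Y. (q - 1) * card W)"
  proof (rule sum.cong[OF refl])
    fix H assume "H \<in> extensions W Y"
    then have "card (H - W) = q * card W - card W"
      using W by (subst card_Diff_subset) (auto simp: extensions_def subspaces_finite)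
    then show "card (H - W) = (q - 1) * card W" by (simp add: diff_mult_distrib)
  qed
  finally have "card (Y - W) = card (extensions W Y) * (q - 1) * card W" by simp
  moreover have "card (Y - W) = (q - 1) * (\<Sum>i<n. q ^ i) * card W"
  proof -
    have "card (Y - W) = q ^ n * card W - card W"
      using W sub c by (subst card_Diff_subset) (auto simp: subspaces_finite)
    also have "\<dots> = (q ^ n - 1) * card W" by (simp add: diff_mult_distrib)
    finally show ?thesis using q_geometric_sum[of n] by (metis add_diff_cancel_right')
  qed
  ultimately have "(q - 1) * card W * card (extensions W Y) = (q - 1) * card W * (\<Sum>i<n. q ^ i)"
    by (metis mult.assoc mult.commute)
  moreover have "(q - 1) * card W > 0" using q_ge_2 subspaces_card_pos[OF W] by simp
  ultimately show ?thesis by (metis mult_cancel1 less_irrefl)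
qed

text \<open>This is the modular law for the line through \<open>b\<close>.\<close>

lemma adjoin_inter:
  assumes X: "X \<in> subspaces" and Y: "Y \<in> subspaces" and b: "b \<in> X" and sub: "X \<subseteq> adjoin Y b"
  shows "X = adjoin (X \<inter> Y) b"
proof
  show "adjoin (X \<inter> Y) b \<subseteq> X" using X b by (intro adjoin_least) auto
  show "X \<subseteq> adjoin (X \<inter> Y) b"
  proof
    fix x assume x: "x \<in> X"
    then obtain y c where y: "x = y \<oplus>\<^bsub>V\<^esub> c \<odot>\<^bsub>V\<^esub> b" "y \<in> Y" "c \<in> carrier K"
      using sub unfolding adjoin_def by auto
    have car: "y \<in> carrier V" "c \<odot>\<^bsub>V\<^esub> b \<in> carrier V" "b \<in> carrier V"
      using y b X Y by (auto simp: subspaces_carrier)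
    have "y = x \<ominus>\<^bsub>V\<^esub> c \<odot>\<^bsub>V\<^esub> b"
      unfolding y(1) using car by (simp add: a_minus_def a_assoc r_neg)
    also have "\<dots> \<in> X" using X x y b by (intro subspaces_minus subspaces_smult) auto
    finally show "x \<in> adjoin (X \<inter> Y) b"
      unfolding adjoin_def using y by (intro image_eqI[where x = "(y, c)"]) auto
  qed
qed

lemma card_inter_of_hyperplanes:
  assumes W: "W \<in> subspaces" and H: "H \<in> hyperplanes W" "H0 \<in> hyperplanes W" "H \<noteq> H0"
  shows "card H = q * card (H \<inter> H0)"
proof -
  have s: "H \<in> subspaces" "H0 \<in> subspaces" "H \<subseteq> W" "H0 \<subseteq> W" "card W = q * card H0" "card H0 = card H"
    using H q_ge_2 by (auto simp: hyperplanes_def)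
  have "\<not> H \<subseteq> H0"
    using subspaces_eqI[OF s(2), of H] s(6) H(3) by auto
  then obtain b where b: "b \<in> H" "b \<notin> H0" by auto
  have "adjoin H0 b = W" using s b W by (intro adjoin_eq) auto
  then have "H = adjoin (H \<inter> H0) b" using adjoin_inter[of H H0 b] s b by auto
  then show ?thesis
    using card_adjoin[of "H \<inter> H0" b] s b by (auto simp: subspaces_inter subspaces_carrier)
qed

lemma hyperplanes_nonempty:
  assumes W: "W \<in> subspaces" and c: "card W > 1"
  shows "hyperplanes W \<noteq> {}"
proof -
  obtain C where C: "C \<subseteq> W" "lin_indpt C" "span C = W"
    using basis_extension[OF W _ lin_indpt_empty] by auto
  have car: "C \<subseteq> carrier V" using C W subspaces_subset by auto
  have fin: "finite C" using car finite_vectors finite_subset by auto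
  have cW: "card W = q ^ card C" using card_span[OF car C(2)] C by simp
  then have "C \<noteq> {}" using c by auto
  then obtain x where x: "x \<in> C" by auto
  have "card (span (C - {x})) = q ^ card (C - {x})"
    using car by (intro card_span lin_indpt_subset[OF C(2)]) auto
  moreover have "card C = Suc (card (C - {x}))"
    using x fin by (metis card_Suc_Diff1)
  moreover have "span (C - {x}) \<subseteq> W" using C(3) span_is_monotone[of "C - {x}" C] by auto
  moreover have "span (C - {x}) \<in> subspaces" using car by (intro span_subspaces) auto
  ultimately have "span (C - {x}) \<in> hyperplanes W"
    using cW by (simp add: hyperplanes_def)
  then show ?thesis by auto
qed

text \<open>Fix one hyperplane \<open>H0\<close>. Any other hyperplane \<open>H\<close> meets \<open>H0\<close> in a hyperplane \<open>J\<close> of \<open>H0\<close>, and \<open>H\<close> is one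
  of the \<open>q\<close> spaces between \<open>J\<close> and \<open>W\<close> that differ from \<open>H0\<close>. Hence the numbers \<open>h\<close> of hyperplanes satisfy
  \<open>h (n + 1) = 1 + q h n\<close>.\<close>

lemma card_hyperplanes:
  assumes "W \<in> subspaces" "card W = q ^ n"
  shows "card (hyperplanes W) = (\<Sum>i<n. q ^ i)"
  using assms
proof (induction n arbitrary: W)
  case 0
  have "hyperplanes W = {}" using 0 q_ge_2 by (auto simp: hyperplanes_def)
  then show ?case by simp
next
  case (Suc n)
  have "card W > 1" using Suc.prems q_ge_2 by (simp only: one_less_power)
  then obtain H0 where H0: "H0 \<in> hyperplanes W" using hyperplanes_nonempty[OF Suc.prems(1)] by blast
  then have H0': "H0 \<in> subspaces" "H0 \<subseteq> W" "card H0 = q ^ n"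
    using Suc.prems q_ge_2 by (auto simp: hyperplanes_def)
  have fin: "finite (hyperplanes X)" for X unfolding hyperplanes_def using finite_subspaces by simp
  have fin2: "finite (extensions X Y)" for X Y unfolding extensions_def using finite_subspaces by simp
  \<comment> \<open>The other hyperplanes are sorted by their intersection with \<open>H0\<close>.\<close>
  have bij: "bij_betw (\<lambda>H. (H \<inter> H0, H)) (hyperplanes W - {H0}) (SIGMA J:hyperplanes H0. extensions J W - {H0})"
  proof (rule bij_betwI[where g = snd])
    show "(\<lambda>H. (H \<inter> H0, H)) \<in> hyperplanes W - {H0} \<rightarrow> (SIGMA J:hyperplanes H0. extensions J W - {H0})"
    proof
      fix H assume H: "H \<in> hyperplanes W - {H0}"
      then have "card H = q * card (H \<inter> H0)"
        using card_inter_of_hyperplanes[of W H H0] Suc.prems H0 by auto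
      moreover have "H \<in> subspaces" "H \<subseteq> W" "card H = card H0"
        using H H0 q_ge_2 by (auto simp: hyperplanes_def)
      ultimately show "(H \<inter> H0, H) \<in> (SIGMA J:hyperplanes H0. extensions J W - {H0})"
        using H H0' by (auto simp: hyperplanes_def extensions_def subspaces_inter)
    qed
    show "snd \<in> (SIGMA J:hyperplanes H0. extensions J W - {H0}) \<rightarrow> hyperplanes W - {H0}"
      using H0 by (auto simp: hyperplanes_def extensions_def)
    show "snd (H \<inter> H0, H) = H" for H by simp
    show "(snd x \<inter> H0, snd x) = x" if "x \<in> (SIGMA J:hyperplanes H0. extensions J W - {H0})" for x
    proof -
      obtain J H where x: "x = (J, H)" by (cases x)
      have J: "J \<in> subspaces" "J \<subseteq> H0" "card H0 = q * card J" "H \<in> subspaces" "J \<subseteq> H" "H \<subseteq> W"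
        "card H = q * card J" "H \<noteq> H0"
        using that by (auto simp: x hyperplanes_def extensions_def)
      have "H \<inter> H0 \<noteq> H0" using subspaces_eqI[of H H0] J by auto
      then have "H \<inter> H0 = J"
        using J H0' by (intro no_subspaces_strictly_between[of H0 J]) (auto simp: subspaces_inter)
      then show ?thesis by (simp add: x)
    qed
  qed
  have sup: "card (extensions J W - {H0}) = q" if "J \<in> hyperplanes H0" for J
  proof -
    have J: "J \<in> subspaces" "J \<subseteq> H0" "card H0 = q * card J" using that by (auto simp: hyperplanes_def)
    have "card W = q ^ 2 * card J"
      using H0 J by (simp add: hyperplanes_def power2_eq_square)
    then have "card (extensions J W) = q + 1"
      using card_extensions[of J W 2] J Suc.prems H0' by (simp add: numeral_2_eq_2)
    moreover have "H0 \<in> extensions J W" using J H0' by (auto simp: extensions_def)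
    ultimately show ?thesis by (simp add: fin2)
  qed
  have "card (hyperplanes W) = Suc (card (hyperplanes W - {H0}))"
    using H0 fin by (metis card_Suc_Diff1)
  also have "card (hyperplanes W - {H0}) = (\<Sum>J\<in>hyperplanes H0. card (extensions J W - {H0}))"
    using bij_betw_same_card[OF bij] fin fin2 by simp
  also have "\<dots> = card (hyperplanes H0) * q" using sup by simp
  also have "\<dots> = (\<Sum>i<n. q ^ i) * q" using Suc.IH H0' by simp
  finally show ?case
    by (simp add: sum.lessThan_Suc_shift sum_distrib_left sum_distrib_right mult_ac del: sum.lessThan_Suc)
qed

lemma card_extensions_containing:
  assumes "W \<in> subspaces" "W' \<in> subspaces" "W' \<subseteq> W" "v \<in> W" "v \<notin> W'"
  shows "card {H \<in> extensions W' W. v \<in> H} = 1"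
proof -
  have vc: "v \<in> carrier V" using assms subspaces_carrier by auto
  have "{H \<in> extensions W' W. v \<in> H} = {adjoin W' v}"
  proof (intro equalityI subsetI)
    fix H assume "H \<in> {H \<in> extensions W' W. v \<in> H}"
    then have "adjoin W' v = H" using assms by (intro adjoin_eq) (auto simp: extensions_def)
    then show "H \<in> {adjoin W' v}" by simp
  next
    fix H assume "H \<in> {adjoin W' v}"
    then show "H \<in> {H \<in> extensions W' W. v \<in> H}"
      using assms vc by (auto simp: extensions_def adjoin_subspaces card_adjoin adjoin_self
          intro: adjoin_superset[THEN subsetD] adjoin_least[THEN subsetD])
  qed
  then show ?thesis by simp
qed

text \<open>A common hyperplane of two different spaces of the same dimension is their intersection.\<close>

lemma card_common_hyperplanes:
  assumes W: "W \<in> subspaces" "W' \<in> subspaces" "card W = card W'" "W \<noteq> W'"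
  shows "card (hyperplanes W \<inter> hyperplanes W') = of_bool (hyperplanes W \<inter> hyperplanes W' \<noteq> {})"
proof -
  have "H = W \<inter> W'" if "H \<in> hyperplanes W \<inter> hyperplanes W'" for H
  proof -
    have "W \<inter> W' \<noteq> W" using subspaces_eqI[of W' W] W by auto
    then have "W \<inter> W' = H"
      using that W by (intro no_subspaces_strictly_between[of W H]) (auto simp: hyperplanes_def subspaces_inter)
    then show ?thesis by simp
  qed
  then have "hyperplanes W \<inter> hyperplanes W' = {} \<or> hyperplanes W \<inter> hyperplanes W' = {W \<inter> W'}" by blast
  then show ?thesis by auto
qed

text \<open>A common extension is generated by \<open>W\<close> and a vector of \<open>W'\<close> outside \<open>W\<close>, so there is at most one. If it
  exists, then \<open>W\<close> and \<open>W'\<close> are hyperplanes in it and meet in a common hyperplane. Conversely, if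
  there is a common hyperplane \<open>J\<close>, then \<open>W'\<close> is generated by \<open>J\<close> and one more vector, and adjoining
  that vector to \<open>W\<close> gives a common extension.\<close>

lemma card_common_extensions:
  assumes W: "W \<in> subspaces" "W' \<in> subspaces" "card W = card W'" "W \<noteq> W'"
  shows "card (extensions W (carrier V) \<inter> extensions W' (carrier V)) = of_bool (hyperplanes W \<inter> hyperplanes W' \<noteq> {})"
proof -
  \<comment> \<open>Neither space contains the other, as they have the same cardinality.\<close>
  have "\<not> W' \<subseteq> W" using subspaces_eqI[of W W'] W by auto
  then obtain b where b: "b \<in> W'" "b \<notin> W" by auto
  then have bc: "b \<in> carrier V" using W subspaces_carrier by auto
  let ?S = "extensions W (carrier V) \<inter> extensions W' (carrier V)"
  have uniq: "H = adjoin W b" if "H \<in> ?S" for H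
    using adjoin_eq[of H W b] that W b by (auto simp: extensions_def)
  have "?S \<noteq> {} \<longleftrightarrow> hyperplanes W \<inter> hyperplanes W' \<noteq> {}"
  proof
    assume "?S \<noteq> {}"
    then obtain H where H: "H \<in> ?S" by auto
    then have h: "W \<in> hyperplanes H" "W' \<in> hyperplanes H" "H \<in> subspaces" using W by (auto simp: extensions_def hyperplanes_def)
    have "card W = q * card (W \<inter> W')" using card_inter_of_hyperplanes[OF h(3,1,2)] W by simp
    then have "W \<inter> W' \<in> hyperplanes W \<inter> hyperplanes W'" using W by (auto simp: hyperplanes_def subspaces_inter)
    then show "hyperplanes W \<inter> hyperplanes W' \<noteq> {}" by auto
  next
    assume "hyperplanes W \<inter> hyperplanes W' \<noteq> {}"
    then obtain J where J: "J \<in> hyperplanes W" "J \<in> hyperplanes W'" by auto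
    then have "J \<in> subspaces" "J \<subseteq> W" "J \<subseteq> W'" "card W' = q * card J" by (auto simp: hyperplanes_def)
    then have "adjoin J b = W'" using b W by (intro adjoin_eq) auto
    moreover have "adjoin J b \<subseteq> adjoin W b" using \<open>J \<subseteq> W\<close> by (auto simp: adjoin_def)
    ultimately have "W' \<subseteq> adjoin W b" by simp
    moreover have "adjoin W b \<in> subspaces" "adjoin W b \<subseteq> carrier V"
      using adjoin_subspaces[OF W(1) bc] subspaces_subset by auto
    ultimately have "adjoin W b \<in> ?S"
      using W b bc adjoin_superset[of W b] card_adjoin[of W b]
      by (simp add: extensions_def)
    then show "?S \<noteq> {}" by auto
  qed
  moreover have "?S = {} \<or> ?S = {adjoin W b}" using uniq by blast
  ultimately show ?thesis by auto
qed

text \<open>Both counts say how often a convolution of the indicators of two nested subspaces hits \<open>v\<close>: the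
  convolution is the indicator of the larger space times the cardinality of the smaller one. The
  second count follows from the first by the reflection \<open>u \<mapsto> v - u\<close>.\<close>

lemma card_translates:
  assumes "A \<in> subspaces" "B \<in> subspaces" "A \<subseteq> B" "v \<in> carrier V"
  shows "card {u \<in> A. v \<ominus>\<^bsub>V\<^esub> u \<in> B} = (if v \<in> B then card A else 0)"
    and "card {u \<in> B. v \<ominus>\<^bsub>V\<^esub> u \<in> A} = (if v \<in> B then card A else 0)"
proof -
  have iff: "v \<ominus>\<^bsub>V\<^esub> u \<in> B \<longleftrightarrow> v \<in> B" if "u \<in> B" for u
  proof
    assume "v \<ominus>\<^bsub>V\<^esub> u \<in> B"
    then have "v \<ominus>\<^bsub>V\<^esub> u \<oplus>\<^bsub>V\<^esub> u \<in> B" using that assms subspaces_add by auto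
    moreover have "v \<ominus>\<^bsub>V\<^esub> u \<oplus>\<^bsub>V\<^esub> u = v"
      using that assms by (simp add: a_minus_def a_assoc l_neg subspaces_carrier)
    ultimately show "v \<in> B" by simp
  qed (use that assms subspaces_minus in auto)
  have "{u \<in> A. v \<ominus>\<^bsub>V\<^esub> u \<in> B} = (if v \<in> B then A else {})"
    using iff assms by auto
  then show "card {u \<in> A. v \<ominus>\<^bsub>V\<^esub> u \<in> B} = (if v \<in> B then card A else 0)" by simp
  have "bij_betw (\<lambda>u. v \<ominus>\<^bsub>V\<^esub> u) {u \<in> B. v \<ominus>\<^bsub>V\<^esub> u \<in> A} {u \<in> A. v \<ominus>\<^bsub>V\<^esub> u \<in> B}"
  proof (rule bij_betwI[where g = "\<lambda>u. v \<ominus>\<^bsub>V\<^esub> u"])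
    have inv: "v \<ominus>\<^bsub>V\<^esub> (v \<ominus>\<^bsub>V\<^esub> u) = u" if "u \<in> carrier V" for u
      using that assms by (simp add: a_minus_def minus_add a_assoc[symmetric] r_neg)
    show "v \<ominus>\<^bsub>V\<^esub> (v \<ominus>\<^bsub>V\<^esub> u) = u" if "u \<in> {u \<in> B. v \<ominus>\<^bsub>V\<^esub> u \<in> A}" for u
      using that assms inv subspaces_carrier by auto
    show "v \<ominus>\<^bsub>V\<^esub> (v \<ominus>\<^bsub>V\<^esub> u) = u" if "u \<in> {u \<in> A. v \<ominus>\<^bsub>V\<^esub> u \<in> B}" for u
      using that assms inv subspaces_carrier by auto
    show "(\<lambda>u. v \<ominus>\<^bsub>V\<^esub> u) \<in> {u \<in> B. v \<ominus>\<^bsub>V\<^esub> u \<in> A} \<rightarrow> {u \<in> A. v \<ominus>\<^bsub>V\<^esub> u \<in> B}"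
      using assms inv subspaces_carrier by auto
    show "(\<lambda>u. v \<ominus>\<^bsub>V\<^esub> u) \<in> {u \<in> A. v \<ominus>\<^bsub>V\<^esub> u \<in> B} \<rightarrow> {u \<in> B. v \<ominus>\<^bsub>V\<^esub> u \<in> A}"
      using assms inv subspaces_carrier by auto
  qed
  then show "card {u \<in> B. v \<ominus>\<^bsub>V\<^esub> u \<in> A} = (if v \<in> B then card A else 0)"
    using \<open>card {u \<in> A. v \<ominus>\<^bsub>V\<^esub> u \<in> B} = _\<close> by (simp add: bij_betw_same_card)
qed

end

section \<open>The orbits of pairs of flags with a vector\<close>

lemma ex_bij_betw_first:
  assumes "finite S" "x \<in> S"
  shows "\<exists>h. bij_betw h {1..card S} S \<and> h 1 = x"
proof -
  obtain h where h: "bij_betw h {1..card S} S" using ex_bij_betw_nat_finite_1[OF assms(1)] by auto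
  then obtain k where k: "k \<in> {1..card S}" "h k = x" using assms(2) by (metis bij_betwE bij_betw_imp_surj_on imageE)
  have "1 \<in> {1..card S}" using k by auto
  then have "bij_betw (Transposition.transpose 1 k) {1..card S} {1..card S}"
    using k by (intro bij_betw_byWitness[where f' = "Transposition.transpose 1 k"]) (auto simp: Transposition.transpose_def)
  then have "bij_betw (h \<circ> Transposition.transpose 1 k) {1..card S} S" using h bij_betw_trans by blast
  then show ?thesis using k by (intro exI[of _ "h \<circ> Transposition.transpose 1 k"]) auto
qed

definition mat4 :: "nat \<Rightarrow> nat \<Rightarrow> nat \<Rightarrow> nat \<Rightarrow> mat2" where
  "mat4 a b c e = (\<lambda>i j. if i = 1 \<and> j = 1 then a else if i = 1 \<and> j = 2 then b
     else if i = 2 \<and> j = 1 then c else if i = 2 \<and> j = 2 then e else 0)"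

lemma mat4_simps [simp]:
  "mat4 a b c e (Suc 0) (Suc 0) = a" "mat4 a b c e (Suc 0) 2 = b"
  "mat4 a b c e 2 (Suc 0) = c" "mat4 a b c e 2 2 = e"
  by (auto simp: mat4_def)

lemma Xi_mat4:
  assumes "(A, \<Delta>) \<in> Xi d"
  shows "A = mat4 (A 1 1) (A 1 2) (A 2 1) (A 2 2)"
  using assms by (auto simp: Xi_def mat4_def fun_eq_iff)

text \<open>The chains of positions that satisfy the condition on \<open>\<Delta>\<close> in a \<open>2 \<times> 2\<close> matrix are the empty one, the four
  single positions and the antidiagonal.\<close>

lemma Xi_mat4_iff:
  "(mat4 a b c e, \<Delta>) \<in> Xi d \<longleftrightarrow> a + b + c + e = d \<and>
     (\<Delta> = {} \<or> \<Delta> = {(1, 1)} \<and> a > 0 \<or> \<Delta> = {(1, 2)} \<and> b > 0 \<or> \<Delta> = {(2, 1)} \<and> c > 0 \<or>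
      \<Delta> = {(2, 2)} \<and> e > 0 \<or> \<Delta> = {(1, 2), (2, 1)} \<and> b > 0 \<and> c > 0)"
  (is "_ \<longleftrightarrow> ?R")
proof
  assume L: "(mat4 a b c e, \<Delta>) \<in> Xi d"
  have sub: "\<Delta> \<subseteq> {(1, 1), (1, 2), (2, 1), (2, 2)}" using L by (auto simp: Xi_def)
  have "\<forall>p\<in>\<Delta>. \<forall>p'\<in>\<Delta>. p \<noteq> p' \<longrightarrow>
     fst p < fst p' \<and> snd p' < snd p \<or> fst p' < fst p \<and> snd p < snd p'"
    and "\<forall>p\<in>\<Delta>. mat4 a b c e (fst p) (snd p) > 0"
    using L by (simp_all add: Xi_def case_prod_beta prod_eq_iff)
  then have chain: "\<And>p p'. p \<in> \<Delta> \<Longrightarrow> p' \<in> \<Delta> \<Longrightarrow> p \<noteq> p' \<Longrightarrow>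
     fst p < fst p' \<and> snd p' < snd p \<or> fst p' < fst p \<and> snd p < snd p'"
    and pos: "\<And>p. p \<in> \<Delta> \<Longrightarrow> mat4 a b c e (fst p) (snd p) > 0"
    by blast+
  have "a + b + c + e = d" using L by (auto simp: Xi_def)
  moreover
  have n: "(1, 1) \<in> \<Delta> \<Longrightarrow> (1, 2) \<notin> \<Delta> \<and> (2, 1) \<notin> \<Delta> \<and> (2, 2) \<notin> \<Delta>"
    "(2, 2) \<in> \<Delta> \<Longrightarrow> (1, 2) \<notin> \<Delta> \<and> (2, 1) \<notin> \<Delta>"
    using chain[of "(1, 1)" "(1, 2)"] chain[of "(1, 1)" "(2, 1)"] chain[of "(1, 1)" "(2, 2)"]
      chain[of "(2, 2)" "(1, 2)"] chain[of "(2, 2)" "(2, 1)"] by auto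
  have "\<Delta> = {} \<or> \<Delta> = {(1, 1)} \<or> \<Delta> = {(1, 2)} \<or> \<Delta> = {(2, 1)} \<or> \<Delta> = {(2, 2)} \<or> \<Delta> = {(1, 2), (2, 1)}"
  proof (cases "(1, 1) \<in> \<Delta>")
    case True
    then have "\<Delta> = {(1, 1)}" using n(1) sub by auto
    then show ?thesis by simp
  next
    case n1: False
    show ?thesis
    proof (cases "(2, 2) \<in> \<Delta>")
      case True
      then have "\<Delta> = {(2, 2)}" using n(2) n1 sub by auto
      then show ?thesis by simp
    next
      case False
      then have "\<Delta> \<subseteq> {(1, 2), (2, 1)}" using n1 sub by auto
      then have "\<Delta> \<in> Pow {(1, 2), (2, 1)}" by simp
      then show ?thesis unfolding Pow_insert by auto
    qed
  qed
  then have "\<Delta> = {} \<or> \<Delta> = {(1, 1)} \<and> a > 0 \<or> \<Delta> = {(1, 2)} \<and> b > 0 \<or> \<Delta> = {(2, 1)} \<and> c > 0 \<or>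
      \<Delta> = {(2, 2)} \<and> e > 0 \<or> \<Delta> = {(1, 2), (2, 1)} \<and> b > 0 \<and> c > 0"
    using pos[of "(1, 1)"] pos[of "(1, 2)"] pos[of "(2, 1)"] pos[of "(2, 2)"] by (elim disjE) auto
  ultimately show ?R by simp
next
  assume R: ?R
  show "(mat4 a b c e, \<Delta>) \<in> Xi d"
    using R unfolding Xi_def by (elim conjE disjE) (auto simp: mat4_def)
qed

lemma finite_Xi: "finite (Xi d)"
proof -
  let ?f = "\<lambda>(a, b, c, e, \<Delta>). (mat4 a b c e, \<Delta>)"
  have "Xi d \<subseteq> ?f ` ({..d} \<times> {..d} \<times> {..d} \<times> {..d} \<times> Pow ({1, 2} \<times> {1, 2}))"
  proof
    fix X assume X: "X \<in> Xi d"
    obtain A \<Delta> where e: "X = (A, \<Delta>)" by (cases X)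
    have "A = mat4 (A 1 1) (A 1 2) (A 2 1) (A 2 2)" using X Xi_mat4 e by blast
    moreover have "A 1 1 \<le> d" "A 1 2 \<le> d" "A 2 1 \<le> d" "A 2 2 \<le> d" "\<Delta> \<subseteq> {1, 2} \<times> {1, 2}"
      using X by (auto simp: e Xi_def)
    ultimately show "X \<in> ?f ` ({..d} \<times> {..d} \<times> {..d} \<times> {..d} \<times> Pow ({1, 2} \<times> {1, 2}))"
      unfolding e by (intro image_eqI[where x = "(A 1 1, A 1 2, A 2 1, A 2 2, \<Delta>)"]) auto
  qed
  then show ?thesis by (rule finite_subset) auto
qed

lemma finite_basis_index: "finite (basis_index A)"
proof -
  have "basis_index A \<subseteq> (\<lambda>(p, m). (fst p, snd p, m)) ` (SIGMA p:{1, 2} \<times> {1, 2}. {1..A (fst p) (snd p)})"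
    by (force simp: basis_index_def)
  then show ?thesis by (rule finite_subset) auto
qed

lemma card_basis_index_if:
  "card {(i, j, m) \<in> basis_index A. P i j} =
     (if P 1 1 then A 1 1 else 0) + (if P 1 2 then A 1 2 else 0)
     + (if P 2 1 then A 2 1 else 0) + (if P 2 2 then A 2 2 else 0)"
proof -
  let ?I = "{p \<in> {1, 2} \<times> {1, 2}. P (fst p) (snd p)}"
  have "bij_betw (\<lambda>(p, m). (fst p, snd p, m)) (SIGMA p:?I. {1..A (fst p) (snd p)})
     {(i, j, m) \<in> basis_index A. P i j}"
    by (rule bij_betwI[where g = "\<lambda>(i, j, m). ((i, j), m)"]) (auto simp: basis_index_def)
  then have "card {(i, j, m) \<in> basis_index A. P i j} = card (SIGMA p:?I. {1..A (fst p) (snd p)})"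
    by (simp add: bij_betw_same_card)
  also have "\<dots> = (\<Sum>p\<in>?I. A (fst p) (snd p))" by simp
  also have "\<dots> = (\<Sum>p\<in>{1, 2} \<times> {1, 2}. if P (fst p) (snd p) then A (fst p) (snd p) else 0)"
    by (rule sum.inter_filter) simp
  also have "{1, 2} \<times> {1, 2} = {(1, 1), (1, 2), (2, 1), (2, 2 :: nat)} \<union> ({} :: (nat \<times> nat) set)" by auto
  finally show ?thesis by (simp add: add.assoc)
qed

locale finite_coord_space = field K
  for K :: "('a, 'b) ring_scheme" (structure) +
  fixes d :: nat
  assumes finite_field: "finite (carrier K)"
begin

abbreviation V :: "('a, nat \<Rightarrow> 'a) module" where "V \<equiv> coord_space K d"

lemma carrier_V: "carrier V = {..<d} \<rightarrow>\<^sub>E carrier K"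
  by (simp add: func_space_def)

sublocale finite_vectorspace K V
proof -
  have "Module.module K V" by (rule func_space_is_module)
  moreover have "finite (carrier V)" unfolding carrier_V by (intro finite_PiE finite_field) auto
  ultimately show "finite_vectorspace K V"
    by (intro finite_vectorspace.intro vectorspace.intro field_axioms finite_vectorspace_axioms.intro finite_field)
qed

lemma card_V: "card (carrier V) = q ^ d"
  unfolding carrier_V by (simp add: card_PiE)

definition flag_of :: "(nat \<Rightarrow> 'a) set \<Rightarrow> nat \<Rightarrow> (nat \<Rightarrow> 'a) set" where
  "flag_of W = restrict (\<lambda>i. if i = 0 then {\<zero>\<^bsub>V\<^esub>} else if i = 1 then W else carrier V) {0, 1, 2}"

abbreviation triple :: "(nat \<Rightarrow> 'a) set \<Rightarrow> (nat \<Rightarrow> 'a) set \<Rightarrow> (nat \<Rightarrow> 'a) \<Rightarrow> 'a triple" where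
  "triple W W' v \<equiv> (flag_of W, flag_of W', v)"

lemma flag_of_simps [simp]:
  "flag_of W 0 = {\<zero>\<^bsub>V\<^esub>}" "flag_of W (Suc 0) = W" "flag_of W 2 = carrier V"
  by (auto simp: flag_of_def)

lemma flags_eq: "flags K d = flag_of ` subspaces"
proof (intro equalityI subsetI)
  fix F assume F: "F \<in> flags K d"
  then have "F 0 = {\<zero>\<^bsub>V\<^esub>}" "F 2 = carrier V" and ext: "F \<in> extensional {0, 1, 2}"
    by (auto simp: flags_def PiE_def)
  then have "F = flag_of (F 1)"
    by (intro extensionalityI[OF ext]) (auto simp: flag_of_def)
  moreover have "F 1 \<in> subspaces" using F by (auto simp: flags_def subspaces_def)
  ultimately show "F \<in> flag_of ` subspaces" by blast
next
  fix F assume "F \<in> flag_of ` subspaces"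
  then obtain W where "W \<in> subspaces" "F = flag_of W" by auto
  then show "F \<in> flags K d"
    using subspaces_zero_space subspaces_carrier_V subspaces_zero[of W] subspaces_subset[of W]
    by (auto simp: flags_def flag_of_def subspaces_def)
qed

lemma inj_flag_of: "inj_on flag_of X"
  by (rule inj_onI) (metis flag_of_simps(2))

lemma sum_flags: "(\<Sum>H\<in>flags K d. f H) = (\<Sum>W\<in>subspaces. f (flag_of W))"
  unfolding flags_eq by (simp add: sum.reindex[OF inj_flag_of])

lemma orbit_cases:
  assumes "t \<in> orbit K d X"
  obtains W W' v where "t = triple W W' v" "W \<in> subspaces" "W' \<in> subspaces" "v \<in> carrier V"
  using assms unfolding orbit_def flags_eq by (auto split: prod.splits)

lemma orbit_iff:
  assumes "W \<in> subspaces" "W' \<in> subspaces" "v \<in> carrier V"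
  shows "triple W W' v \<in> orbit K d (A, \<Delta>) \<longleftrightarrow>
     (\<exists>b. inj_on b (basis_index A) \<and> basis (b ` basis_index A) \<and>
       W = span (b ` {(i, j, m) \<in> basis_index A. i = 1}) \<and>
       W' = span (b ` {(i, j, m) \<in> basis_index A. j = 1}) \<and>
       v = (\<Oplus>\<^bsub>V\<^esub> p\<in>\<Delta>. b (fst p, snd p, 1)))"
proof -
  have e1: "{(i, j, m) \<in> basis_index A. i \<le> 0} = {}" "{(i, j, m) \<in> basis_index A. j \<le> 0} = {}"
    "{(i, j, m) \<in> basis_index A. i \<le> 2} = basis_index A" "{(i, j, m) \<in> basis_index A. j \<le> 2} = basis_index A"
    "{(i, j, m) \<in> basis_index A. i \<le> 1} = {(i, j, m) \<in> basis_index A. i = 1}"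
    "{(i, j, m) \<in> basis_index A. j \<le> 1} = {(i, j, m) \<in> basis_index A. j = 1}"
    by (auto simp: basis_index_def)
  have span_iff: "(\<forall>r\<in>{0, 1, 2}. flag_of W r = span (b ` {(i, j, m) \<in> basis_index A. i \<le> r}))
      \<longleftrightarrow> W = span (b ` {(i, j, m) \<in> basis_index A. i = 1})"
    "(\<forall>r\<in>{0, 1, 2}. flag_of W r = span (b ` {(i, j, m) \<in> basis_index A. j \<le> r}))
      \<longleftrightarrow> W = span (b ` {(i, j, m) \<in> basis_index A. j = 1})"
    if "basis (b ` basis_index A)" for W b
    using that unfolding ball_simps e1 by (auto simp: span_empty basis_def)
  have "flag_of W \<in> flags K d" "flag_of W' \<in> flags K d"
    using assms by (auto simp: flags_eq)
  then show ?thesis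
    unfolding orbit_def prod.case mem_Collect_eq using assms(3)
    by (intro iffI; elim conjE exE; intro conjI exI; (simp only: span_iff)?)
qed

lemma span_union_span:
  assumes "S \<subseteq> carrier V" "S' \<subseteq> carrier V"
  shows "span (span S \<union> span S') = span (S \<union> S')"
proof
  have "span S \<subseteq> span (S \<union> S')" "span S' \<subseteq> span (S \<union> S')" by (auto intro!: span_is_monotone)
  then show "span (span S \<union> span S') \<subseteq> span (S \<union> S')"
    using assms by (intro span_least span_subspaces) auto
  have "S \<subseteq> span S" "S' \<subseteq> span S'" using assms span_mem by auto
  then show "span (S \<union> S') \<subseteq> span (span S \<union> span S')" by (intro span_is_monotone) auto
qed

text \<open>These data are invariant under the group and can be read off from the label through an adapted
  basis; together they determine the label.\<close>

lemma orbit_invariants: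
  assumes X: "(A, \<Delta>) \<in> Xi d" and s: "W \<in> subspaces" "W' \<in> subspaces" "v \<in> carrier V"
    and t: "triple W W' v \<in> orbit K d (A, \<Delta>)"
  shows "card W = q ^ (A 1 1 + A 1 2)" "card W' = q ^ (A 1 1 + A 2 1)"
    "card (span (W \<union> W')) = q ^ (A 1 1 + A 1 2 + A 2 1)"
    "v = \<zero>\<^bsub>V\<^esub> \<longleftrightarrow> \<Delta> = {}" "v \<in> W \<longleftrightarrow> (\<forall>p\<in>\<Delta>. fst p = 1)" "v \<in> W' \<longleftrightarrow> (\<forall>p\<in>\<Delta>. snd p = 1)"
    "v \<in> span (W \<union> W') \<longleftrightarrow> (\<forall>p\<in>\<Delta>. fst p = 1 \<or> snd p = 1)"
    "\<exists>J\<in>subspaces. J \<subseteq> W \<and> J \<subseteq> W' \<and> card J = q ^ A 1 1"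
proof -
  obtain b where b: "inj_on b (basis_index A)" "basis (b ` basis_index A)"
     and W: "W = span (b ` {(i, j, m) \<in> basis_index A. i = 1})"
     and W': "W' = span (b ` {(i, j, m) \<in> basis_index A. j = 1})"
     and v: "v = (\<Oplus>\<^bsub>V\<^esub> p\<in>\<Delta>. b (fst p, snd p, 1))"
    using t unfolding orbit_iff[OF s] by blast
  have li: "lin_indpt (b ` basis_index A)" and car: "b ` basis_index A \<subseteq> carrier V"
    using b(2) by (auto simp: basis_def)
  have fin: "finite \<Delta>" by (rule finite_subset[of _ "{1, 2} \<times> {1, 2}"]) (use X in \<open>auto simp: Xi_def\<close>)
  have idx: "(fst p, snd p, 1) \<in> basis_index A" if "p \<in> \<Delta>" for p
    using X that by (auto simp: Xi_def basis_index_def Suc_le_eq)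
  \<comment> \<open>Index sets cut out by a condition on the position in the matrix; all the spaces in question are spanned this way.\<close>
  define I where "I P = {(i, j, m) \<in> basis_index A. P i j}" for P
  have Isub: "I P \<subseteq> basis_index A" for P by (auto simp: I_def)
  have cardI: "card (span (b ` I P)) = q ^ card (I P)" for P
  proof -
    have "card (span (b ` I P)) = q ^ card (b ` I P)"
      using Isub[of P] car by (intro card_span lin_indpt_subset[OF li]) auto
    also have "card (b ` I P) = card (I P)"
      using inj_on_subset[OF b(1) Isub] by (rule card_image)
    finally show ?thesis .
  qed
  have memI: "v \<in> span (b ` I P) \<longleftrightarrow> (\<forall>p\<in>\<Delta>. P (fst p) (snd p))" for P
  proof -
    have inj: "inj_on (\<lambda>p. b (fst p, snd p, 1)) \<Delta>"
      by (rule inj_onI) (use inj_onD[OF b(1)] idx in \<open>fastforce simp: prod_eq_iff\<close>)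
    have "v \<in> span (b ` I P) \<longleftrightarrow> (\<lambda>p. b (fst p, snd p, 1)) ` \<Delta> \<subseteq> b ` I P"
      unfolding v
    proof (rule finsum_subset_in_span[OF car li fin _ inj])
      show "(\<lambda>p. b (fst p, snd p, 1)) ` \<Delta> \<subseteq> b ` basis_index A" using idx by auto
      show "b ` I P \<subseteq> b ` basis_index A" using Isub by (rule image_mono)
    qed
    also have "\<dots> \<longleftrightarrow> (\<forall>p\<in>\<Delta>. (fst p, snd p, 1) \<in> I P)"
      unfolding image_subset_iff using idx inj_on_image_mem_iff[OF b(1) _ Isub] by simp
    also have "\<dots> \<longleftrightarrow> (\<forall>p\<in>\<Delta>. P (fst p) (snd p))" using idx by (auto simp: I_def)
    finally show ?thesis .
  qed
  have W2: "W = span (b ` I (\<lambda>i j. i = 1))" "W' = span (b ` I (\<lambda>i j. j = 1))"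
    by (simp_all add: W W' I_def)
  have U: "span (W \<union> W') = span (b ` I (\<lambda>i j. i = 1 \<or> j = 1))"
  proof -
    have sub: "b ` I P \<subseteq> carrier V" for P using Isub car by blast
    have "span (W \<union> W') = span (b ` I (\<lambda>i j. i = 1) \<union> b ` I (\<lambda>i j. j = 1))"
      unfolding W2 by (intro span_union_span sub)
    also have "b ` I (\<lambda>i j. i = 1) \<union> b ` I (\<lambda>i j. j = 1) = b ` I (\<lambda>i j. i = 1 \<or> j = 1)"
      unfolding image_Un[symmetric] by (rule arg_cong[of _ _ "image b"]) (auto simp: I_def)
    finally show ?thesis .
  qed
  show "card W = q ^ (A 1 1 + A 1 2)" "card W' = q ^ (A 1 1 + A 2 1)"
    "card (span (W \<union> W')) = q ^ (A 1 1 + A 1 2 + A 2 1)"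
    unfolding U unfolding W2 cardI unfolding I_def card_basis_index_if by simp_all
  have z: "b ` I (\<lambda>i j. False) = {}" by (auto simp: I_def)
  show "v = \<zero>\<^bsub>V\<^esub> \<longleftrightarrow> \<Delta> = {}"
    using memI[of "\<lambda>i j. False"] unfolding z span_empty by auto
  show "v \<in> W \<longleftrightarrow> (\<forall>p\<in>\<Delta>. fst p = 1)" "v \<in> W' \<longleftrightarrow> (\<forall>p\<in>\<Delta>. snd p = 1)"
    "v \<in> span (W \<union> W') \<longleftrightarrow> (\<forall>p\<in>\<Delta>. fst p = 1 \<or> snd p = 1)"
    unfolding U unfolding W2 memI by simp_all
  let ?J = "span (b ` I (\<lambda>i j. i = 1 \<and> j = 1))"
  have "?J \<subseteq> W" "?J \<subseteq> W'" unfolding W2 by (rule span_is_monotone, force simp: I_def)+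
  moreover have "card ?J = q ^ A 1 1" unfolding cardI unfolding I_def card_basis_index_if by simp
  moreover have "?J \<in> subspaces" by (rule span_subspaces) (use Isub car in blast)
  ultimately show "\<exists>J\<in>subspaces. J \<subseteq> W \<and> J \<subseteq> W' \<and> card J = q ^ A 1 1" by blast
qed

text \<open>The cardinalities of \<open>W\<close>, \<open>W'\<close> and \<open>W + W'\<close> together with \<open>d\<close> determine the matrix, and the
  membership of \<open>v\<close> in \<open>0\<close>, \<open>W\<close>, \<open>W'\<close> and \<open>W + W'\<close> distinguishes the six possible sets \<open>\<Delta>\<close>.\<close>

lemma orbit_disjoint:
  assumes X: "X \<in> Xi d" and Y: "Y \<in> Xi d" and t: "t \<in> orbit K d X" "t \<in> orbit K d Y"
  shows "X = Y"
proof -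
  obtain W W' v where e: "t = triple W W' v" and s: "W \<in> subspaces" "W' \<in> subspaces" "v \<in> carrier V"
    using t(1) by (rule orbit_cases)
  obtain a b c e' \<Delta> where X': "X = (mat4 a b c e', \<Delta>)" using Xi_mat4 X by (metis surj_pair)
  obtain a2 b2 c2 e2 \<Delta>2 where Y': "Y = (mat4 a2 b2 c2 e2, \<Delta>2)" using Xi_mat4 Y by (metis surj_pair)
  note i = orbit_invariants[OF X[unfolded X'] s t(1)[unfolded e X']]
  note j = orbit_invariants[OF Y[unfolded Y'] s t(2)[unfolded e Y']]
  have dX: "a + b + c + e' = d" "a2 + b2 + c2 + e2 = d" using X Y by (auto simp: X' Y' Xi_mat4_iff)
  have "a + b = a2 + b2" "a + c = a2 + c2" "a + b + c = a2 + b2 + c2"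
    using i(1-3) j(1-3) by (simp_all add: q_pow_inj)
  then have m: "a = a2" "b = b2" "c = c2" "e' = e2" using dX by linarith+
  have "\<Delta> = {} \<longleftrightarrow> \<Delta>2 = {}" "(\<forall>p\<in>\<Delta>. fst p = 1) \<longleftrightarrow> (\<forall>p\<in>\<Delta>2. fst p = 1)"
    "(\<forall>p\<in>\<Delta>. snd p = 1) \<longleftrightarrow> (\<forall>p\<in>\<Delta>2. snd p = 1)"
    "(\<forall>p\<in>\<Delta>. fst p = 1 \<or> snd p = 1) \<longleftrightarrow> (\<forall>p\<in>\<Delta>2. fst p = 1 \<or> snd p = 1)"
    using i(4-7) j(4-7) by auto
  moreover have "\<Delta> = {} \<or> \<Delta> = {(1, 1)} \<or> \<Delta> = {(1, 2)} \<or> \<Delta> = {(2, 1)} \<or> \<Delta> = {(2, 2)} \<or> \<Delta> = {(1, 2), (2, 1)}"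
    using X by (auto simp: X' Xi_mat4_iff)
  moreover have "\<Delta>2 = {} \<or> \<Delta>2 = {(1, 1)} \<or> \<Delta>2 = {(1, 2)} \<or> \<Delta>2 = {(2, 1)} \<or> \<Delta>2 = {(2, 2)} \<or> \<Delta>2 = {(1, 2), (2, 1)}"
    using Y by (auto simp: Y' Xi_mat4_iff)
  ultimately have "\<Delta> = \<Delta>2" by (elim disjE) simp_all
  with m show ?thesis by (simp add: X' Y')
qed

lemma orbit_nonempty:
  assumes X: "X \<in> Xi d"
  shows "orbit K d X \<noteq> {}"
proof -
  obtain A \<Delta> where X': "X = (A, \<Delta>)" by (cases X)
  obtain C where C: "lin_indpt C" "span C = carrier V" "C \<subseteq> carrier V"
    using basis_extension[OF subspaces_carrier_V empty_subsetI lin_indpt_empty] by metis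
  have "card C = d" using card_span[OF C(3,1)] C(2) card_V q_pow_inj by simp
  moreover have "card (basis_index A) = d"
    using card_basis_index_if[of A "\<lambda>_ _. True"] X by (simp add: X' Xi_def)
  moreover have "finite C" using C(3) finite_vectors finite_subset by auto
  ultimately obtain b where b: "bij_betw b (basis_index A) C"
    using finite_same_card_bij finite_basis_index by metis
  define W W' v where "W = span (b ` {(i, j, m) \<in> basis_index A. i = 1})"
    and "W' = span (b ` {(i, j, m) \<in> basis_index A. j = 1})"
    and "v = (\<Oplus>\<^bsub>V\<^esub> p\<in>\<Delta>. b (fst p, snd p, 1))"
  have bc: "b x \<in> carrier V" if "x \<in> basis_index A" for x
    using b C(3) that bij_betwE by blast
  have "(fst p, snd p, 1) \<in> basis_index A" if "p \<in> \<Delta>" for p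
    using X that by (auto simp: X' Xi_def basis_index_def Suc_le_eq)
  then have "v \<in> carrier V" unfolding v_def using bc by (intro finsum_closed) auto
  moreover have "W \<in> subspaces" "W' \<in> subspaces" unfolding W_def W'_def using bc by (auto intro!: span_subspaces)
  moreover have "basis C" using C by (simp add: basis_def)
  ultimately have "triple W W' v \<in> orbit K d (A, \<Delta>)"
    using b by (subst orbit_iff) (auto simp: bij_betw_def W_def W'_def v_def)
  then show ?thesis by (auto simp: X')
qed

text \<open>An adapted basis may be given as four disjoint blocks \<open>\<beta> i j\<close>, each with a distinguished vector if its
  position belongs to \<open>\<Delta>\<close>: one enumerates each block so that this vector comes first.\<close>

lemma orbitI:
  assumes X: "(A, \<Delta>) \<in> Xi d" and s: "W \<in> subspaces" "W' \<in> subspaces" "v \<in> carrier V"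
    and card: "\<And>i j. i \<in> {1, 2} \<Longrightarrow> j \<in> {1, 2} \<Longrightarrow> card (\<beta> i j) = A i j"
    and disj: "\<And>i j i' j'. i \<in> {1, 2} \<Longrightarrow> j \<in> {1, 2} \<Longrightarrow> i' \<in> {1, 2} \<Longrightarrow> j' \<in> {1, 2} \<Longrightarrow>
      (i, j) \<noteq> (i', j') \<Longrightarrow> \<beta> i j \<inter> \<beta> i' j' = {}"
    and bas: "basis (\<beta> 1 1 \<union> \<beta> 1 2 \<union> \<beta> 2 1 \<union> \<beta> 2 2)"
    and W: "W = span (\<beta> 1 1 \<union> \<beta> 1 2)" and W': "W' = span (\<beta> 1 1 \<union> \<beta> 2 1)"
    and w: "\<And>p. p \<in> \<Delta> \<Longrightarrow> w p \<in> \<beta> (fst p) (snd p)" and v: "v = (\<Oplus>\<^bsub>V\<^esub> p\<in>\<Delta>. w p)"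
  shows "triple W W' v \<in> orbit K d (A, \<Delta>)"
proof -
  have car: "\<beta> 1 1 \<union> \<beta> 1 2 \<union> \<beta> 2 1 \<union> \<beta> 2 2 \<subseteq> carrier V" using bas by (simp add: basis_def)
  have fin: "finite (\<beta> i j)" if "i \<in> {1, 2}" "j \<in> {1, 2}" for i j
    by (rule finite_subset[OF _ finite_vectors]) (use that car in auto)
  have D: "\<Delta> \<subseteq> {1, 2} \<times> {1, 2}" using X by (auto simp: Xi_def)
  have "\<exists>h. bij_betw h {1..A i j} (\<beta> i j) \<and> ((i, j) \<in> \<Delta> \<longrightarrow> h 1 = w (i, j))"
    if "i \<in> {1, 2}" "j \<in> {1, 2}" for i j
  proof (cases "(i, j) \<in> \<Delta>")
    case True
    then show ?thesis
      using ex_bij_betw_first[OF fin[OF that], of "w (i, j)"] w[of "(i, j)"] card[OF that] by auto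
  next
    case False
    then show ?thesis
      using ex_bij_betw_nat_finite_1[OF fin[OF that]] card[OF that] by auto
  qed
  then obtain h where h: "\<And>i j. i \<in> {1, 2} \<Longrightarrow> j \<in> {1, 2} \<Longrightarrow> bij_betw (h i j) {1..A i j} (\<beta> i j)"
    "\<And>i j. i \<in> {1, 2} \<Longrightarrow> j \<in> {1, 2} \<Longrightarrow> (i, j) \<in> \<Delta> \<Longrightarrow> h i j 1 = w (i, j)"
    by metis
  define b where "b = (\<lambda>(i, j, m). h i j m)"
  have img: "h i j ` {1..A i j} = \<beta> i j" if "i \<in> {1, 2}" "j \<in> {1, 2}" for i j
    using h(1)[OF that] by (simp add: bij_betw_def)
  have mem: "h i j m \<in> \<beta> i j" if "(i, j, m) \<in> basis_index A" for i j m
    using that img[of i j] by (auto simp: basis_index_def)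
  have inj: "inj_on b (basis_index A)"
  proof (rule inj_onI)
    fix x y assume xy: "x \<in> basis_index A" "y \<in> basis_index A" "b x = b y"
    obtain i j m i' j' m' where e: "x = (i, j, m)" "y = (i', j', m')" by (metis prod_cases3)
    note * = xy[unfolded e]
    then have "\<beta> i j \<inter> \<beta> i' j' \<noteq> {}"
      using mem[OF *(1)] mem[OF *(2)] by (auto simp: b_def)
    then have eq: "(i, j) = (i', j')" using disj[of i j i' j'] * by (auto simp: basis_index_def)
    have ij: "i \<in> {1, 2}" "j \<in> {1, 2}" using * by (auto simp: basis_index_def)
    have "m = m'"
      using * eq inj_onD[OF bij_betw_imp_inj_on[OF h(1)[OF ij]], of m m'] by (auto simp: b_def basis_index_def)
    with eq show "x = y" by (simp add: e)
  qed
  have image: "b ` {(i, j, m) \<in> basis_index A. P i j} = (\<Union>i\<in>{1, 2}. \<Union>j\<in>{1, 2}. if P i j then \<beta> i j else {})" for P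
  proof (intro equalityI subsetI)
    fix x assume "x \<in> b ` {(i, j, m) \<in> basis_index A. P i j}"
    then obtain i j m where "(i, j, m) \<in> basis_index A" "P i j" "x = h i j m" by (auto simp: b_def)
    then show "x \<in> (\<Union>i\<in>{1, 2}. \<Union>j\<in>{1, 2}. if P i j then \<beta> i j else {})"
      using mem[of i j m] by (auto simp: basis_index_def)
  next
    fix x assume "x \<in> (\<Union>i\<in>{1, 2}. \<Union>j\<in>{1, 2}. if P i j then \<beta> i j else {})"
    then obtain i j where ij: "i \<in> {1, 2}" "j \<in> {1, 2}" "P i j" "x \<in> \<beta> i j"
      by (auto split: if_splits)
    then obtain m where "m \<in> {1..A i j}" "x = h i j m" using img[of i j] by blast
    then show "x \<in> b ` {(i, j, m) \<in> basis_index A. P i j}"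
      using ij by (intro image_eqI[where x = "(i, j, m)"]) (auto simp: b_def basis_index_def)
  qed
  have "b ` basis_index A = \<beta> 1 1 \<union> \<beta> 1 2 \<union> \<beta> 2 1 \<union> \<beta> 2 2"
    using image[of "\<lambda>_ _. True"] by (simp add: Un_assoc)
  moreover have "b ` {(i, j, m) \<in> basis_index A. i = 1} = \<beta> 1 1 \<union> \<beta> 1 2"
    "b ` {(i, j, m) \<in> basis_index A. j = 1} = \<beta> 1 1 \<union> \<beta> 2 1"
    unfolding image by auto
  moreover have "v = (\<Oplus>\<^bsub>V\<^esub> p\<in>\<Delta>. b (fst p, snd p, 1))"
  proof -
    have "w p \<in> carrier V" if "p \<in> \<Delta>" for p
    proof -
      have "fst p \<in> {1, 2}" "snd p \<in> {1, 2}" using D that by auto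
      then have "\<beta> (fst p) (snd p) \<subseteq> carrier V" using car by auto
      then show ?thesis using w[OF that] by auto
    qed
    then show ?thesis
      unfolding v using h(2) D by (intro finsum_cong') (auto simp: b_def)
  qed
  ultimately show ?thesis
    unfolding orbit_iff[OF s] using inj bas W W' by (intro exI[of _ b]) simp
qed

text \<open>The subspaces among which the vector of a triple with \<open>W' \<subseteq> W\<close> is located: \<open>0 \<subseteq> W' \<subseteq> W\<close>.\<close>

definition level :: "nat \<Rightarrow> (nat \<Rightarrow> 'a) set \<Rightarrow> (nat \<Rightarrow> 'a) set \<Rightarrow> (nat \<Rightarrow> 'a) set" where
  "level j W W' = (if j = 0 then {\<zero>\<^bsub>V\<^esub>} else if j = 1 then W' else W)"

text \<open>The vector \<open>v\<close> is put into the basis at the first stage of the chain \<open>W' \<subseteq> W \<subseteq> V\<close> that contains it.\<close>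

lemma adapted_bases:
  assumes s: "W \<in> subspaces" "W' \<in> subspaces" "W' \<subseteq> W" and v: "v \<in> W"
  obtains B' B C where "B' \<subseteq> B" "B \<subseteq> C" "basis C" "span B' = W'" "span B = W"
    "v \<in> W' \<Longrightarrow> v \<noteq> \<zero>\<^bsub>V\<^esub> \<Longrightarrow> v \<in> B'" "v \<notin> W' \<Longrightarrow> v \<in> B - B'"
proof -
  have vc: "v \<in> carrier V" using s(1) v subspaces_carrier by auto
  obtain B' where B': "B' \<subseteq> W'" "lin_indpt B'" "span B' = W'" "v \<in> W' \<Longrightarrow> v \<noteq> \<zero>\<^bsub>V\<^esub> \<Longrightarrow> v \<in> B'"
  proof (cases "v \<in> W' \<and> v \<noteq> \<zero>\<^bsub>V\<^esub>")
    case True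
    then have "lin_indpt (insert v {})"
      using vc by (intro lin_indpt_insert lin_indpt_empty) (auto simp: span_empty)
    then obtain B' where "insert v {} \<subseteq> B'" "B' \<subseteq> W'" "lin_indpt B'" "span B' = W'"
      using basis_extension[OF s(2), of "insert v {}"] True by auto
    then show ?thesis using that[of B'] by simp
  next
    case False
    then show ?thesis
      using basis_extension[OF s(2) empty_subsetI lin_indpt_empty] that by metis
  qed
  have car: "B' \<subseteq> carrier V" using B'(1) subspaces_subset[OF s(2)] by simp
  obtain B where B: "B' \<subseteq> B" "B \<subseteq> W" "lin_indpt B" "span B = W" "v \<notin> W' \<Longrightarrow> v \<in> B"
  proof (cases "v \<in> W'")
    case True
    have "B' \<subseteq> W" using B'(1) s(3) by simp
    from basis_extension[OF s(1) this B'(2)] show ?thesis using that True by metis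
  next
    case False
    have "insert v B' \<subseteq> W" using B'(1) s(3) v by simp
    moreover have "lin_indpt (insert v B')"
      using False B' by (intro lin_indpt_insert[OF car _ vc]) auto
    ultimately obtain B where "insert v B' \<subseteq> B" "B \<subseteq> W" "lin_indpt B" "span B = W"
      using basis_extension[OF s(1)] by metis
    then show ?thesis using that[of B] by simp
  qed
  have "B \<subseteq> carrier V" using B(2) subspaces_subset[OF s(1)] by simp
  then obtain C where C: "B \<subseteq> C" "C \<subseteq> carrier V" "lin_indpt C" "span C = carrier V"
    using basis_extension[OF subspaces_carrier_V _ B(3)] by metis
  have "v \<notin> B'" if "v \<notin> W'" using B'(1) that by auto
  moreover have "basis C" using C by (simp add: basis_def)
  ultimately show thesis using that[of B' B C] B' B C by auto
qed

text \<open>For a label with \<open>a\<^sub>2\<^sub>1 = 0\<close> the orbit consists of nested pairs, and the three possible sets \<open>\<Delta>\<close> that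
  avoid the position \<open>(2, 2)\<close> correspond to the position of \<open>v\<close> in the chain \<open>0 \<subseteq> W' \<subseteq> W\<close>. Membership
  of the label in \<open>Xi d\<close> is part of the left side because degenerate parameters yield no label,
  while the right side is then unsatisfiable.\<close>

lemma orbit_chain_iff:
  assumes s: "W \<in> subspaces" "W' \<in> subspaces" "v \<in> carrier V"
    and \<Delta>: "\<Delta> \<in> {{}, {(1, 1)}, {(1, 2)}}"
  shows "(mat4 r k 0 (d - r - k), \<Delta>) \<in> Xi d \<and>
      triple W W' v \<in> orbit K d (mat4 r k 0 (d - r - k), \<Delta>) \<longleftrightarrow>
    W' \<subseteq> W \<and> card W' = q ^ r \<and> card W = q ^ (r + k) \<and>
    (if \<Delta> = {} then v = \<zero>\<^bsub>V\<^esub> else if \<Delta> = {(1, 1)} then v \<in> W' \<and> v \<noteq> \<zero>\<^bsub>V\<^esub> else v \<in> W \<and> v \<notin> W')"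
    (is "?L \<longleftrightarrow> ?R")
proof
  let ?A = "mat4 r k 0 (d - r - k)"
  assume ?L
  then have X: "(?A, \<Delta>) \<in> Xi d" and t: "triple W W' v \<in> orbit K d (?A, \<Delta>)" by auto
  note i = orbit_invariants[OF X s t]
  have sub: "W \<union> W' \<subseteq> span (W \<union> W')" using span_mem[of "W \<union> W'"] s subspaces_subset by blast
  have "span (W \<union> W') \<in> subspaces" using s subspaces_subset by (intro span_subspaces) auto
  then have "W = span (W \<union> W')" using i(1,3) sub by (intro subspaces_eqI) auto
  then have "W' \<subseteq> W" using sub by auto
  then show ?R using i \<Delta> by auto
next
  let ?A = "mat4 r k 0 (d - r - k)"
  assume R: ?R
  have v: "v \<in> W" using R subspaces_zero[OF s(1)] by (auto split: if_splits)
  obtain B' B C where B: "B' \<subseteq> B" "B \<subseteq> C" "basis C" "span B' = W'" "span B = W"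
    "v \<in> W' \<Longrightarrow> v \<noteq> \<zero>\<^bsub>V\<^esub> \<Longrightarrow> v \<in> B'" "v \<notin> W' \<Longrightarrow> v \<in> B - B'"
    using adapted_bases[OF s(1,2) _ v] R by metis
  have C: "C \<subseteq> carrier V" "lin_indpt C" "span C = carrier V" using B(3) by (auto simp: basis_def)
  have fin: "finite C" using C(1) finite_vectors finite_subset by auto
  have cards: "card (span S) = q ^ card S" if "S \<subseteq> C" for S
    using that C by (intro card_span lin_indpt_subset[OF C(2)]) auto
  have "card B' = r" using cards[of B'] B R q_pow_inj by auto
  moreover have "card B = r + k" using cards[of B] B R q_pow_inj by auto
  moreover have "card C = d" using cards[of C] C(3) card_V q_pow_inj by auto
  ultimately have c: "card B' = r" "card (B - B') = k" "card (C - B) = d - r - k" "r + k \<le> d"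
    using B(1,2) fin card_mono[OF fin B(2)]
    by (auto simp: card_Diff_subset finite_subset)
  have r0: "r > 0" if "v \<in> W'" "v \<noteq> \<zero>\<^bsub>V\<^esub>"
    using B(6)[OF that] c(1) fin B(1,2) by (metis card_gt_0_iff empty_iff finite_subset)
  have k0: "k > 0" if "v \<notin> W'"
    using B(7)[OF that] c(2) fin B(2) by (metis card_gt_0_iff empty_iff finite_subset finite_Diff)
  have X: "(?A, \<Delta>) \<in> Xi d"
    using \<Delta> R r0 k0 c(4) by (auto simp: Xi_mat4_iff split: if_splits)
  define \<beta> where "\<beta> = (\<lambda>(i::nat) (j::nat). if i = 1 \<and> j = 1 then B' else if i = 1 \<and> j = 2 then B - B'
     else if i = 2 \<and> j = 2 then C - B else ({} :: (nat \<Rightarrow> 'a) set))"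
  have "triple W W' v \<in> orbit K d (?A, \<Delta>)"
  proof (rule orbitI[OF X s, where \<beta> = \<beta> and w = "\<lambda>_. v"])
    show "card (\<beta> i j) = ?A i j" if "i \<in> {1, 2}" "j \<in> {1, 2}" for i j
      using that c by (auto simp: \<beta>_def)
    show "\<beta> i j \<inter> \<beta> i' j' = {}" if "i \<in> {1, 2}" "j \<in> {1, 2}" "i' \<in> {1, 2}" "j' \<in> {1, 2}" "(i, j) \<noteq> (i', j')" for i j i' j'
      using that B(1,2) by (auto simp: \<beta>_def)
    have "\<beta> 1 1 \<union> \<beta> 1 2 \<union> \<beta> 2 1 \<union> \<beta> 2 2 = C" using B(1,2) by (auto simp: \<beta>_def)
    then show "basis (\<beta> 1 1 \<union> \<beta> 1 2 \<union> \<beta> 2 1 \<union> \<beta> 2 2)" using B(3) by simp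
    have "\<beta> 1 1 \<union> \<beta> 1 2 = B" using B(1) by (auto simp: \<beta>_def)
    then show "W = span (\<beta> 1 1 \<union> \<beta> 1 2)" using B by simp
    show "W' = span (\<beta> 1 1 \<union> \<beta> 2 1)" using B by (simp add: \<beta>_def)
    show "v \<in> \<beta> (fst p) (snd p)" if "p \<in> \<Delta>" for p
      using that \<Delta> R B(6,7) by (auto simp: \<beta>_def)
    show "v = (\<Oplus>\<^bsub>V\<^esub> p\<in>\<Delta>. v)"
      using \<Delta> R s(3) by (auto)
  qed
  with X show ?L by simp
qed

text \<open>This is the orbit that contributes the off-diagonal terms of \<open>ef\<close> and \<open>fe\<close>. The adapted basis consists
  of a basis of the common hyperplane, one further vector for each of the two spaces, and a completion.\<close>

lemma orbit_crossing_iff: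
  assumes s: "W \<in> subspaces" "W' \<in> subspaces" "v \<in> carrier V"
  shows "(mat4 r 1 1 (d - r - 2), {}) \<in> Xi d \<and>
      triple W W' v \<in> orbit K d (mat4 r 1 1 (d - r - 2), {}) \<longleftrightarrow>
    W \<noteq> W' \<and> card W = q ^ (r + 1) \<and> card W' = q ^ (r + 1) \<and> v = \<zero>\<^bsub>V\<^esub> \<and> hyperplanes W \<inter> hyperplanes W' \<noteq> {}"
    (is "?L \<longleftrightarrow> ?R")
proof
  let ?A = "mat4 r 1 1 (d - r - 2)"
  assume ?L
  then have X: "(?A, {}) \<in> Xi d" and t: "triple W W' v \<in> orbit K d (?A, {})" by auto
  note i = orbit_invariants[OF X s t]
  obtain J where J: "J \<in> subspaces" "J \<subseteq> W" "J \<subseteq> W'" "card J = q ^ r" using i(8) by auto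
  have "W \<noteq> W'"
  proof
    assume "W = W'"
    moreover have "span W = W" using s span_least[of W W] span_mem[of W] subspaces_subset by auto
    ultimately have "q ^ (r + 1) = q ^ (r + 2)" using i(1,3) by simp
    then show False unfolding q_pow_inj by simp
  qed
  moreover have "J \<in> hyperplanes W \<inter> hyperplanes W'" using J i(1,2) by (auto simp: hyperplanes_def)
  ultimately show ?R using i(1,2,4) by auto
next
  let ?A = "mat4 r 1 1 (d - r - 2)"
  assume R: ?R
  then obtain J where "J \<in> hyperplanes W \<inter> hyperplanes W'" by auto
  then have J: "J \<in> subspaces" "J \<subseteq> W" "J \<subseteq> W'" "card W = q * card J" by (auto simp: hyperplanes_def)
  have "\<not> W \<subseteq> W'" "\<not> W' \<subseteq> W" using R subspaces_eqI[OF s(2), of W] subspaces_eqI[OF s(1), of W'] by auto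
  then obtain x y where xy: "x \<in> W" "x \<notin> W'" "y \<in> W'" "y \<notin> W" by auto
  have c: "x \<in> carrier V" "y \<in> carrier V" using xy s subspaces_carrier by auto
  have W: "W = adjoin J x" and W': "W' = adjoin J y"
    using adjoin_eq[OF s(1) J(1,2,4) xy(1)] adjoin_eq[OF s(2) J(1,3) _ xy(3)] J R xy by auto
  obtain B where B: "B \<subseteq> J" "lin_indpt B" "span B = J"
    using basis_extension[OF J(1) empty_subsetI lin_indpt_empty] by metis
  have Bc: "B \<subseteq> carrier V" using B(1) subspaces_subset[OF J(1)] by simp
  have sx: "span (insert x B) = W" and sy: "span (insert y B) = W'"
    using B Bc c by (simp_all add: span_insert W W')
  have lx: "lin_indpt (insert x B)" using B J xy by (intro lin_indpt_insert Bc c) auto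
  have lxy: "lin_indpt (insert y (insert x B))" using sx xy Bc c by (intro lin_indpt_insert[OF _ lx]) auto
  obtain C where C: "insert y (insert x B) \<subseteq> C" "C \<subseteq> carrier V" "lin_indpt C" "span C = carrier V"
    using basis_extension[OF subspaces_carrier_V _ lxy] Bc c by auto
  have fin: "finite C" using C(2) finite_vectors finite_subset by auto
  have nB: "x \<notin> B" "y \<notin> B" "x \<noteq> y" using xy B J by auto
  have "card J = q ^ r" using J(4) R q_ge_2 by simp
  then have cB: "card B = r" using card_span[OF Bc B(2)] B(3) q_pow_inj by simp
  have cC: "card C = d" using card_span[OF C(2,3)] C(4) card_V q_pow_inj by simp
  have finB: "finite B" using C(1) fin finite_subset by auto
  have "card (insert y (insert x B)) = r + 2" using nB cB finB by simp
  then have e: "card (C - insert y (insert x B)) = d - r - 2" "r + 2 \<le> d"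
    using cC C(1) card_mono[OF fin C(1)] finB by (auto simp: card_Diff_subset)
  have X: "(?A, {}) \<in> Xi d" using e(2) by (simp add: Xi_mat4_iff)
  define \<beta> where "\<beta> = (\<lambda>(i::nat) (j::nat). if i = 1 \<and> j = 1 then B else if i = 1 \<and> j = 2 then {x}
     else if i = 2 \<and> j = 1 then {y}
     else if i = 2 \<and> j = 2 then C - insert y (insert x B) else ({} :: (nat \<Rightarrow> 'a) set))"
  have "triple W W' v \<in> orbit K d (?A, {})"
  proof (rule orbitI[OF X s, where \<beta> = \<beta> and w = "\<lambda>_. v"])
    show "card (\<beta> i j) = ?A i j" if "i \<in> {1, 2}" "j \<in> {1, 2}" for i j
      using that e cB by (auto simp: \<beta>_def)
    show "\<beta> i j \<inter> \<beta> i' j' = {}" if "i \<in> {1, 2}" "j \<in> {1, 2}" "i' \<in> {1, 2}" "j' \<in> {1, 2}" "(i, j) \<noteq> (i', j')" for i j i' j'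
      using that nB by (auto simp: \<beta>_def)
    have "\<beta> 1 1 \<union> \<beta> 1 2 \<union> \<beta> 2 1 \<union> \<beta> 2 2 = C" using C(1) by (auto simp: \<beta>_def)
    then show "basis (\<beta> 1 1 \<union> \<beta> 1 2 \<union> \<beta> 2 1 \<union> \<beta> 2 2)" using C by (simp add: basis_def)
    show "W = span (\<beta> 1 1 \<union> \<beta> 1 2)" "W' = span (\<beta> 1 1 \<union> \<beta> 2 1)"
      using sx sy by (simp_all add: \<beta>_def)
    show "v = (\<Oplus>\<^bsub>V\<^esub> p\<in>{}. v)" using R by simp
  qed auto
  with X show ?L by simp
qed

end

section \<open>From counting over finite fields to the generic algebra\<close>

text \<open>A family of coefficients, one integer polynomial for each label, gives an invariant function over
  every finite field, by evaluation at \<open>q\<close>, and an element of the generic algebra, by evaluation at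
  \<open>\<^bold>v\<^sup>2\<close>.\<close>

type_synonym vec = "label \<Rightarrow> int poly"

definition fin_elt :: "('a, 'b) ring_scheme \<Rightarrow> nat \<Rightarrow> vec \<Rightarrow> 'a triple \<Rightarrow> complex" where
  "fin_elt K d c t = (\<Sum>Z\<in>Xi d. of_int (poly (c Z) (int (card (carrier K)))) * T_fin K d Z t)"

definition gen_elt :: "nat \<Rightarrow> vec \<Rightarrow> generic" where
  "gen_elt d c = (\<Sum>Z\<in>Xi d. poly (map_poly of_int (c Z)) (vv ^ 2) *\<^sub>v T Z)"

definition triples :: "('a, 'b) ring_scheme \<Rightarrow> nat \<Rightarrow> 'a triple set" where
  "triples K d = flags K d \<times> flags K d \<times> carrier (coord_space K d)"

definition convolves_to :: "nat \<Rightarrow> vec \<Rightarrow> vec \<Rightarrow> vec \<Rightarrow> bool" where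
  "convolves_to d a b c \<longleftrightarrow> (\<forall>K :: nat ring. field K \<longrightarrow> finite (carrier K) \<longrightarrow>
     (\<forall>t\<in>triples K d. convolution K d (fin_elt K d a) (fin_elt K d b) t = fin_elt K d c t))"

definition unit_vec :: "label \<Rightarrow> vec" where
  "unit_vec X = (\<lambda>Z. if Z = X then 1 else 0)"

definition prefix_sum :: "(nat \<Rightarrow> label) \<Rightarrow> nat \<Rightarrow> vec" where
  "prefix_sum X i = (\<lambda>Z. \<Sum>k\<le>i. unit_vec (X k) Z)"

subsection \<open>Uniqueness of the structure polynomials\<close>

text \<open>The residue rings modulo primes, transported from integers to natural numbers, suffice to determine
  a polynomial.\<close>

lemma prime_field_exists:
  assumes "prime p"
  shows "\<exists>K :: nat ring. field K \<and> finite (carrier K) \<and> card (carrier K) = p"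
proof -
  interpret residues_prime p "residue_ring (int p)"
    using assms by unfold_locales auto
  let ?R = "residue_ring (int p)"
  let ?S = "\<lparr>carrier = nat ` carrier ?R, monoid.mult = (\<lambda>x y. nat (int x \<otimes>\<^bsub>?R\<^esub> int y)), monoid.one = nat \<one>\<^bsub>?R\<^esub>,
    ring.zero = nat \<zero>\<^bsub>?R\<^esub>, ring.add = (\<lambda>x y. nat (int x \<oplus>\<^bsub>?R\<^esub> int y))\<rparr> :: nat ring"
  have car: "carrier ?R = {0..int p - 1}" by (simp add: residue_ring_def)
  have inj: "inj_on nat (carrier ?R)" by (auto simp: inj_on_def car)
  have "nat \<in> ring_iso ?R ?S"
    unfolding ring_iso_def ring_hom_def using inj by (auto simp: bij_betw_def car)
  then have "field (?S \<lparr>zero := nat \<zero>\<^bsub>?R\<^esub>\<rparr>)"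
    by (rule field.ring_iso_imp_img_field[OF is_field])
  then have "field ?S" by simp
  moreover have "finite (carrier ?S)" "card (carrier ?S) = p"
    using card_image[OF inj] by (simp_all add: car)
  ultimately show ?thesis by blast
qed

lemma int_poly_eqI:
  fixes f g :: "int poly"
  assumes "\<And>K :: nat ring. field K \<Longrightarrow> finite (carrier K) \<Longrightarrow>
    poly f (int (card (carrier K))) = poly g (int (card (carrier K)))"
  shows "f = g"
proof -
  have "int ` {p. prime p} \<subseteq> {x. poly (f - g) x = 0}"
    using prime_field_exists assms by (auto simp: image_subset_iff)
  moreover have "infinite (int ` {p :: nat. prime p})"
    by (simp add: finite_image_iff primes_infinite)
  ultimately have "infinite {x. poly (f - g) x = 0}" using finite_subset by blast
  then have "f - g = 0" using poly_roots_finite by blast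
  then show ?thesis by simp
qed

lemma finite_coord_spaceI: "field K \<Longrightarrow> finite (carrier K) \<Longrightarrow> finite_coord_space K"
  by (simp add: finite_coord_space_def finite_coord_space_axioms_def)

lemma orbit_subset_triples: "orbit K d X \<subseteq> triples K d"
  by (auto simp: orbit_def triples_def)

lemma fin_elt_at_orbit:
  assumes "field K" "finite (carrier K)" "Z \<in> Xi d" "t \<in> orbit K d Z"
  shows "fin_elt K d c t = of_int (poly (c Z) (int (card (carrier K))))"
proof -
  interpret finite_coord_space K d by (rule finite_coord_spaceI) (use assms in auto)
  have "T_fin K d Z' t = (if Z' = Z then 1 else 0)" if "Z' \<in> Xi d" for Z'
    using assms(4) orbit_disjoint[OF that assms(3) _ assms(4)]
    by (cases "t \<in> orbit K d Z'") (auto simp: T_fin_def)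
  then have "fin_elt K d c t =
    (\<Sum>Z'\<in>Xi d. if Z' = Z then of_int (poly (c Z') (int (card (carrier K)))) else 0)"
    unfolding fin_elt_def by (intro sum.cong) auto
  then show ?thesis
    using assms(3) finite_Xi by simp
qed

lemma convolves_to_unique:
  assumes "convolves_to d a b c" "convolves_to d a b c'" "Z \<in> Xi d"
  shows "c Z = c' Z"
proof (rule int_poly_eqI)
  fix K :: "nat ring" assume K: "field K" "finite (carrier K)"
  interpret finite_coord_space K d by (rule finite_coord_spaceI) (use K in auto)
  obtain t where t: "t \<in> orbit K d Z" using orbit_nonempty[OF assms(3)] by auto
  then have "t \<in> triples K d" using orbit_subset_triples by blast
  then have "fin_elt K d c t = fin_elt K d c' t"
    using assms(1,2) K unfolding convolves_to_def by metis
  then show "poly (c Z) (int (card (carrier K))) = poly (c' Z) (int (card (carrier K)))"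
    unfolding fin_elt_at_orbit[OF K assms(3) t] by simp
qed

lemma fin_elt_unit_vec:
  "fin_elt K d (unit_vec X) = (if X \<in> Xi d then T_fin K d X else (\<lambda>t. 0))"
proof
  fix t
  have "fin_elt K d (unit_vec X) t = (\<Sum>Z\<in>Xi d. if Z = X then T_fin K d X t else 0)"
    unfolding fin_elt_def unit_vec_def by (intro sum.cong) auto
  then show "fin_elt K d (unit_vec X) t = (if X \<in> Xi d then T_fin K d X else (\<lambda>t. 0)) t"
    using finite_Xi by (simp add: sum.delta)
qed

text \<open>Evaluation at points of the orbit of \<open>Z\<close> extracts the coefficient at \<open>Z\<close>, and nonempty orbits over
  infinitely many fields leave no choice for the polynomial.\<close>

lemma structure_poly_eq:
  assumes "X \<in> Xi d" "Y \<in> Xi d" "Z \<in> Xi d" and r: "convolves_to d (unit_vec X) (unit_vec Y) c"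
  shows "structure_poly d X Y Z = c Z"
  unfolding structure_poly_def
proof (rule the_equality)
  show "\<forall>K :: nat ring. field K \<longrightarrow> finite (carrier K) \<longrightarrow>
     (\<forall>t\<in>orbit K d Z. convolution K d (T_fin K d X) (T_fin K d Y) t =
        of_int (poly (c Z) (int (card (carrier K)))))"
  proof (intro allI impI ballI)
    fix K :: "nat ring" and t assume K: "field K" "finite (carrier K)" and t: "t \<in> orbit K d Z"
    then have "t \<in> triples K d" using orbit_subset_triples by blast
    then have "convolution K d (T_fin K d X) (T_fin K d Y) t = fin_elt K d c t"
      using r K assms(1,2) by (simp add: convolves_to_def fin_elt_unit_vec)
    then show "convolution K d (T_fin K d X) (T_fin K d Y) t = of_int (poly (c Z) (int (card (carrier K))))"
      using fin_elt_at_orbit[OF K assms(3) t] by simp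
  qed
next
  fix f :: "int poly"
  assume f: "\<forall>K :: nat ring. field K \<longrightarrow> finite (carrier K) \<longrightarrow>
     (\<forall>t\<in>orbit K d Z. convolution K d (T_fin K d X) (T_fin K d Y) t =
        of_int (poly f (int (card (carrier K)))))"
  show "f = c Z"
  proof (rule int_poly_eqI)
    fix K :: "nat ring" assume K: "field K" "finite (carrier K)"
    interpret finite_coord_space K d by (rule finite_coord_spaceI) (use K in auto)
    obtain t where t: "t \<in> orbit K d Z" using orbit_nonempty[OF assms(3)] by auto
    then have "t \<in> triples K d" using orbit_subset_triples by blast
    then have "convolution K d (T_fin K d X) (T_fin K d Y) t = fin_elt K d c t"
      using r K assms(1,2) by (simp add: convolves_to_def fin_elt_unit_vec)
    then show "poly f (int (card (carrier K))) = poly (c Z) (int (card (carrier K)))"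
      using fin_elt_at_orbit[OF K assms(3) t] f K t by simp
  qed
qed

subsection \<open>Linearity\<close>

lemma fin_elt_diff: "fin_elt K d (\<lambda>Z. a Z - b Z) t = fin_elt K d a t - fin_elt K d b t"
  by (simp add: fin_elt_def sum_subtractf algebra_simps)

lemma fin_elt_sum: "fin_elt K d (\<lambda>Z. \<Sum>i\<in>I. a i Z) t = (\<Sum>i\<in>I. fin_elt K d (a i) t)"
  unfolding fin_elt_def by (subst sum.swap) (simp add: poly_sum sum_distrib_right)

lemma fin_elt_mult: "fin_elt K d (\<lambda>Z. f * a Z) t = of_int (poly f (int (card (carrier K)))) * fin_elt K d a t"
  by (simp add: fin_elt_def sum_distrib_left mult_ac)

lemma fin_elt_add: "fin_elt K d (\<lambda>Z. a Z + b Z) t = fin_elt K d a t + fin_elt K d b t"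
  by (simp add: fin_elt_def sum.distrib algebra_simps)

lemma convolves_to_diff_left:
  assumes "convolves_to d a b c" "convolves_to d a' b c'"
  shows "convolves_to d (\<lambda>Z. a Z - a' Z) b (\<lambda>Z. c Z - c' Z)"
  unfolding convolves_to_def
proof (intro allI impI ballI)
  fix K :: "nat ring" and t assume K: "field K" "finite (carrier K)" and t: "t \<in> triples K d"
  have "convolution K d (fin_elt K d (\<lambda>Z. a Z - a' Z)) (fin_elt K d b) t =
    convolution K d (fin_elt K d a) (fin_elt K d b) t - convolution K d (fin_elt K d a') (fin_elt K d b) t"
    unfolding convolution_def by (simp add: fin_elt_diff sum_subtractf left_diff_distrib split: prod.splits)
  then show "convolution K d (fin_elt K d (\<lambda>Z. a Z - a' Z)) (fin_elt K d b) t = fin_elt K d (\<lambda>Z. c Z - c' Z) t"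
    using assms K t by (simp add: convolves_to_def fin_elt_diff)
qed

lemma convolves_to_diff_right:
  assumes "convolves_to d a b c" "convolves_to d a b' c'"
  shows "convolves_to d a (\<lambda>Z. b Z - b' Z) (\<lambda>Z. c Z - c' Z)"
  unfolding convolves_to_def
proof (intro allI impI ballI)
  fix K :: "nat ring" and t assume K: "field K" "finite (carrier K)" and t: "t \<in> triples K d"
  have "convolution K d (fin_elt K d a) (fin_elt K d (\<lambda>Z. b Z - b' Z)) t =
    convolution K d (fin_elt K d a) (fin_elt K d b) t - convolution K d (fin_elt K d a) (fin_elt K d b') t"
    unfolding convolution_def by (simp add: fin_elt_diff sum_subtractf right_diff_distrib split: prod.splits)
  then show "convolution K d (fin_elt K d a) (fin_elt K d (\<lambda>Z. b Z - b' Z)) t = fin_elt K d (\<lambda>Z. c Z - c' Z) t"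
    using assms K t by (simp add: convolves_to_def fin_elt_diff)
qed

lemma convolution_sum_left:
  "convolution K d (\<lambda>t. \<Sum>i\<in>I. \<alpha> i t) \<beta> t = (\<Sum>i\<in>I. convolution K d (\<alpha> i) \<beta> t)"
proof (induction I rule: infinite_finite_induct)
  case (insert i I)
  have "convolution K d (\<lambda>t. \<alpha> i t + (\<Sum>i\<in>I. \<alpha> i t)) \<beta> t =
      convolution K d (\<alpha> i) \<beta> t + convolution K d (\<lambda>t. \<Sum>i\<in>I. \<alpha> i t) \<beta> t"
    by (simp add: convolution_def sum.distrib distrib_right split: prod.splits)
  with insert show ?case by simp
qed (simp_all add: convolution_def split: prod.splits)

lemma convolution_sum_right:
  "convolution K d \<alpha> (\<lambda>t. \<Sum>i\<in>I. \<beta> i t) t = (\<Sum>i\<in>I. convolution K d \<alpha> (\<beta> i) t)"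
proof (induction I rule: infinite_finite_induct)
  case (insert i I)
  have "convolution K d \<alpha> (\<lambda>t. \<beta> i t + (\<Sum>i\<in>I. \<beta> i t)) t =
      convolution K d \<alpha> (\<beta> i) t + convolution K d \<alpha> (\<lambda>t. \<Sum>i\<in>I. \<beta> i t) t"
    by (simp add: convolution_def sum.distrib distrib_left split: prod.splits)
  with insert show ?case by simp
qed (simp_all add: convolution_def split: prod.splits)

lemma convolves_to_sum_sum:
  assumes "\<And>i j. i \<in> I \<Longrightarrow> j \<in> J \<Longrightarrow> convolves_to d (a i) (b j) (c i j)"
  shows "convolves_to d (\<lambda>Z. \<Sum>i\<in>I. a i Z) (\<lambda>Z. \<Sum>j\<in>J. b j Z) (\<lambda>Z. \<Sum>i\<in>I. \<Sum>j\<in>J. c i j Z)"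
  unfolding convolves_to_def
proof (intro allI impI ballI)
  fix K :: "nat ring" and t assume K: "field K" "finite (carrier K)" and t: "t \<in> triples K d"
  have e: "fin_elt K d (\<lambda>Z. \<Sum>i\<in>I. a i Z) = (\<lambda>t. \<Sum>i\<in>I. fin_elt K d (a i) t)"
    "fin_elt K d (\<lambda>Z. \<Sum>j\<in>J. b j Z) = (\<lambda>t. \<Sum>j\<in>J. fin_elt K d (b j) t)"
    by (simp_all add: fin_elt_sum fun_eq_iff)
  show "convolution K d (fin_elt K d (\<lambda>Z. \<Sum>i\<in>I. a i Z)) (fin_elt K d (\<lambda>Z. \<Sum>j\<in>J. b j Z)) t =
    fin_elt K d (\<lambda>Z. \<Sum>i\<in>I. \<Sum>j\<in>J. c i j Z) t"
    unfolding e convolution_sum_left convolution_sum_right fin_elt_sum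
    using assms K t by (intro sum.cong refl) (simp add: convolves_to_def)
qed

lemma lookup_scale [simp]: "Poly_Mapping.lookup (c *\<^sub>v x) X = c * Poly_Mapping.lookup x X"
  by (simp add: scale_def Poly_Mapping.map.rep_eq when_def)

lemma lookup_T: "Poly_Mapping.lookup (T X) Z = (if Z = X then 1 else 0)"
  by (simp add: T_def lookup_single when_def)

lemma lookup_gen_elt:
  "Poly_Mapping.lookup (gen_elt d c) Z = (if Z \<in> Xi d then poly (map_poly of_int (c Z)) (vv ^ 2) else 0)"
proof -
  have "Poly_Mapping.lookup (gen_elt d c) Z =
    (\<Sum>Z'\<in>Xi d. if Z' = Z then poly (map_poly of_int (c Z')) (vv ^ 2) else 0)"
    unfolding gen_elt_def lookup_sum by (intro sum.cong) (auto simp: lookup_T)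
  then show ?thesis using finite_Xi by (simp add: sum.delta)
qed

lemma lookup_MU_mult:
  "Poly_Mapping.lookup (MU_mult d x y) Z = (if Z \<in> Xi d then \<Sum>X\<in>Xi d. \<Sum>Y\<in>Xi d.
     Poly_Mapping.lookup x X * Poly_Mapping.lookup y Y *
       poly (map_poly of_int (structure_poly d X Y Z)) (vv ^ 2) else 0)"
proof -
  have "Poly_Mapping.lookup (MU_mult d x y) Z = (\<Sum>X\<in>Xi d. \<Sum>Y\<in>Xi d. \<Sum>Z'\<in>Xi d. if Z' = Z then
     Poly_Mapping.lookup x X * Poly_Mapping.lookup y Y *
       poly (map_poly of_int (structure_poly d X Y Z')) (vv ^ 2) else 0)"
    unfolding MU_mult_def lookup_sum by (intro sum.cong) (auto simp: lookup_T)
  also have "\<dots> = (\<Sum>X\<in>Xi d. \<Sum>Y\<in>Xi d. if Z \<in> Xi d then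
     Poly_Mapping.lookup x X * Poly_Mapping.lookup y Y *
       poly (map_poly of_int (structure_poly d X Y Z)) (vv ^ 2) else 0)"
    using finite_Xi by (intro sum.cong refl) (simp add: sum.delta)
  finally show ?thesis by simp
qed

lemma gen_elt_cong: "(\<And>Z. Z \<in> Xi d \<Longrightarrow> a Z = b Z) \<Longrightarrow> gen_elt d a = gen_elt d b"
  unfolding gen_elt_def by (intro sum.cong) auto

lemma of_int_poly_add: "map_poly of_int (f + g) = (map_poly of_int f + map_poly of_int g :: ratfun poly)"
  by (rule poly_eqI) (simp add: coeff_map_poly)

lemma of_int_poly_sum:
  "map_poly of_int (\<Sum>i\<in>I. f i) = (\<Sum>i\<in>I. map_poly of_int (f i) :: ratfun poly)"
  by (induction I rule: infinite_finite_induct) (simp_all add: of_int_poly_add)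

lemma of_int_poly_mult: "map_poly of_int (f * g) = (map_poly of_int f * map_poly of_int g :: ratfun poly)"
  by (rule poly_eqI) (simp add: coeff_map_poly coeff_mult)

lemma gen_elt_sum: "gen_elt d (\<lambda>Z. \<Sum>i\<in>I. a i Z) = (\<Sum>i\<in>I. gen_elt d (a i))"
  by (rule poly_mapping_eqI) (simp add: lookup_gen_elt lookup_sum of_int_poly_sum poly_sum)

lemma gen_elt_add: "gen_elt d (\<lambda>Z. a Z + b Z) = gen_elt d a + gen_elt d b"
  by (rule poly_mapping_eqI) (simp add: lookup_gen_elt lookup_add of_int_poly_add)

lemma gen_elt_mult: "gen_elt d (\<lambda>Z. f * a Z) = poly (map_poly of_int f) (vv ^ 2) *\<^sub>v gen_elt d a"
  by (rule poly_mapping_eqI) (simp add: lookup_gen_elt of_int_poly_mult)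

lemma gen_elt_unit_vec: "gen_elt d (unit_vec X) = (if X \<in> Xi d then T X else 0)"
  by (rule poly_mapping_eqI) (auto simp: lookup_gen_elt unit_vec_def lookup_T)

lemma MU_mult_sum_left: "MU_mult d (\<Sum>i\<in>I. x i) y = (\<Sum>i\<in>I. MU_mult d (x i) y)"
proof (induction I rule: infinite_finite_induct)
  case (insert i I)
  have "MU_mult d (x i + (\<Sum>i\<in>I. x i)) y = MU_mult d (x i) y + MU_mult d (\<Sum>i\<in>I. x i) y"
    by (rule poly_mapping_eqI)
       (simp add: lookup_MU_mult lookup_add distrib_right sum.distrib)
  with insert show ?case by simp
qed (simp_all add: poly_mapping_eq_iff lookup_MU_mult fun_eq_iff)

lemma MU_mult_sum_right: "MU_mult d x (\<Sum>i\<in>I. y i) = (\<Sum>i\<in>I. MU_mult d x (y i))"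
proof (induction I rule: infinite_finite_induct)
  case (insert i I)
  have "MU_mult d x (y i + (\<Sum>i\<in>I. y i)) = MU_mult d x (y i) + MU_mult d x (\<Sum>i\<in>I. y i)"
    by (rule poly_mapping_eqI)
       (simp add: lookup_MU_mult lookup_add distrib_right distrib_left sum.distrib)
  with insert show ?case by simp
qed (simp_all add: poly_mapping_eq_iff lookup_MU_mult fun_eq_iff)

lemma MU_mult_scale_left: "MU_mult d (c *\<^sub>v x) y = c *\<^sub>v MU_mult d x y"
  by (rule poly_mapping_eqI) (simp add: lookup_MU_mult sum_distrib_left mult_ac)

lemma MU_mult_scale_right: "MU_mult d x (c *\<^sub>v y) = c *\<^sub>v MU_mult d x y"
  by (rule poly_mapping_eqI) (simp add: lookup_MU_mult sum_distrib_left mult_ac)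

lemma MU_mult_zero [simp]: "MU_mult d 0 y = 0" "MU_mult d x 0 = 0"
  by (rule poly_mapping_eqI, simp add: lookup_MU_mult)+

subsection \<open>Transfer of product formulas\<close>

lemma T_mult_T:
  assumes "X \<in> Xi d" "Y \<in> Xi d" "convolves_to d (unit_vec X) (unit_vec Y) c"
  shows "MU_mult d (T X) (T Y) = gen_elt d c"
proof (rule poly_mapping_eqI)
  fix Z
  show "Poly_Mapping.lookup (MU_mult d (T X) (T Y)) Z = Poly_Mapping.lookup (gen_elt d c) Z"
  proof (cases "Z \<in> Xi d")
    case True
    have "Poly_Mapping.lookup (MU_mult d (T X) (T Y)) Z = (\<Sum>X'\<in>Xi d. if X' = X then (\<Sum>Y'\<in>Xi d. if Y' = Y then
       poly (map_poly of_int (structure_poly d X' Y' Z)) (vv ^ 2) else 0) else 0)"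
      using True unfolding lookup_MU_mult lookup_T by (auto intro!: sum.cong)
    also have "\<dots> = poly (map_poly of_int (structure_poly d X Y Z)) (vv ^ 2)"
      using assms(1,2) finite_Xi by (simp add: sum.delta)
    finally show ?thesis using True structure_poly_eq[OF assms(1,2) True assms(3)] by (simp add: lookup_gen_elt)
  qed (simp add: lookup_MU_mult lookup_gen_elt)
qed

lemma convolves_to_unit_vec_zero:
  assumes "X \<notin> Xi d"
  shows "convolves_to d (unit_vec X) b (\<lambda>Z. 0)" "convolves_to d b (unit_vec X) (\<lambda>Z. 0)"
  using assms by (auto simp: convolves_to_def fin_elt_unit_vec convolution_def fin_elt_def split: prod.splits)

lemma gen_elt_zero [simp]: "gen_elt d (\<lambda>Z. 0) = 0"
  by (rule poly_mapping_eqI) (simp add: lookup_gen_elt)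

text \<open>A label outside \<open>Xi d\<close> is allowed here: both sides vanish, the right one because the coefficients of
  the zero function are unique.\<close>

lemma unit_vec_mult_unit_vec:
  assumes r: "convolves_to d (unit_vec X) (unit_vec Y) c"
  shows "MU_mult d (gen_elt d (unit_vec X)) (gen_elt d (unit_vec Y)) = gen_elt d c"
proof (cases "X \<in> Xi d \<and> Y \<in> Xi d")
  case True
  then show ?thesis using T_mult_T[OF _ _ r] by (simp add: gen_elt_unit_vec)
next
  case False
  then have "convolves_to d (unit_vec X) (unit_vec Y) (\<lambda>Z. 0)" using convolves_to_unit_vec_zero by blast
  then have "gen_elt d c = gen_elt d (\<lambda>Z. 0)" by (intro gen_elt_cong convolves_to_unique[OF r])
  then show ?thesis using False by (auto simp: gen_elt_unit_vec)
qed

lemma prefix_sum_0: "prefix_sum X 0 = unit_vec (X 0)"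
  by (simp add: prefix_sum_def)

lemma unit_vec_prefix_diff: "unit_vec (X (Suc i)) = (\<lambda>Z. prefix_sum X (Suc i) Z - prefix_sum X i Z)"
  by (simp add: prefix_sum_def)

text \<open>A product formula between invariant functions transfers to the generic algebra only if the structure
  polynomials of all pairs of orbit functions involved are known to exist. If the formula is available
  for all shorter partial sums as well, then each orbit function is a difference of partial sums, so that
  its products are polynomial too, and summing them up again gives the formula in the generic algebra.\<close>

theorem prefix_sum_mult:
  assumes r: "\<And>i j. i \<le> m \<Longrightarrow> j \<le> n \<Longrightarrow> convolves_to d (prefix_sum X i) (prefix_sum Y j) (c i j)"
  shows "MU_mult d (gen_elt d (prefix_sum X m)) (gen_elt d (prefix_sum Y n)) = gen_elt d (c m n)"
proof -
  \<comment> \<open>First the left factor is replaced by a single orbit function, then the right one.\<close>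
  have left: "\<exists>c'. convolves_to d (unit_vec (X i)) (prefix_sum Y j) c'" if "i \<le> m" "j \<le> n" for i j
  proof (cases i)
    case 0
    then show ?thesis using r[of 0 j] that by (auto simp: prefix_sum_0)
  next
    case (Suc i')
    then show ?thesis
      using convolves_to_diff_left[OF r[of "Suc i'" j] r[of i' j]] that unit_vec_prefix_diff[of X i'] by auto
  qed
  have "\<exists>c'. convolves_to d (unit_vec (X i)) (unit_vec (Y j)) c'" if "i \<le> m" "j \<le> n" for i j
  proof (cases j)
    case 0
    then show ?thesis using left[of i 0] that by (auto simp: prefix_sum_0)
  next
    case (Suc j')
    then have "j' \<le> n" "Suc j' \<le> n" using that by auto
    from left[OF that(1) this(2)] left[OF that(1) this(1)] obtain c1 c2
      where "convolves_to d (unit_vec (X i)) (prefix_sum Y (Suc j')) c1"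
        "convolves_to d (unit_vec (X i)) (prefix_sum Y j') c2"
      by (elim exE)
    from convolves_to_diff_right[OF this] show ?thesis
      using unit_vec_prefix_diff[of Y j'] Suc by auto
  qed
  then obtain c' where c': "\<And>i j. i \<le> m \<Longrightarrow> j \<le> n \<Longrightarrow> convolves_to d (unit_vec (X i)) (unit_vec (Y j)) (c' i j)"
    by metis
  have "convolves_to d (prefix_sum X m) (prefix_sum Y n) (\<lambda>Z. \<Sum>i\<le>m. \<Sum>j\<le>n. c' i j Z)"
    unfolding prefix_sum_def by (rule convolves_to_sum_sum) (use c' in auto)
  then have "gen_elt d (c m n) = gen_elt d (\<lambda>Z. \<Sum>i\<le>m. \<Sum>j\<le>n. c' i j Z)"
    by (intro gen_elt_cong convolves_to_unique[OF r]) auto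
  also have "\<dots> = (\<Sum>i\<le>m. \<Sum>j\<le>n. gen_elt d (c' i j))" by (simp add: gen_elt_sum)
  also have "\<dots> = (\<Sum>i\<le>m. \<Sum>j\<le>n. MU_mult d (gen_elt d (unit_vec (X i))) (gen_elt d (unit_vec (Y j))))"
    using c' by (intro sum.cong refl unit_vec_mult_unit_vec[symmetric]) simp
  also have "\<dots> = MU_mult d (gen_elt d (prefix_sum X m)) (gen_elt d (prefix_sum Y n))"
    unfolding prefix_sum_def gen_elt_sum MU_mult_sum_left MU_mult_sum_right by (rule sum.swap)
  finally show ?thesis by simp
qed

section \<open>The anti-automorphism given by transposition\<close>

definition transpose_label :: "label \<Rightarrow> label" where
  "transpose_label X = ((\<lambda>i j. fst X j i), prod.swap ` snd X)"

lemma transpose_label_involution [simp]: "transpose_label (transpose_label X) = X"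
  by (simp add: transpose_label_def image_comp)

lemma mat4_transpose: "mat4 a b c e j i = mat4 a c b e i j"
  unfolding mat4_def
  by (cases "i = 1"; cases "i = 2"; cases "j = 1"; cases "j = 2";
      simp only: simp_thms if_True if_False numeral_eq_iff)

lemma transpose_label_mat4:
  "transpose_label (mat4 a b c e, \<Delta>) = (mat4 a c b e, prod.swap ` \<Delta>)"
  unfolding transpose_label_def fst_conv snd_conv mat4_transpose[of a b c e] ..

lemma transpose_label_Xi [simp]: "transpose_label X \<in> Xi d \<longleftrightarrow> X \<in> Xi d"
proof -
  have "transpose_label X \<in> Xi d" if X: "X \<in> Xi d" for X
  proof -
    obtain a b c e \<Delta> where X': "X = (mat4 a b c e, \<Delta>)" using Xi_mat4 X by (metis surj_pair)
    show ?thesis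
      using X unfolding X' transpose_label_mat4 Xi_mat4_iff by (elim conjE disjE) auto
  qed
  from this[of X] this[of "transpose_label X"] show ?thesis by auto
qed

lemma bij_transpose_label: "bij_betw transpose_label (Xi d) (Xi d)"
  by (rule bij_betwI[where g = transpose_label]) auto

lemma inj_transpose_label: "inj transpose_label"
  by (rule injI) (metis transpose_label_involution)

context finite_coord_space begin

text \<open>Exchanging the roles of rows and columns in the index of an adapted basis exchanges the two flags.\<close>

lemma orbit_transpose:
  assumes X: "X \<in> Xi d"
  shows "(F, F', v) \<in> orbit K d (transpose_label X) \<longleftrightarrow> (F', F, v) \<in> orbit K d X"
proof -
  have *: "(F', F, v) \<in> orbit K d (transpose_label X)"
    if X: "X \<in> Xi d" and t: "(F, F', v) \<in> orbit K d X" for X F F' v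
  proof -
    obtain A \<Delta> where X': "X = (A, \<Delta>)" by (cases X)
    obtain W W' where s: "W \<in> subspaces" "W' \<in> subspaces" "v \<in> carrier V" and e: "F = flag_of W" "F' = flag_of W'"
      using t by (elim orbit_cases) auto
    obtain b where b: "inj_on b (basis_index A)" "basis (b ` basis_index A)"
     and W: "W = span (b ` {(i, j, m) \<in> basis_index A. i = 1})"
     and W': "W' = span (b ` {(i, j, m) \<in> basis_index A. j = 1})"
     and v: "v = (\<Oplus>\<^bsub>V\<^esub> p\<in>\<Delta>. b (fst p, snd p, 1))"
      using t unfolding e X' orbit_iff[OF s] by blast
    let ?s = "\<lambda>(i, j, m). (j, i, m :: nat)"
    let ?A = "\<lambda>i j. A j i"
    have idx: "basis_index ?A = ?s ` basis_index A"
      by (force simp: basis_index_def)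
    have inj: "inj_on (b \<circ> ?s) (basis_index ?A)"
      unfolding idx by (intro comp_inj_on) (use b(1) in \<open>auto simp: image_comp comp_def inj_on_def\<close>)
    have img: "(b \<circ> ?s) ` basis_index ?A = b ` basis_index A"
      unfolding idx by (force simp: image_comp comp_def)
    have imgs: "(b \<circ> ?s) ` {(i, j, m) \<in> basis_index ?A. i = 1} = b ` {(i, j, m) \<in> basis_index A. j = 1}"
       "(b \<circ> ?s) ` {(i, j, m) \<in> basis_index ?A. j = 1} = b ` {(i, j, m) \<in> basis_index A. i = 1}"
      unfolding idx by (force simp: image_comp comp_def)+
    have idx1: "(fst p, snd p, 1) \<in> basis_index A" if "p \<in> \<Delta>" for p
      using X that by (auto simp: X' Xi_def basis_index_def Suc_le_eq)
    have car: "b x \<in> carrier V" if "x \<in> basis_index A" for x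
      using b(2) that by (auto simp: basis_def)
    have "(\<Oplus>\<^bsub>V\<^esub> p\<in>prod.swap ` \<Delta>. (b \<circ> ?s) (fst p, snd p, 1)) = v"
      unfolding v using car idx1 by (subst finsum_reindex) (auto simp: comp_def)
    then show ?thesis
      unfolding e transpose_label_def X' fst_conv snd_conv orbit_iff[OF s(2,1,3)]
      using b(2) inj W W' by (intro exI[of _ "b \<circ> ?s"]) (simp only: img imgs simp_thms)
  qed
  from *[of X F' F v] *[of "transpose_label X" F F' v] X show ?thesis by auto
qed

lemma convolution_eq:
  assumes s: "W \<in> subspaces" "W' \<in> subspaces" "v \<in> carrier V"
  shows "convolution K d \<alpha> \<beta> (triple W W' v) =
    (\<Sum>H\<in>subspaces. \<Sum>u\<in>carrier V. \<alpha> (triple W H u) * \<beta> (triple H W' (v \<ominus>\<^bsub>V\<^esub> u)))"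
  by (simp add: convolution_def sum_flags)

lemma minus_minus_cancel:
  assumes "v \<in> carrier V" "u \<in> carrier V" shows "v \<ominus>\<^bsub>V\<^esub> (v \<ominus>\<^bsub>V\<^esub> u) = u"
  using assms by (simp add: a_minus_def minus_add a_assoc[symmetric] r_neg)

text \<open>The substitution \<open>u \<mapsto> v - u\<close> exchanges the two factors of the convolution.\<close>

lemma convolution_transpose:
  assumes X: "X \<in> Xi d" "Y \<in> Xi d" and t: "(F, F', v) \<in> triples K d"
  shows "convolution K d (T_fin K d X) (T_fin K d Y) (F, F', v) =
    convolution K d (T_fin K d (transpose_label Y)) (T_fin K d (transpose_label X)) (F', F, v)"
proof -
  have T: "T_fin K d (transpose_label X) (F, F', v) = T_fin K d X (F', F, v)" if "X \<in> Xi d" for X F F' v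
    using orbit_transpose[OF that] by (simp add: T_fin_def indicator_def)
  have v: "v \<in> carrier V" using t by (simp add: triples_def)
  have "(\<Sum>u\<in>carrier V. T_fin K d X (F, H, u) * T_fin K d Y (H, F', v \<ominus>\<^bsub>V\<^esub> u)) =
     (\<Sum>u\<in>carrier V. T_fin K d Y (H, F', u) * T_fin K d X (F, H, v \<ominus>\<^bsub>V\<^esub> u))" for H
    by (rule sum.reindex_bij_witness[where i = "\<lambda>u. v \<ominus>\<^bsub>V\<^esub> u" and j = "\<lambda>u. v \<ominus>\<^bsub>V\<^esub> u"])
       (use v minus_minus_cancel in \<open>auto simp: mult.commute\<close>)
  then show ?thesis using X by (simp add: convolution_def T)
qed

end

text \<open>The conditions that define the two structure polynomials are equivalent over each field; this is a
  statement about the definite descriptions, so it covers products of arbitrary orbits.\<close>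

lemma structure_poly_transpose:
  assumes X: "X \<in> Xi d" "Y \<in> Xi d" "Z \<in> Xi d"
  shows "structure_poly d (transpose_label Y) (transpose_label X) (transpose_label Z) = structure_poly d X Y Z"
proof -
  have "(\<forall>t\<in>orbit K d (transpose_label Z).
       convolution K d (T_fin K d (transpose_label Y)) (T_fin K d (transpose_label X)) t = c) \<longleftrightarrow>
    (\<forall>t\<in>orbit K d Z. convolution K d (T_fin K d X) (T_fin K d Y) t = c)"
    if K: "field K" "finite (carrier K)" for K :: "nat ring" and c
  proof -
    interpret finite_coord_space K d by (rule finite_coord_spaceI) (use K in auto)
    have flip: "(\<forall>t\<in>orbit K d (transpose_label Z). P t) \<longleftrightarrow> (\<forall>(F, F', v)\<in>orbit K d Z. P (F', F, v))" for P
    proof (intro iffI ballI)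
      fix t assume *: "\<forall>t\<in>orbit K d (transpose_label Z). P t" and "t \<in> orbit K d Z"
      moreover obtain F F' v where "t = (F, F', v)" by (cases t)
      ultimately show "case t of (F, F', v) \<Rightarrow> P (F', F, v)"
        using orbit_transpose[OF X(3), of F' F v] by simp
    next
      fix t assume *: "\<forall>(F, F', v)\<in>orbit K d Z. P (F', F, v)" and t: "t \<in> orbit K d (transpose_label Z)"
      obtain F F' v where e: "t = (F, F', v)" by (cases t)
      then have "(F', F, v) \<in> orbit K d Z" using orbit_transpose[OF X(3), of F F' v] t by simp
      from bspec[OF * this] show "P t" by (simp add: e)
    qed
    have conv: "convolution K d (T_fin K d (transpose_label Y)) (T_fin K d (transpose_label X)) (F', F, v) =
        convolution K d (T_fin K d X) (T_fin K d Y) (F, F', v)" if "(F, F', v) \<in> orbit K d Z" for F F' v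
      by (rule convolution_transpose[OF X(1,2) subsetD[OF orbit_subset_triples that], symmetric])
    show ?thesis unfolding flip by (intro ball_cong refl) (auto simp: conv)
  qed
  then show ?thesis unfolding structure_poly_def by (simp cong: conj_cong imp_cong)
qed

definition transpose_elt :: "generic \<Rightarrow> generic" where
  "transpose_elt x = Poly_Mapping.map_key transpose_label x"

lemma lookup_transpose_elt [simp]:
  "Poly_Mapping.lookup (transpose_elt x) Z = Poly_Mapping.lookup x (transpose_label Z)"
  by (simp add: transpose_elt_def map_key.rep_eq inj_transpose_label)

lemma transpose_elt_mult:
  "transpose_elt (MU_mult d x y) = MU_mult d (transpose_elt y) (transpose_elt x)"
proof (rule poly_mapping_eqI)
  fix Z
  let ?l = "Poly_Mapping.lookup"
  show "?l (transpose_elt (MU_mult d x y)) Z = ?l (MU_mult d (transpose_elt y) (transpose_elt x)) Z"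
  proof (cases "Z \<in> Xi d")
    case True
    let ?c = "\<lambda>X Y Z. poly (map_poly of_int (structure_poly d X Y Z)) (vv ^ 2)"
    have "?l (MU_mult d (transpose_elt y) (transpose_elt x)) Z =
      (\<Sum>X\<in>Xi d. \<Sum>Y\<in>Xi d. ?l y (transpose_label X) * ?l x (transpose_label Y) * ?c X Y Z)"
      using True by (simp add: lookup_MU_mult)
    also have "\<dots> = (\<Sum>X\<in>Xi d. \<Sum>Y\<in>Xi d. ?l y X * ?l x Y * ?c (transpose_label X) (transpose_label Y) Z)"
      unfolding sum.reindex_bij_betw[OF bij_transpose_label, symmetric,
          of "\<lambda>Y. ?l y _ * ?l x Y * ?c _ (transpose_label Y) Z"]
      by (subst sum.reindex_bij_betw[OF bij_transpose_label, symmetric]) simp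
    also have "\<dots> = (\<Sum>X\<in>Xi d. \<Sum>Y\<in>Xi d. ?l y X * ?l x Y * ?c Y X (transpose_label Z))"
      using True structure_poly_transpose[of _ d _ "transpose_label Z"] by (intro sum.cong refl) simp
    also have "\<dots> = (\<Sum>Y\<in>Xi d. \<Sum>X\<in>Xi d. ?l y X * ?l x Y * ?c Y X (transpose_label Z))"
      by (rule sum.swap)
    also have "\<dots> = ?l (transpose_elt (MU_mult d x y)) Z"
      using True by (simp add: lookup_MU_mult mult_ac)
    finally show ?thesis by simp
  qed (simp add: lookup_MU_mult)
qed

lemma transpose_elt_add: "transpose_elt (x + y) = transpose_elt x + transpose_elt y"
  by (rule poly_mapping_eqI) (simp add: lookup_add)

lemma transpose_elt_zero [simp]: "transpose_elt 0 = 0"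
  by (rule poly_mapping_eqI) simp

lemma transpose_elt_sum: "transpose_elt (\<Sum>i\<in>I. x i) = (\<Sum>i\<in>I. transpose_elt (x i))"
  by (induction I rule: infinite_finite_induct) (simp_all add: transpose_elt_add)

lemma transpose_elt_scale: "transpose_elt (c *\<^sub>v x) = c *\<^sub>v transpose_elt x"
  by (rule poly_mapping_eqI) simp

lemma transpose_elt_T: "transpose_elt (T X) = T (transpose_label X)"
  by (rule poly_mapping_eqI) (auto simp: lookup_T)

section \<open>Convolution products of chain functions\<close>

text \<open>The labels of the orbits with \<open>W' \<subseteq> W\<close>, \<open>dim W' = r\<close> and \<open>dim W = r + k\<close>, ordered by the position of
  \<open>v\<close>, so that their partial sums become the indicators of \<open>v = 0\<close>, \<open>v \<in> W'\<close> and \<open>v \<in> W\<close>.\<close>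

definition chain_label :: "nat \<Rightarrow> nat \<Rightarrow> nat \<Rightarrow> nat \<Rightarrow> label" where
  "chain_label d k r i = (mat4 r k 0 (d - r - k), if i = 0 then {} else if i = 1 then {(1, 1)} else {(1, 2)})"

definition chain_vec :: "nat \<Rightarrow> nat \<Rightarrow> nat \<Rightarrow> nat \<Rightarrow> vec" where
  "chain_vec d k r j = prefix_sum (chain_label d k r) j"

text \<open>The indeterminate that stands for the order of the field.\<close>

definition qvar :: "int poly" where
  "qvar = [:0, 1:]"

lemma poly_qvar [simp]: "poly qvar x = x"
  by (simp add: qvar_def)

lemma convolves_toI:
  assumes "\<And>K :: nat ring. \<And>W W' v. finite_coord_space K \<Longrightarrow>
    W \<in> finite_vectorspace.subspaces K (coord_space K d) \<Longrightarrow> W' \<in> finite_vectorspace.subspaces K (coord_space K d) \<Longrightarrow>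
    v \<in> carrier (coord_space K d) \<Longrightarrow>
    convolution K d (fin_elt K d a) (fin_elt K d b)
      (finite_coord_space.flag_of K d W, finite_coord_space.flag_of K d W', v) =
    fin_elt K d c (finite_coord_space.flag_of K d W, finite_coord_space.flag_of K d W', v)"
  shows "convolves_to d a b c"
  unfolding convolves_to_def
proof (intro allI impI ballI)
  fix K :: "nat ring" and t assume K: "field K" "finite (carrier K)" and t: "t \<in> triples K d"
  interpret finite_coord_space K d by (rule finite_coord_spaceI) (use K in auto)
  obtain W W' v where "t = triple W W' v" "W \<in> subspaces" "W' \<in> subspaces" "v \<in> carrier V"
    using t by (auto simp: triples_def flags_eq)
  then show "convolution K d (fin_elt K d a) (fin_elt K d b) t = fin_elt K d c t"
    using assms finite_coord_space_axioms by simp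
qed

context finite_coord_space begin

lemma level_simps [simp]:
  "level 0 W W' = {\<zero>\<^bsub>V\<^esub>}" "level (Suc 0) W W' = W'" "level 2 W W' = W"
  by (simp_all add: level_def)

lemma level_subspaces: "W \<in> subspaces \<Longrightarrow> W' \<in> subspaces \<Longrightarrow> level j W W' \<in> subspaces"
  by (simp add: level_def subspaces_zero_space)

lemma fin_elt_unit_vec_orbit:
  "fin_elt K d (unit_vec X) t = of_bool (X \<in> Xi d \<and> t \<in> orbit K d X)"
  by (simp add: fin_elt_unit_vec T_fin_def indicator_def)

text \<open>The three orbits partition the triples with \<open>W' \<subseteq> W\<close> and \<open>v \<in> W\<close> according to \<open>v = 0\<close>,
  \<open>0 \<noteq> v \<in> W'\<close> and \<open>v \<in> W - W'\<close>.\<close>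

lemma fin_elt_chain:
  assumes s: "W \<in> subspaces" "W' \<in> subspaces" "v \<in> carrier V" and j: "j \<le> 2"
  shows "fin_elt K d (chain_vec d k r j) (triple W W' v) =
    of_bool (W' \<subseteq> W \<and> card W' = q ^ r \<and> card W = q ^ (r + k) \<and> v \<in> level j W W')"
proof -
  let ?C = "W' \<subseteq> W \<and> card W' = q ^ r \<and> card W = q ^ (r + k)"
  have u: "fin_elt K d (unit_vec (chain_label d k r i)) (triple W W' v) =
     of_bool (?C \<and> (if i = 0 then v = \<zero>\<^bsub>V\<^esub> else if i = 1 then v \<in> W' \<and> v \<noteq> \<zero>\<^bsub>V\<^esub> else v \<in> W \<and> v \<notin> W'))" for i
  proof -
    define \<Delta> :: "(nat \<times> nat) set" where "\<Delta> = (if i = 0 then {} else if i = 1 then {(1, 1)} else {(1, 2)})"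
    have "\<Delta> \<in> {{}, {(1, 1)}, {(1, 2)}}" by (simp add: \<Delta>_def)
    from orbit_chain_iff[OF s this] show ?thesis
      unfolding fin_elt_unit_vec_orbit chain_label_def \<Delta>_def[symmetric] by (simp add: \<Delta>_def)
  qed
  have z: "\<zero>\<^bsub>V\<^esub> \<in> W" "\<zero>\<^bsub>V\<^esub> \<in> W'" using s subspaces_zero by auto
  have "j = 0 \<or> j = 1 \<or> j = 2" using j by auto
  moreover have "(\<Sum>i\<le>2. f i) = f 0 + f 1 + f 2" for f :: "nat \<Rightarrow> complex"
    by (simp add: numeral_2_eq_2)
  ultimately have val: "fin_elt K d (chain_vec d k r j) (triple W W' v) =
    of_bool (?C \<and> v = \<zero>\<^bsub>V\<^esub>) + (if j \<ge> 1 then of_bool (?C \<and> v \<in> W' \<and> v \<noteq> \<zero>\<^bsub>V\<^esub>) else 0) +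
    (if j = 2 then of_bool (?C \<and> v \<in> W \<and> v \<notin> W') else 0)"
    unfolding chain_vec_def prefix_sum_def fin_elt_sum u by (elim disjE) simp_all
  have lvl: "?C \<and> v \<in> level j W W' \<longleftrightarrow> W' \<subseteq> W \<and> card W' = q ^ r \<and> card W = q ^ (r + k) \<and> v \<in> level j W W'"
    by blast
  show ?thesis
  proof (cases ?C)
    case True
    have drop: "C \<Longrightarrow> of_bool (C \<and> P) = (of_bool P :: complex)" for C P by simp
    have "v \<in> W' \<Longrightarrow> v \<in> W" using True by blast
    then show ?thesis
      unfolding val lvl[symmetric] drop[OF True] using z \<open>j = 0 \<or> j = 1 \<or> j = 2\<close>
      by (cases "v = \<zero>\<^bsub>V\<^esub>"; cases "v \<in> W'"; cases "v \<in> W"; elim disjE; simp)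
  next
    case False
    have kill: "\<not> C \<Longrightarrow> of_bool (C \<and> P) = (0 :: complex)" for C P by simp
    show ?thesis unfolding val lvl[symmetric] kill[OF False] by simp
  qed
qed

text \<open>All products of chain functions reduce to counting, for each intermediate space, the decompositions
  of \<open>v\<close> into vectors of two prescribed subspaces.\<close>

lemma convolution_chain:
  assumes s: "W \<in> subspaces" "W' \<in> subspaces" "v \<in> carrier V" and ij: "i \<le> 2" "j \<le> 2"
  shows "convolution K d (fin_elt K d (chain_vec d k r i)) (fin_elt K d (chain_vec d l s j)) (triple W W' v) =
    (if r = s + l \<and> card W' = q ^ s \<and> card W = q ^ (r + k)
     then of_nat (\<Sum>H\<in>{H \<in> subspaces. W' \<subseteq> H \<and> H \<subseteq> W \<and> card H = q ^ r}.
       card {u \<in> level i W H. v \<ominus>\<^bsub>V\<^esub> u \<in> level j H W'}) else 0)"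
proof -
  let ?C = "r = s + l \<and> card W' = q ^ s \<and> card W = q ^ (r + k)"
  let ?M = "{H \<in> subspaces. W' \<subseteq> H \<and> H \<subseteq> W \<and> card H = q ^ r}"
  have "(\<Sum>u\<in>carrier V. fin_elt K d (chain_vec d k r i) (triple W H u) *
        fin_elt K d (chain_vec d l s j) (triple H W' (v \<ominus>\<^bsub>V\<^esub> u))) =
      (if ?C \<and> H \<in> ?M then of_nat (card {u \<in> level i W H. v \<ominus>\<^bsub>V\<^esub> u \<in> level j H W'}) else 0)"
    if H: "H \<in> subspaces" for H
  proof -
    have "(\<Sum>u\<in>carrier V. fin_elt K d (chain_vec d k r i) (triple W H u) *
        fin_elt K d (chain_vec d l s j) (triple H W' (v \<ominus>\<^bsub>V\<^esub> u))) =
      (\<Sum>u\<in>carrier V. of_bool ((H \<subseteq> W \<and> card H = q ^ r \<and> card W = q ^ (r + k) \<and> u \<in> level i W H) \<and>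
        (W' \<subseteq> H \<and> card W' = q ^ s \<and> card H = q ^ (s + l) \<and> v \<ominus>\<^bsub>V\<^esub> u \<in> level j H W')))"
      using s ij H by (intro sum.cong refl) (simp only: fin_elt_chain minus_closed of_bool_conj)
    also have "\<dots> = (\<Sum>u\<in>carrier V. if u \<in> {u \<in> level i W H. v \<ominus>\<^bsub>V\<^esub> u \<in> level j H W'}
        then of_bool (?C \<and> H \<in> ?M) else 0)"
      using H q_pow_inj by (intro sum.cong refl) auto
    also have "\<dots> = (\<Sum>u\<in>{u \<in> level i W H. v \<ominus>\<^bsub>V\<^esub> u \<in> level j H W'}. of_bool (?C \<and> H \<in> ?M))"
    proof -
      have "carrier V \<inter> {u \<in> level i W H. v \<ominus>\<^bsub>V\<^esub> u \<in> level j H W'} =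
          {u \<in> level i W H. v \<ominus>\<^bsub>V\<^esub> u \<in> level j H W'}"
        using level_subspaces[OF s(1) H, of i, THEN subspaces_subset] by blast
      then show ?thesis by (simp only: sum.inter_restrict[OF finite_vectors, symmetric])
    qed
    finally show ?thesis by simp
  qed
  then have "convolution K d (fin_elt K d (chain_vec d k r i)) (fin_elt K d (chain_vec d l s j)) (triple W W' v) =
    (\<Sum>H\<in>subspaces. if ?C \<and> H \<in> ?M then of_nat (card {u \<in> level i W H. v \<ominus>\<^bsub>V\<^esub> u \<in> level j H W'}) else 0)"
    unfolding convolution_eq[OF s] by simp
  also have "\<dots> = (if ?C then (\<Sum>H\<in>?M. of_nat (card {u \<in> level i W H. v \<ominus>\<^bsub>V\<^esub> u \<in> level j H W'})) else 0)"
  proof (cases ?C)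
    case True
    show ?thesis
      unfolding if_P[OF True] by (simp only: True simp_thms sum.inter_filter[OF finite_subspaces, symmetric] mem_Collect_eq)
  next
    case False
    then show ?thesis by (simp only: simp_thms if_False sum.neutral_const)
  qed
  finally show ?thesis by simp
qed

lemma between_left:
  assumes "W \<in> subspaces" "card W = q ^ r"
  shows "{H \<in> subspaces. W' \<subseteq> H \<and> H \<subseteq> W \<and> card H = q ^ r} = (if W' \<subseteq> W then {W} else {})"
proof -
  have "H = W" if "H \<subseteq> W" "card H = q ^ r" for H
    using subspaces_eqI[OF assms(1) that(1)] that(2) assms(2) by simp
  then show ?thesis using assms by auto
qed

lemma between_empty:
  "\<not> W' \<subseteq> W \<Longrightarrow> {H \<in> subspaces. W' \<subseteq> H \<and> H \<subseteq> W \<and> card H = n} = {}"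
  by auto

lemma between_right:
  assumes "W' \<in> subspaces" "card W' = q ^ r"
  shows "{H \<in> subspaces. W' \<subseteq> H \<and> H \<subseteq> W \<and> card H = q ^ r} = (if W' \<subseteq> W then {W'} else {})"
proof -
  have "H = W'" if "H \<in> subspaces" "W' \<subseteq> H" "card H = q ^ r" for H
    using subspaces_eqI[OF that(1,2)] that(3) assms by simp
  then show ?thesis using assms by auto
qed

lemma zero_translates:
  assumes "A \<in> subspaces" "v \<in> carrier V"
  shows "card {u \<in> {\<zero>\<^bsub>V\<^esub>}. v \<ominus>\<^bsub>V\<^esub> u \<in> A} = of_bool (v \<in> A)"
    "card {u \<in> A. v \<ominus>\<^bsub>V\<^esub> u \<in> {\<zero>\<^bsub>V\<^esub>}} = of_bool (v \<in> A)"
  using card_translates[OF subspaces_zero_space assms(1) _ assms(2)] subspaces_zero[OF assms(1)] by auto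

lemma convolution_chain_unit_left:
  assumes s: "W \<in> subspaces" "W' \<in> subspaces" "v \<in> carrier V" and j: "j \<le> 2"
  shows "convolution K d (fin_elt K d (chain_vec d 0 r 0)) (fin_elt K d (chain_vec d l s j)) (triple W W' v) =
    fin_elt K d (\<lambda>Z. (if r = s + l then 1 else 0) * chain_vec d l s j Z) (triple W W' v)"
proof (cases "r = s + l \<and> card W' = q ^ s \<and> card W = q ^ r")
  case True
  then show ?thesis
    unfolding fin_elt_mult convolution_chain[OF s le0 j] fin_elt_chain[OF s j]
    using between_left[OF s(1), of r W'] zero_translates(1)[OF level_subspaces[OF s(1,2)] s(3)] by simp
next
  case False
  then show ?thesis
    unfolding fin_elt_mult convolution_chain[OF s le0 j] fin_elt_chain[OF s j] by auto
qed

lemma convolution_chain_unit_right: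
  assumes s: "W \<in> subspaces" "W' \<in> subspaces" "v \<in> carrier V" and i: "i \<le> 2"
  shows "convolution K d (fin_elt K d (chain_vec d k r i)) (fin_elt K d (chain_vec d 0 s 0)) (triple W W' v) =
    fin_elt K d (\<lambda>Z. (if r = s then 1 else 0) * chain_vec d k r i Z) (triple W W' v)"
proof (cases "r = s \<and> card W' = q ^ s \<and> card W = q ^ (r + k)")
  case True
  then show ?thesis
    unfolding fin_elt_mult convolution_chain[OF s i le0] fin_elt_chain[OF s i]
    using between_right[OF s(2), of r W] zero_translates(2)[OF level_subspaces[OF s(1,2)] s(3)] by simp
next
  case False
  then show ?thesis
    unfolding fin_elt_mult convolution_chain[OF s i le0] fin_elt_chain[OF s i] by auto
qed

lemma level_card:
  assumes "card W' = q ^ s" "card W = q ^ (s + l)" "j \<le> 2"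
  shows "card (level j W W') = q ^ (if j = 0 then 0 else if j = 1 then s else s + l)"
  using assms by (auto simp: level_def)

lemma level_subset:
  assumes "W \<in> subspaces" "W' \<in> subspaces" "W' \<subseteq> W"
  shows "level j W W' \<subseteq> W" "j > 0 \<Longrightarrow> W' \<subseteq> level j W W'"
  using assms subspaces_zero by (auto simp: level_def)

text \<open>Since \<open>level j W W'\<close> is contained in \<open>W\<close>, its convolution with \<open>W\<close> is a multiple of the indicator of \<open>W\<close>.\<close>

lemma convolution_chain_average_left:
  assumes s: "W \<in> subspaces" "W' \<in> subspaces" "v \<in> carrier V" and j: "j \<le> 2"
  shows "convolution K d (fin_elt K d (chain_vec d 0 r 1)) (fin_elt K d (chain_vec d l s j)) (triple W W' v) =
    fin_elt K d (\<lambda>Z. (if r = s + l then qvar ^ (if j = 0 then 0 else if j = 1 then s else s + l) else 0)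
      * chain_vec d l s 2 Z) (triple W W' v)"
proof (cases "r = s + l \<and> card W' = q ^ s \<and> card W = q ^ r \<and> W' \<subseteq> W")
  case True
  have "card {u \<in> W. v \<ominus>\<^bsub>V\<^esub> u \<in> level j W W'} = (if v \<in> W then card (level j W W') else 0)"
    using True s by (intro card_translates level_subspaces level_subset) auto
  moreover have "card (level j W W') = q ^ (if j = 0 then 0 else if j = 1 then s else s + l)"
    using True j by (intro level_card) auto
  ultimately show ?thesis
    unfolding fin_elt_mult convolution_chain[OF s one_le_numeral j] fin_elt_chain[OF s order_refl]
    using True between_left[OF s(1), of r W'] by (simp add: poly_qvar)
next
  case False
  show ?thesis
  proof (cases "W' \<subseteq> W")
    case True
    then show ?thesis
      unfolding fin_elt_mult convolution_chain[OF s one_le_numeral j] fin_elt_chain[OF s order_refl]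
      using False by auto
  next
    case sub: False
    show ?thesis
      unfolding fin_elt_mult convolution_chain[OF s one_le_numeral j] fin_elt_chain[OF s order_refl] between_empty[OF sub]
      using sub by simp
  qed
qed

text \<open>The only intermediate space is \<open>W'\<close>. For \<open>i > 0\<close> the space \<open>level i W W'\<close> contains \<open>W'\<close> and is merely
  rescaled; for \<open>i = 0\<close> the vector \<open>0\<close> is smeared out over \<open>W'\<close>.\<close>

lemma convolution_chain_average_right:
  assumes s: "W \<in> subspaces" "W' \<in> subspaces" "v \<in> carrier V" and i: "i \<le> 2"
  shows "convolution K d (fin_elt K d (chain_vec d k r i)) (fin_elt K d (chain_vec d 0 s 1)) (triple W W' v) =
    fin_elt K d (\<lambda>Z. (if r = s then qvar ^ (if i = 0 then 0 else r) else 0)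
      * chain_vec d k r (max i 1) Z) (triple W W' v)"
proof -
  have m: "max i 1 \<le> 2" using i by simp
  show ?thesis
  proof (cases "r = s \<and> card W' = q ^ s \<and> card W = q ^ (r + k) \<and> W' \<subseteq> W")
    case True
    have "card {u \<in> level i W W'. v \<ominus>\<^bsub>V\<^esub> u \<in> W'} =
      (if v \<in> level (max i 1) W W' then q ^ (if i = 0 then 0 else r) else 0)"
    proof (cases "i = 0")
      case True
      then show ?thesis using zero_translates(1)[OF s(2,3)] by simp
    next
      case False
      then have "card {u \<in> level i W W'. v \<ominus>\<^bsub>V\<^esub> u \<in> W'} = (if v \<in> level i W W' then card W' else 0)"
        using True s by (intro card_translates level_subspaces level_subset) auto
      moreover have "max i 1 = i" using False by simp
      ultimately show ?thesis using True False by simp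
    qed
    then show ?thesis
      unfolding fin_elt_mult convolution_chain[OF s i one_le_numeral] fin_elt_chain[OF s m]
      using True between_right[OF s(2), of r W] by (simp add: poly_qvar)
  next
    case False
    show ?thesis
  proof (cases "W' \<subseteq> W")
    case True
    then show ?thesis
      unfolding fin_elt_mult convolution_chain[OF s i one_le_numeral] fin_elt_chain[OF s m]
      using False by auto
  next
    case sub: False
    show ?thesis
      unfolding fin_elt_mult convolution_chain[OF s i one_le_numeral] fin_elt_chain[OF s m] between_empty[OF sub]
      using sub by simp
  qed
  qed
qed

text \<open>For \<open>x = 2\<close> this is the identity behind the Serre relation: a vector of \<open>W'\<close> lies in all \<open>q + 1\<close>
  intermediate spaces, any other vector of \<open>W\<close> in exactly one.\<close>

lemma count_intermediate_containing:
  assumes s: "W \<in> subspaces" "W' \<in> subspaces" "W' \<subseteq> W" and c: "card W = q ^ 2 * card W'" and x: "x \<le> 2"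
  shows "(\<Sum>H\<in>extensions W' W. of_bool (v \<in> level x H W')) =
    (if x < 2 then (q + 1) * of_bool (v \<in> level x W W') else q * of_bool (v \<in> W') + of_bool (v \<in> W))"
proof -
  have fin: "finite (extensions W' W)" unfolding extensions_def using finite_subspaces by simp
  have cS: "card (extensions W' W) = q + 1"
    using card_extensions[OF s(2,1,3) c] by (simp add: numeral_2_eq_2)
  show ?thesis
  proof (cases "x < 2")
    case True
    define L where "L = level x W W'"
    have "level x H W' = L" for H using True by (simp add: L_def level_def)
    then show ?thesis using cS True by (simp add: L_def[symmetric])
  next
    case False
    then have x2: "x = 2" using x by simp
    have "(\<Sum>H\<in>extensions W' W. of_bool (v \<in> level x H W')) = card {H \<in> extensions W' W. v \<in> H}"
      unfolding x2 using fin by (simp add: sum.inter_filter Int_def)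
    also have "\<dots> = q * of_bool (v \<in> W') + of_bool (v \<in> W)"
    proof -
      consider "v \<in> W'" | "v \<in> W" "v \<notin> W'" | "v \<notin> W" by auto
      then show ?thesis
      proof cases
        case 1
        then have "{H \<in> extensions W' W. v \<in> H} = extensions W' W" by (auto simp: extensions_def)
        moreover have "v \<in> W" using 1 s by auto
        ultimately show ?thesis using 1 cS by simp
      next
        case 2
        then show ?thesis using card_extensions_containing[OF s] by simp
      next
        case 3
        then have "{H \<in> extensions W' W. v \<in> H} = {}" by (auto simp: extensions_def)
        then have "card {H \<in> extensions W' W. v \<in> H} = 0" by (simp only: card.empty)
        moreover have "v \<notin> W'" using 3 s by auto
        ultimately show ?thesis using 3 by simp
      qed
    qed
    finally show ?thesis using False by simp
  qed
qed

text \<open>One of the two factors lives at \<open>v = 0\<close>, so the decomposition of \<open>v\<close> is forced and only the choice of the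
  intermediate space is counted. The cases \<open>(i, j) = (1, 0)\<close> and \<open>(0, 2)\<close> belong to the two ways of
  bracketing \<open>e\<ell>e\<close>.\<close>

lemma convolution_chain_step_step:
  assumes s: "W \<in> subspaces" "W' \<in> subspaces" "v \<in> carrier V" and ij: "i = 0 \<and> j \<le> 2 \<or> i = 1 \<and> j = 0"
  shows "convolution K d (fin_elt K d (chain_vec d 1 r i)) (fin_elt K d (chain_vec d 1 s j)) (triple W W' v) =
    fin_elt K d (\<lambda>Z. (if r = s + 1 then 1 else 0) *
      (if i = 0 \<and> j < 2 then (qvar + 1) * chain_vec d 2 s j Z
       else qvar * chain_vec d 2 s 1 Z + chain_vec d 2 s 2 Z)) (triple W W' v)"
proof -
  have i2: "i \<le> 2" and j2: "j \<le> 2" using ij by auto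
  \<comment> \<open>The position of \<open>v\<close> relative to the intermediate space that is forced by the two factors.\<close>
  define x where "x = (if i = 0 then j else 2)"
  have x2: "x \<le> 2" and x_less: "i = 0 \<and> j < 2 \<longleftrightarrow> x < 2" using ij by (auto simp: x_def)
  have val: "fin_elt K d (\<lambda>Z. (if r = s + 1 then 1 else 0) *
      (if i = 0 \<and> j < 2 then (qvar + 1) * chain_vec d 2 s j Z
       else qvar * chain_vec d 2 s 1 Z + chain_vec d 2 s 2 Z)) (triple W W' v) =
    (if r = s + 1 \<and> card W' = q ^ s \<and> card W = q ^ (s + 2) \<and> W' \<subseteq> W
     then of_nat (if x < 2 then (q + 1) * of_bool (v \<in> level x W W')
       else q * of_bool (v \<in> W') + of_bool (v \<in> W)) else 0)"
  proof (cases "x < 2")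
    case True
    then have "i = 0 \<and> j < 2" "x = j" using x_less by (auto simp: x_def)
    then show ?thesis
      unfolding fin_elt_mult if_P[OF \<open>i = 0 \<and> j < 2\<close>] fin_elt_chain[OF s j2] if_P[OF True] by simp
  next
    case False
    then have n: "\<not> (i = 0 \<and> j < 2)" using x_less by simp
    show ?thesis
      unfolding fin_elt_mult if_not_P[OF n] fin_elt_add fin_elt_chain[OF s one_le_numeral]
        fin_elt_chain[OF s order_refl] if_not_P[OF False] by simp
  qed
  have count: "card {u \<in> level i W H. v \<ominus>\<^bsub>V\<^esub> u \<in> level j H W'} = of_bool (v \<in> level x H W')"
    if "H \<in> subspaces" for H
  proof (cases "i = 0")
    case True
    then show ?thesis using zero_translates(1)[OF level_subspaces[OF that s(2)] s(3)] by (simp add: x_def)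
  next
    case False
    then show ?thesis using zero_translates(2)[OF that s(3)] ij by (simp add: x_def)
  qed
  show ?thesis
  proof (cases "r = s + 1 \<and> card W' = q ^ s \<and> card W = q ^ (s + 2) \<and> W' \<subseteq> W")
    case True
    then have c: "card W = q ^ 2 * card W'" by (simp add: power_add power2_eq_square)
    have M: "{H \<in> subspaces. W' \<subseteq> H \<and> H \<subseteq> W \<and> card H = q ^ r} = extensions W' W"
      using True by (auto simp: extensions_def)
    have "(\<Sum>H\<in>extensions W' W. card {u \<in> level i W H. v \<ominus>\<^bsub>V\<^esub> u \<in> level j H W'}) =
      (\<Sum>H\<in>extensions W' W. of_bool (v \<in> level x H W'))"
      by (intro sum.cong refl count) (simp add: extensions_def)
    moreover have "W' \<subseteq> W" using True by simp
    note count_intermediate_containing[OF s(1,2) this c x2, of v]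
    ultimately show ?thesis
      unfolding val if_P[OF True] convolution_chain[OF s i2 j2] M using True by simp
  next
    case False
    have val0: "(if r = s + 1 \<and> card W' = q ^ s \<and> card W = q ^ (s + 2) \<and> W' \<subseteq> W then x else 0) = (0 :: complex)" for x
      using False by (simp only: if_False)
    show ?thesis
    proof (cases "W' \<subseteq> W")
      case True
      then have "\<not> (r = s + 1 \<and> card W' = q ^ s \<and> card W = q ^ (r + 1))" using False by auto
      then show ?thesis unfolding val val0 convolution_chain[OF s i2 j2] by (simp only: if_False)
    next
      case sub: False
      show ?thesis
        unfolding val val0 convolution_chain[OF s i2 j2] between_empty[OF sub] by simp
    qed
  qed
qed

end

section \<open>Products of raising and lowering functions\<close>

text \<open>At a prime power \<open>q\<close> this is the number of points of a projective space of dimension \<open>n - 1\<close>.\<close>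

definition qsum :: "nat \<Rightarrow> int poly" where
  "qsum n = (\<Sum>i<n. qvar ^ i)"

definition e_label :: "nat \<Rightarrow> nat \<Rightarrow> label" where
  "e_label d r = (mat4 r 1 0 (d - r - 1), {})"

definition f_label :: "nat \<Rightarrow> nat \<Rightarrow> label" where
  "f_label d r = (mat4 r 0 1 (d - r - 1), {})"

definition cross_label :: "nat \<Rightarrow> nat \<Rightarrow> label" where
  "cross_label d r = (mat4 r 1 1 (d - r - 2), {})"

lemma e_label_chain: "unit_vec (e_label d r) = chain_vec d 1 r 0"
  by (simp add: e_label_def chain_vec_def prefix_sum_0 chain_label_def)

lemma f_label_transpose: "f_label d r = transpose_label (e_label d r)"
  by (simp add: f_label_def e_label_def transpose_label_mat4)

context finite_coord_space begin

lemma fin_elt_e: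
  assumes s: "W \<in> subspaces" "W' \<in> subspaces" "v \<in> carrier V"
  shows "fin_elt K d (unit_vec (e_label d r)) (triple W W' v) =
    of_bool (card W' = q ^ r \<and> W' \<in> hyperplanes W \<and> v = \<zero>\<^bsub>V\<^esub>)"
  unfolding e_label_chain fin_elt_chain[OF s le0] using s q_ge_2
  by (auto simp: hyperplanes_def)

lemma fin_elt_f:
  assumes s: "W \<in> subspaces" "W' \<in> subspaces" "v \<in> carrier V"
  shows "fin_elt K d (unit_vec (f_label d r)) (triple W W' v) =
    of_bool (card W = q ^ r \<and> W \<in> hyperplanes W' \<and> v = \<zero>\<^bsub>V\<^esub>)"
proof -
  have "fin_elt K d (unit_vec (f_label d r)) (triple W W' v) =
    fin_elt K d (unit_vec (e_label d r)) (triple W' W v)"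
    using orbit_transpose[of "e_label d r"]
    unfolding fin_elt_unit_vec_orbit f_label_transpose transpose_label_Xi by (auto simp: of_bool_def)
  then show ?thesis using fin_elt_e[OF s(2,1,3)] by simp
qed

lemma fin_elt_cross:
  assumes s: "W \<in> subspaces" "W' \<in> subspaces" "v \<in> carrier V"
  shows "fin_elt K d (unit_vec (cross_label d r)) (triple W W' v) =
    of_bool (W \<noteq> W' \<and> card W = q ^ (r + 1) \<and> card W' = q ^ (r + 1) \<and> v = \<zero>\<^bsub>V\<^esub> \<and> hyperplanes W \<inter> hyperplanes W' \<noteq> {})"
  unfolding fin_elt_unit_vec_orbit cross_label_def orbit_crossing_iff[OF s] ..

lemma poly_qsum: "poly (qsum n) (int q) = int (\<Sum>i<n. q ^ i)"
  by (simp add: qsum_def poly_sum)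

lemma convolution_zero_support:
  assumes s: "W \<in> subspaces" "W' \<in> subspaces" "v \<in> carrier V"
    and \<alpha>: "\<And>H u. H \<in> subspaces \<Longrightarrow> u \<in> carrier V \<Longrightarrow> \<alpha> (triple W H u) = of_bool (P H \<and> u = \<zero>\<^bsub>V\<^esub>)"
    and \<beta>: "\<And>H u. H \<in> subspaces \<Longrightarrow> u \<in> carrier V \<Longrightarrow> \<beta> (triple H W' u) = of_bool (Q H \<and> u = \<zero>\<^bsub>V\<^esub>)"
  shows "convolution K d \<alpha> \<beta> (triple W W' v) =
    of_bool (v = \<zero>\<^bsub>V\<^esub>) * of_nat (card {H \<in> subspaces. P H \<and> Q H})"
proof -
  have "(\<Sum>u\<in>carrier V. \<alpha> (triple W H u) * \<beta> (triple H W' (v \<ominus>\<^bsub>V\<^esub> u))) =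
     of_bool (v = \<zero>\<^bsub>V\<^esub>) * of_bool (P H \<and> Q H)" if H: "H \<in> subspaces" for H
  proof -
    have v0: "v \<ominus>\<^bsub>V\<^esub> \<zero>\<^bsub>V\<^esub> = v"
      using minus_minus_cancel[OF s(3,3)] s(3) by (simp add: a_minus_def r_neg)
    have "(\<Sum>u\<in>carrier V. \<alpha> (triple W H u) * \<beta> (triple H W' (v \<ominus>\<^bsub>V\<^esub> u))) =
      (\<Sum>u\<in>carrier V. if u = \<zero>\<^bsub>V\<^esub> then of_bool (P H) * \<beta> (triple H W' v) else 0)"
      using H s by (intro sum.cong refl) (auto simp: \<alpha> v0)
    also have "\<dots> = of_bool (P H) * \<beta> (triple H W' v)"
      using finite_vectors by simp
    finally show ?thesis using \<beta>[OF H s(3)]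
      by (cases "P H"; cases "Q H"; cases "v = \<zero>\<^bsub>V\<^esub>") simp_all
  qed
  then show ?thesis
    unfolding convolution_eq[OF s] using finite_subspaces
    by (simp add: sum_distrib_left[symmetric] sum.inter_filter[symmetric] Int_def)
qed

text \<open>On the diagonal the intermediate space is any hyperplane of \<open>W\<close>, off the diagonal the common
  hyperplane of \<open>W\<close> and \<open>W'\<close>, if there is one.\<close>

lemma convolution_e_f:
  assumes s: "W \<in> subspaces" "W' \<in> subspaces" "v \<in> carrier V"
  shows "convolution K d (fin_elt K d (unit_vec (e_label d r))) (fin_elt K d (unit_vec (f_label d t))) (triple W W' v) =
    fin_elt K d (\<lambda>Z. (if r = t then 1 else 0) * (qsum (r + 1) * chain_vec d 0 (r + 1) 0 Z + unit_vec (cross_label d r) Z))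
     (triple W W' v)"
proof -
  have L: "convolution K d (fin_elt K d (unit_vec (e_label d r))) (fin_elt K d (unit_vec (f_label d t))) (triple W W' v) =
    of_bool (v = \<zero>\<^bsub>V\<^esub>) * of_nat (card {H \<in> subspaces. (card H = q ^ r \<and> H \<in> hyperplanes W) \<and> (card H = q ^ t \<and> H \<in> hyperplanes W')})"
    using s by (intro convolution_zero_support) (simp_all add: fin_elt_e fin_elt_f)
  show ?thesis
  proof (cases "r = t \<and> card W = q ^ (r + 1) \<and> card W' = q ^ (r + 1)")
    case True
    then have "{H \<in> subspaces. (card H = q ^ r \<and> H \<in> hyperplanes W) \<and> (card H = q ^ t \<and> H \<in> hyperplanes W')} = hyperplanes W \<inter> hyperplanes W'"
      using q_ge_2 by (auto simp: hyperplanes_def)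
    moreover have "card (hyperplanes W \<inter> hyperplanes W') =
      (if W = W' then (\<Sum>i<r + 1. q ^ i) else of_bool (hyperplanes W \<inter> hyperplanes W' \<noteq> {}))"
      using card_hyperplanes[OF s(1), of "r + 1"] card_common_hyperplanes[OF s(1,2)] True
      by (cases "W = W'") (simp_all del: sum.lessThan_Suc)
    moreover have "W' \<subseteq> W \<longleftrightarrow> W = W'" using subspaces_eqI[OF s(1), of W'] True by auto
    ultimately show ?thesis
      unfolding L fin_elt_mult fin_elt_add fin_elt_chain[OF s le0] fin_elt_cross[OF s]
      using True by (simp add: poly_qsum del: sum.lessThan_Suc)
  next
    case False
    have "{H \<in> subspaces. (card H = q ^ r \<and> H \<in> hyperplanes W) \<and> (card H = q ^ t \<and> H \<in> hyperplanes W')} = {}"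
      using False q_pow_inj by (auto simp: hyperplanes_def)
    then have L0: "card {H \<in> subspaces. (card H = q ^ r \<and> H \<in> hyperplanes W) \<and> (card H = q ^ t \<and> H \<in> hyperplanes W')} = 0"
      by (simp only: card.empty)
    show ?thesis
    proof (cases "r = t")
      case True
      have z1: "(W' \<subseteq> W \<and> card W' = q ^ (r + 1) \<and> card W = q ^ (r + 1 + 0) \<and> v \<in> level 0 W W') = False"
        using False True by auto
      have z2: "(W \<noteq> W' \<and> card W = q ^ (r + 1) \<and> card W' = q ^ (r + 1) \<and>
          v = \<zero>\<^bsub>V\<^esub> \<and> hyperplanes W \<inter> hyperplanes W' \<noteq> {}) = False"
        using False True by auto
      show ?thesis
        unfolding L L0 fin_elt_mult fin_elt_add fin_elt_chain[OF s le0] fin_elt_cross[OF s] z1 z2 by simp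
    next
      case False
      then show ?thesis unfolding L L0 fin_elt_mult if_not_P[OF False] by simp
    qed
  qed
qed

text \<open>On the diagonal the intermediate space is any extension of \<open>W\<close> by one dimension inside \<open>V\<close>; off the
  diagonal a common extension exists exactly on the crossing orbit. The crossing label with
  \<open>r = 0\<close> has to be excluded explicitly because \<open>0 - 1 = 0\<close> for natural numbers.\<close>

lemma convolution_f_e:
  assumes s: "W \<in> subspaces" "W' \<in> subspaces" "v \<in> carrier V" and t: "r < d"
  shows "convolution K d (fin_elt K d (unit_vec (f_label d t))) (fin_elt K d (unit_vec (e_label d r))) (triple W W' v) =
    fin_elt K d (\<lambda>Z. (if r = t then 1 else 0) * (qsum (d - r) * chain_vec d 0 r 0 Z +
       (if r = 0 then 0 else 1) * unit_vec (cross_label d (r - 1)) Z))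
     (triple W W' v)"
proof -
  have L: "convolution K d (fin_elt K d (unit_vec (f_label d t))) (fin_elt K d (unit_vec (e_label d r))) (triple W W' v) =
    of_bool (v = \<zero>\<^bsub>V\<^esub>) * of_nat (card {H \<in> subspaces. (card W = q ^ t \<and> W \<in> hyperplanes H) \<and> (card W' = q ^ r \<and> W' \<in> hyperplanes H)})"
    using s by (intro convolution_zero_support) (simp_all add: fin_elt_e fin_elt_f)
  show ?thesis
  proof (cases "r = t \<and> card W = q ^ r \<and> card W' = q ^ r")
    case True
    then have M: "{H \<in> subspaces. (card W = q ^ t \<and> W \<in> hyperplanes H) \<and> (card W' = q ^ r \<and> W' \<in> hyperplanes H)} =
       extensions W (carrier V) \<inter> extensions W' (carrier V)"
      using s subspaces_subset by (auto simp: hyperplanes_def extensions_def)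
    have cV: "card (carrier V) = q ^ (d - r) * card W"
      using True t by (simp add: card_V power_add[symmetric])
    \<comment> \<open>In dimension zero there is no room for a crossing pair.\<close>
    have W0: "W = W'" if "r = 0"
    proof -
      have "X = {\<zero>\<^bsub>V\<^esub>}" if "X \<in> subspaces" "card X = q ^ r" for X
        using subspaces_eqI[OF that(1), of "{\<zero>\<^bsub>V\<^esub>}"] subspaces_zero[OF that(1)] that(2) \<open>r = 0\<close> by simp
      then show ?thesis using s True by metis
    qed
    have "card (extensions W (carrier V) \<inter> extensions W' (carrier V)) =
      (if W = W' then (\<Sum>i<d - r. q ^ i) else of_bool (hyperplanes W \<inter> hyperplanes W' \<noteq> {}))"
      using card_extensions[OF s(1) subspaces_carrier_V subspaces_subset[OF s(1)] cV] card_common_extensions[OF s(1,2)] True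
      by (cases "W = W'") simp_all
    moreover have "W' \<subseteq> W \<longleftrightarrow> W = W'" using subspaces_eqI[OF s(1), of W'] True by auto
    ultimately show ?thesis
      unfolding L M fin_elt_mult fin_elt_add fin_elt_chain[OF s le0] fin_elt_cross[OF s]
      using True W0 by (cases "r = 0") (auto simp add: poly_qsum)
  next
    case False
    have "{H \<in> subspaces. (card W = q ^ t \<and> W \<in> hyperplanes H) \<and> (card W' = q ^ r \<and> W' \<in> hyperplanes H)} = {}"
      using False q_pow_inj q_ge_2 by (auto simp: hyperplanes_def)
    then have L0: "card {H \<in> subspaces. (card W = q ^ t \<and> W \<in> hyperplanes H) \<and> (card W' = q ^ r \<and> W' \<in> hyperplanes H)} = 0"
      by (simp only: card.empty)
    show ?thesis
    proof (cases "r = t")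
      case True
      have z1: "(W' \<subseteq> W \<and> card W' = q ^ r \<and> card W = q ^ (r + 0) \<and> v \<in> level 0 W W') = False"
        using False True by auto
      show ?thesis
      proof (cases "r = 0")
        case True
        then show ?thesis
          unfolding L L0 fin_elt_mult fin_elt_add fin_elt_chain[OF s le0] z1 by simp
      next
        case r0: False
        have z2: "(W \<noteq> W' \<and> card W = q ^ (r - 1 + 1) \<and> card W' = q ^ (r - 1 + 1) \<and>
            v = \<zero>\<^bsub>V\<^esub> \<and> hyperplanes W \<inter> hyperplanes W' \<noteq> {}) = False"
          using False True r0 by auto
        show ?thesis
          unfolding L L0 fin_elt_mult fin_elt_add fin_elt_chain[OF s le0] fin_elt_cross[OF s] z1 z2 by simp
      qed
    next
      case False
      then show ?thesis unfolding L L0 fin_elt_mult if_not_P[OF False] by simp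
    qed
  qed
qed

end

section \<open>Products in the generic algebra\<close>

lemma chain_mult:
  assumes "\<And>i' j'. i' \<le> i \<Longrightarrow> j' \<le> j \<Longrightarrow> convolves_to d (chain_vec d k r i') (chain_vec d l s j') (c i' j')"
  shows "MU_mult d (gen_elt d (chain_vec d k r i)) (gen_elt d (chain_vec d l s j)) = gen_elt d (c i j)"
  unfolding chain_vec_def by (rule prefix_sum_mult) (use assms in \<open>simp add: chain_vec_def\<close>)

lemma scale_zero [simp]: "0 *\<^sub>v x = 0" "c *\<^sub>v 0 = 0"
  by (rule poly_mapping_eqI, simp)+

lemma scale_one [simp]: "1 *\<^sub>v x = x"
  by (rule poly_mapping_eqI) simp

definition chain :: "nat \<Rightarrow> nat \<Rightarrow> nat \<Rightarrow> nat \<Rightarrow> generic" where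
  "chain d k r j = gen_elt d (chain_vec d k r j)"

lemma poly_of_int_qvar [simp]: "poly (map_poly of_int (qvar ^ n)) x = (x :: ratfun) ^ n"
proof -
  have q: "map_poly of_int qvar = ([:0, 1:] :: ratfun poly)"
    by (simp add: qvar_def map_poly_pCons)
  have "map_poly of_int (qvar ^ n) = (map_poly of_int qvar :: ratfun poly) ^ n"
    by (induction n) (simp_all add: of_int_poly_mult)
  then show ?thesis by (simp add: q poly_power)
qed

lemma unit_mult_chain:
  assumes "j \<le> 2"
  shows "chain d 0 r 0 \<star>\<^bsub>d\<^esub> chain d l s j = (if r = s + l then chain d l s j else 0)"
proof -
  have "convolves_to d (chain_vec d 0 r 0) (chain_vec d l s j') (\<lambda>Z. (if r = s + l then 1 else 0) * chain_vec d l s j' Z)"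
    if "j' \<le> 2" for j'
    by (rule convolves_toI) (rule finite_coord_space.convolution_chain_unit_left, use that in auto)
  then have "chain d 0 r 0 \<star>\<^bsub>d\<^esub> chain d l s j = gen_elt d (\<lambda>Z. (if r = s + l then 1 else 0) * chain_vec d l s j Z)"
    unfolding chain_def using assms
    by (intro chain_mult[where c = "\<lambda>_ j' Z. (if r = s + l then 1 else 0) * chain_vec d l s j' Z"]) auto
  then show ?thesis by (simp add: chain_def)
qed

lemma chain_mult_unit:
  assumes "i \<le> 2"
  shows "chain d k r i \<star>\<^bsub>d\<^esub> chain d 0 s 0 = (if r = s then chain d k r i else 0)"
proof -
  have "convolves_to d (chain_vec d k r i') (chain_vec d 0 s 0) (\<lambda>Z. (if r = s then 1 else 0) * chain_vec d k r i' Z)"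
    if "i' \<le> 2" for i'
    by (rule convolves_toI) (rule finite_coord_space.convolution_chain_unit_right, use that in auto)
  then have "chain d k r i \<star>\<^bsub>d\<^esub> chain d 0 s 0 = gen_elt d (\<lambda>Z. (if r = s then 1 else 0) * chain_vec d k r i Z)"
    unfolding chain_def using assms
    by (intro chain_mult[where c = "\<lambda>i' _ Z. (if r = s then 1 else 0) * chain_vec d k r i' Z"]) auto
  then show ?thesis by (simp add: chain_def)
qed

lemma average_mult_chain:
  assumes "j \<le> 2"
  shows "chain d 0 r 1 \<star>\<^bsub>d\<^esub> chain d l s j =
    (if r = s + l then vv ^ (2 * (if j = 0 then 0 else if j = 1 then s else s + l)) *\<^sub>v chain d l s 2 else 0)"
proof -
  let ?c = "\<lambda>(i :: nat) (j :: nat) Z. if i = 0 then (if r = s + l then 1 else 0) * chain_vec d l s j Z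
    else (if r = s + l then qvar ^ (if j = 0 then 0 else if j = 1 then s else s + l) else 0) * chain_vec d l s 2 Z"
  have "convolves_to d (chain_vec d 0 r i') (chain_vec d l s j') (?c i' j')"
    if "i' \<le> 1" "j' \<le> 2" for i' j'
  proof (cases "i' = 0")
    case True
    show ?thesis unfolding True if_P[OF refl]
      by (rule convolves_toI) (rule finite_coord_space.convolution_chain_unit_left, use that in auto)
  next
    case False
    then have "i' = 1" using that by simp
    then show ?thesis unfolding if_not_P[OF False]
      by (intro convolves_toI) (simp only:, rule finite_coord_space.convolution_chain_average_left, use that in auto)
  qed
  then have "chain d 0 r 1 \<star>\<^bsub>d\<^esub> chain d l s j = gen_elt d (?c 1 j)"
    unfolding chain_def using assms by (intro chain_mult[where c = ?c]) auto
  then show ?thesis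
    by (simp only: one_neq_zero if_False gen_elt_mult) (simp add: chain_def power_mult)
qed

lemma chain_mult_average:
  assumes "i \<le> 2"
  shows "chain d k r i \<star>\<^bsub>d\<^esub> chain d 0 s 1 =
    (if r = s then vv ^ (2 * (if i = 0 then 0 else r)) *\<^sub>v chain d k r (max i 1) else 0)"
proof -
  let ?c = "\<lambda>(i :: nat) (j :: nat) Z. if j = 0 then (if r = s then 1 else 0) * chain_vec d k r i Z
    else (if r = s then qvar ^ (if i = 0 then 0 else r) else 0) * chain_vec d k r (max i 1) Z"
  have "convolves_to d (chain_vec d k r i') (chain_vec d 0 s j') (?c i' j')"
    if "i' \<le> 2" "j' \<le> 1" for i' j'
  proof (cases "j' = 0")
    case True
    show ?thesis unfolding True if_P[OF refl]
      by (rule convolves_toI) (rule finite_coord_space.convolution_chain_unit_right, use that in auto)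
  next
    case False
    then have "j' = 1" using that by simp
    then show ?thesis unfolding if_not_P[OF False]
      by (intro convolves_toI) (simp only:, rule finite_coord_space.convolution_chain_average_right, use that in auto)
  qed
  then have "chain d k r i \<star>\<^bsub>d\<^esub> chain d 0 s 1 = gen_elt d (?c i 1)"
    unfolding chain_def using assms by (intro chain_mult[where c = ?c]) auto
  then show ?thesis
    by (simp only: one_neq_zero if_False gen_elt_mult) (simp add: chain_def power_mult)
qed

lemma step_mult_step:
  assumes ij: "i = 0 \<and> j \<le> 2 \<or> i = 1 \<and> j = 0"
  shows "chain d 1 r i \<star>\<^bsub>d\<^esub> chain d 1 s j = (if r = s + 1 then
    if i = 0 \<and> j < 2 then (vv ^ 2 + 1) *\<^sub>v chain d 2 s j
    else vv ^ 2 *\<^sub>v chain d 2 s 1 + chain d 2 s 2 else 0)"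
proof -
  let ?c = "\<lambda>(i :: nat) (j :: nat) Z. (if r = s + 1 then 1 else 0) *
      (if i = 0 \<and> j < 2 then (qvar + 1) * chain_vec d 2 s j Z
       else qvar * chain_vec d 2 s 1 Z + chain_vec d 2 s 2 Z)"
  have conv: "convolves_to d (chain_vec d 1 r i') (chain_vec d 1 s j') (?c i' j')"
    if "i' = 0 \<and> j' \<le> 2 \<or> i' = 1 \<and> j' = 0" for i' j'
    by (rule convolves_toI) (rule finite_coord_space.convolution_chain_step_step, use that in auto)
  have "chain d 1 r i \<star>\<^bsub>d\<^esub> chain d 1 s j = gen_elt d (?c i j)"
    unfolding chain_def
  proof (rule chain_mult[where c = ?c])
    fix i' j' assume "i' \<le> i" "j' \<le> j"
    then have "i' = 0 \<and> j' \<le> 2 \<or> i' = 1 \<and> j' = 0" using ij by auto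
    then show "convolves_to d (chain_vec d 1 r i') (chain_vec d 1 s j') (?c i' j')" by (rule conv)
  qed
  moreover define b where "b \<longleftrightarrow> i = 0 \<and> j < 2"
  ultimately show ?thesis
    unfolding b_def[symmetric] using poly_of_int_qvar[of 1]
    by (cases b) (simp_all add: gen_elt_mult gen_elt_add chain_def of_int_poly_add)
qed

section \<open>The relations\<close>

lemma vv_nonzero [simp]: "vv \<noteq> 0"
  by (simp add: vv_def Zero_fract_def eq_fract)

lemma vv_square_neq_one: "vv ^ 2 \<noteq> 1"
  by (simp add: vv_def One_fract_def power2_eq_square eq_fract one_pCons)

lemma vv_powi_add: "vv powi (m + n) = vv powi m * vv powi n"
  by (simp add: power_int_add)

lemma vv_power: "vv ^ n = vv powi int n"
  by simp

lemma vv_minus_inverse: "vv - vv powi (-1) = (vv ^ 2 - 1) / vv"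
  by (simp add: power_int_minus field_simps power2_eq_square)

text \<open>All generators except \<open>f\<close> have this form, with \<open>k = 0\<close> for \<open>\<ell>\<close> and the diagonal elements and
  \<open>k = 1\<close> for \<open>e\<close>. The range of summation is that of the possible dimensions of \<open>W'\<close>.\<close>

definition graded :: "nat \<Rightarrow> nat \<Rightarrow> (nat \<Rightarrow> ratfun) \<Rightarrow> nat \<Rightarrow> generic" where
  "graded d k a j = (\<Sum>r<d + 1 - k. a r *\<^sub>v chain d k r j)"

lemma scale_scale [simp]: "a *\<^sub>v b *\<^sub>v x = (a * b) *\<^sub>v x"
  by (rule poly_mapping_eqI) (simp add: mult_ac)

lemma scale_add_right: "a *\<^sub>v (x + y) = a *\<^sub>v x + a *\<^sub>v y"
  by (rule poly_mapping_eqI) (simp add: lookup_add distrib_left)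

lemma scale_add_left: "(a + b) *\<^sub>v x = a *\<^sub>v x + b *\<^sub>v x"
  by (rule poly_mapping_eqI) (simp add: lookup_add distrib_right)

lemma scale_diff_left: "(a - b) *\<^sub>v x = a *\<^sub>v x - b *\<^sub>v x"
  by (rule poly_mapping_eqI) (simp add: lookup_minus left_diff_distrib)

lemma scale_diff_right: "a *\<^sub>v (x - y) = a *\<^sub>v x - a *\<^sub>v y"
  by (rule poly_mapping_eqI) (simp add: lookup_minus right_diff_distrib)

lemma scale_sum: "a *\<^sub>v (\<Sum>i\<in>I. x i) = (\<Sum>i\<in>I. a *\<^sub>v x i)"
  by (rule poly_mapping_eqI) (simp add: lookup_sum sum_distrib_left)

lemma graded_cong: "(\<And>r. a r = b r) \<Longrightarrow> graded d k a j = graded d k b j"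
  by (simp add: graded_def)

lemma scale_graded: "c *\<^sub>v graded d k a j = graded d k (\<lambda>r. c * a r) j"
  by (simp add: graded_def scale_sum)

text \<open>Products vanish unless the dimensions of the middle spaces match, so a product of weighted sums is
  again a single weighted sum.\<close>

lemma sum_mult_graded:
  fixes m n p l :: nat
  assumes "\<And>r s. r < m \<Longrightarrow> s < n \<Longrightarrow> P r \<star>\<^bsub>d\<^esub> Q s = (if r = s + l then R s else 0)"
    and p: "\<And>s. s < p \<longleftrightarrow> s < n \<and> s + l < m"
  shows "(\<Sum>r<m. a r *\<^sub>v P r) \<star>\<^bsub>d\<^esub> (\<Sum>s<n. b s *\<^sub>v Q s) = (\<Sum>s<p. (a (s + l) * b s) *\<^sub>v R s)"
proof -
  have "(\<Sum>r<m. a r *\<^sub>v P r) \<star>\<^bsub>d\<^esub> (\<Sum>s<n. b s *\<^sub>v Q s) =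
    (\<Sum>s<n. \<Sum>r<m. (a r * b s) *\<^sub>v (P r \<star>\<^bsub>d\<^esub> Q s))"
    unfolding MU_mult_sum_left MU_mult_sum_right MU_mult_scale_left MU_mult_scale_right
    by (simp add: scale_sum mult.commute)
  also have "\<dots> = (\<Sum>s<n. \<Sum>r<m. if r = s + l then (a (s + l) * b s) *\<^sub>v R s else 0)"
    using assms(1) by (intro sum.cong refl) auto
  also have "\<dots> = (\<Sum>s<n. if s + l < m then (a (s + l) * b s) *\<^sub>v R s else 0)"
    by (intro sum.cong refl) (simp only: sum.delta[OF finite_lessThan] lessThan_iff)
  also have "\<dots> = (\<Sum>s<p. (a (s + l) * b s) *\<^sub>v R s)"
  proof -
    have "{..<p} = {s \<in> {..<n}. s + l < m}" using p by blast
    then show ?thesis by (simp only: sum.inter_filter[OF finite_lessThan])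
  qed
  finally show ?thesis .
qed

lemma diagonal_mult_graded:
  assumes "j \<le> 2"
  shows "graded d 0 a 0 \<star>\<^bsub>d\<^esub> graded d l b j = graded d l (\<lambda>s. a (s + l) * b s) j"
  unfolding graded_def by (rule sum_mult_graded) (use unit_mult_chain[OF assms] in auto)

lemma graded_mult_diagonal:
  assumes "i \<le> 2"
  shows "graded d k b i \<star>\<^bsub>d\<^esub> graded d 0 a 0 = graded d k (\<lambda>s. b s * a s) i"
proof -
  have "graded d k b i \<star>\<^bsub>d\<^esub> graded d 0 a 0 = (\<Sum>s<d + 1 - k. (b (s + 0) * a s) *\<^sub>v chain d k s i)"
    unfolding graded_def by (rule sum_mult_graded) (use chain_mult_unit[OF assms] in auto)
  then show ?thesis by (simp add: graded_def)
qed

lemma average_mult_graded: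
  assumes "j \<le> 2"
  shows "graded d 0 a 1 \<star>\<^bsub>d\<^esub> graded d l b j =
    graded d l (\<lambda>s. a (s + l) * b s * vv ^ (2 * (if j = 0 then 0 else if j = 1 then s else s + l))) 2"
proof -
  have "graded d 0 a 1 \<star>\<^bsub>d\<^esub> graded d l b j = (\<Sum>s<d + 1 - l. (a (s + l) * b s) *\<^sub>v
     (vv ^ (2 * (if j = 0 then 0 else if j = 1 then s else s + l)) *\<^sub>v chain d l s 2))"
    unfolding graded_def by (rule sum_mult_graded) (use average_mult_chain[OF assms] in auto)
  then show ?thesis by (simp add: graded_def)
qed

lemma graded_mult_average:
  assumes "i \<le> 2"
  shows "graded d k b i \<star>\<^bsub>d\<^esub> graded d 0 a 1 =
    graded d k (\<lambda>s. b s * a s * vv ^ (2 * (if i = 0 then 0 else s))) (max i 1)"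
proof -
  have "graded d k b i \<star>\<^bsub>d\<^esub> graded d 0 a 1 = (\<Sum>s<d + 1 - k. (b (s + 0) * a s) *\<^sub>v
     (vv ^ (2 * (if i = 0 then 0 else s)) *\<^sub>v chain d k s (max i 1)))"
    unfolding graded_def by (rule sum_mult_graded) (use chain_mult_average[OF assms] in auto)
  then show ?thesis by (simp add: graded_def)
qed

lemma step_mult_step_graded:
  "graded d 1 b 0 \<star>\<^bsub>d\<^esub> graded d 1 c 0 = graded d 2 (\<lambda>s. b (s + 1) * c s * (vv ^ 2 + 1)) 0"
  "i = 0 \<and> j = 2 \<or> i = 1 \<and> j = 0 \<Longrightarrow> graded d 1 b i \<star>\<^bsub>d\<^esub> graded d 1 c j =
     graded d 2 (\<lambda>s. b (s + 1) * c s * vv ^ 2) 1 + graded d 2 (\<lambda>s. b (s + 1) * c s) 2"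
proof -
  have "graded d 1 b 0 \<star>\<^bsub>d\<^esub> graded d 1 c 0 =
      (\<Sum>s<d + 1 - 2. (b (s + 1) * c s) *\<^sub>v ((vv ^ 2 + 1) *\<^sub>v chain d 2 s 0))"
    unfolding graded_def by (rule sum_mult_graded) (use step_mult_step[of 0 0] in auto)
  then show "graded d 1 b 0 \<star>\<^bsub>d\<^esub> graded d 1 c 0 = graded d 2 (\<lambda>s. b (s + 1) * c s * (vv ^ 2 + 1)) 0"
    by (simp add: graded_def)
  assume ij: "i = 0 \<and> j = 2 \<or> i = 1 \<and> j = 0"
  then have "graded d 1 b i \<star>\<^bsub>d\<^esub> graded d 1 c j =
      (\<Sum>s<d + 1 - 2. (b (s + 1) * c s) *\<^sub>v (vv ^ 2 *\<^sub>v chain d 2 s 1 + chain d 2 s 2))"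
    unfolding graded_def by (intro sum_mult_graded) (use step_mult_step[of i j] in auto)
  then show "graded d 1 b i \<star>\<^bsub>d\<^esub> graded d 1 c j =
     graded d 2 (\<lambda>s. b (s + 1) * c s * vv ^ 2) 1 + graded d 2 (\<lambda>s. b (s + 1) * c s) 2"
    by (simp add: graded_def scale_add_right sum.distrib)
qed

text \<open>For \<open>k = 0\<close> both \<open>v \<in> W'\<close> and \<open>v \<in> W\<close> say the same.\<close>

lemma graded_zero_top: "graded d 0 a 2 = graded d 0 a 1"
proof -
  have "chain d 0 r 2 = chain d 0 r 1" for r
  proof -
    have "chain_label d 0 r 2 \<notin> Xi d" by (simp add: chain_label_def Xi_mat4_iff)
    moreover have "chain_vec d 0 r 2 = (\<lambda>Z. chain_vec d 0 r 1 Z + unit_vec (chain_label d 0 r 2) Z)"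
      by (simp add: chain_vec_def prefix_sum_def numeral_2_eq_2)
    ultimately show ?thesis by (simp add: chain_def gen_elt_add gen_elt_unit_vec)
  qed
  then show ?thesis by (simp add: graded_def)
qed

subsection \<open>The generators as weighted sums\<close>

abbreviation l_coeff :: "nat \<Rightarrow> ratfun" where "l_coeff r \<equiv> vv powi (- 2 * int r)"

lemma label_matrices:
  "diag_mat2 r n = mat4 r 0 0 n"
  "add_mat2 (diag_mat2 r n) (elem_mat2 1 2) = mat4 r 1 0 n"
  "add_mat2 (diag_mat2 r n) (elem_mat2 2 1) = mat4 r 0 1 n"
  unfolding diag_mat2_def mat4_def add_mat2_def elem_mat2_def
  by (intro ext, rename_tac i j, case_tac "i = 1"; case_tac "i = 2"; case_tac "j = 1"; case_tac "j = 2";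
      simp only: simp_thms if_True if_False numeral_eq_iff add_0_left add_0_right num.distinct one_eq_numeral_iff numeral_eq_one_iff)+

lemma chain_0_0: "r \<le> d \<Longrightarrow> chain d 0 r 0 = one_elt d r"
proof -
  assume "r \<le> d"
  then have "(mat4 r 0 0 (d - r), {}) \<in> Xi d" by (simp add: Xi_mat4_iff)
  then show ?thesis
    by (simp add: chain_def chain_vec_def prefix_sum_0 chain_label_def gen_elt_unit_vec one_elt_def label_matrices)
qed

lemma chain_0_1: "r \<le> d \<Longrightarrow> chain d 0 r 1 = one_elt d r + (if r = 0 then 0 else x_elt d r)"
proof -
  assume r: "r \<le> d"
  have "(mat4 r 0 0 (d - r), {(1, 1)}) \<in> Xi d \<longleftrightarrow> r \<noteq> 0" using r by (auto simp: Xi_mat4_iff)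
  moreover have "chain d 0 r 1 = chain d 0 r 0 + gen_elt d (unit_vec (chain_label d 0 r 1))"
    unfolding chain_def gen_elt_add[symmetric] by (simp add: chain_vec_def prefix_sum_def)
  ultimately show ?thesis
    using chain_0_0[OF r] by (simp add: chain_label_def gen_elt_unit_vec x_elt_def label_matrices)
qed

lemma chain_1_0: "r < d \<Longrightarrow> chain d 1 r 0 = e_elt d r"
proof -
  assume "r < d"
  then have "(mat4 r 1 0 (d - r - 1), {}) \<in> Xi d" by (simp add: Xi_mat4_iff)
  then show ?thesis
    by (simp add: chain_def chain_vec_def prefix_sum_0 chain_label_def gen_elt_unit_vec e_elt_def label_matrices(2)[simplified])
qed

lemma transpose_e_elt: "transpose_elt (e_elt d r) = f_elt d r"
  unfolding e_elt_def f_elt_def transpose_elt_T label_matrices(2,3) transpose_label_mat4 by simp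

lemma transpose_chain_0: "j \<le> 1 \<Longrightarrow> r \<le> d \<Longrightarrow> transpose_elt (chain d 0 r j) = chain d 0 r j"
proof -
  assume j: "j \<le> 1" and r: "r \<le> d"
  have "transpose_elt (one_elt d r) = one_elt d r" "transpose_elt (x_elt d r) = x_elt d r"
    by (simp_all add: label_matrices one_elt_def x_elt_def transpose_elt_T transpose_label_mat4)
  moreover have "j = 0 \<or> j = 1" using j by auto
  ultimately show ?thesis
    using chain_0_0[OF r] chain_0_1[OF r] by (auto simp: transpose_elt_add)
qed

lemma transpose_graded_0: "j \<le> 1 \<Longrightarrow> transpose_elt (graded d 0 a j) = graded d 0 a j"
  by (simp add: graded_def transpose_elt_sum transpose_elt_scale transpose_chain_0 del: sum.lessThan_Suc)

lemma sum_atLeast0AtMost: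
  fixes d :: nat
  shows "d > 0 \<Longrightarrow> (\<Sum>r=0..d - 1. f r) = (\<Sum>r<d. f r)" "(\<Sum>r=0..d. f r) = (\<Sum>r<d + 1. f r)"
proof -
  show "(\<Sum>r=0..d. f r) = (\<Sum>r<d + 1. f r)"
    by (simp only: atLeast0AtMost lessThan_Suc_atMost Suc_eq_plus1[symmetric])
  assume "d > 0"
  then have "{0..d - 1} = {..<d}" by auto
  then show "(\<Sum>r=0..d - 1. f r) = (\<Sum>r<d. f r)" by simp
qed

lemma chev_e_graded: "d > 0 \<Longrightarrow> chev_e d = graded d 1 (\<lambda>r. vv powi (- int r)) 0"
  by (simp add: chev_e_def graded_def sum_atLeast0AtMost chain_1_0[simplified])

lemma chev_f_graded: "d > 0 \<Longrightarrow> chev_f d = transpose_elt (graded d 1 (\<lambda>r. vv powi (1 + int r - int d)) 0)"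
  by (simp add: chev_f_def graded_def sum_atLeast0AtMost chain_1_0[simplified] transpose_elt_sum transpose_elt_scale transpose_e_elt)

lemma chev_k_graded: "chev_k d = graded d 0 (\<lambda>r. vv powi (2 * int r - int d)) 0"
  by (simp add: chev_k_def graded_def sum_atLeast0AtMost chain_0_0 del: sum.lessThan_Suc)

lemma chev_kinv_graded: "chev_kinv d = graded d 0 (\<lambda>r. vv powi (int d - 2 * int r)) 0"
  by (simp add: chev_kinv_def graded_def sum_atLeast0AtMost chain_0_0 del: sum.lessThan_Suc)

lemma MU_one_graded: "MU_one d = graded d 0 (\<lambda>r. 1) 0"
  by (simp add: MU_one_def graded_def sum_atLeast0AtMost chain_0_0 del: sum.lessThan_Suc)

lemma chev_l_graded: "chev_l d = graded d 0 l_coeff 1"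
proof -
  have "graded d 0 l_coeff 1 = (\<Sum>r=0..d. l_coeff r *\<^sub>v (one_elt d r + (if r = 0 then 0 else x_elt d r)))"
    unfolding sum_atLeast0AtMost graded_def by (intro sum.cong) (auto simp: chain_0_1[simplified])
  also have "\<dots> = l_coeff 0 *\<^sub>v (one_elt d 0 + 0) + (\<Sum>r=1..d. l_coeff r *\<^sub>v (one_elt d r + x_elt d r))"
    by (subst sum.atLeast_Suc_atMost) auto
  finally show ?thesis by (simp add: chev_l_def)
qed

lemma l_coeff_cancel: "l_coeff r * vv ^ (2 * r) = 1"
  unfolding vv_power vv_powi_add[symmetric] by simp

lemma l_idempotent: "chev_l d \<star>\<^bsub>d\<^esub> chev_l d = chev_l d"
  unfolding chev_l_graded average_mult_graded[OF one_le_numeral]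
  by (simp add: mult.assoc l_coeff_cancel[simplified] graded_zero_top[simplified])

text \<open>Averaging over \<open>W\<close> absorbs averaging over \<open>W' \<subseteq> W\<close>. The two bracketings serve \<open>e\<close> and, after
  transposition, \<open>f\<close>.\<close>

lemma l_absorbs_step:
  "(chev_l d \<star>\<^bsub>d\<^esub> graded d 1 c 0) \<star>\<^bsub>d\<^esub> chev_l d = chev_l d \<star>\<^bsub>d\<^esub> graded d 1 c 0"
  "chev_l d \<star>\<^bsub>d\<^esub> (graded d 1 c 0 \<star>\<^bsub>d\<^esub> chev_l d) = chev_l d \<star>\<^bsub>d\<^esub> graded d 1 c 0"
  unfolding chev_l_graded average_mult_graded[OF zero_le]
    graded_mult_average[OF order_refl] graded_mult_average[OF zero_le] max_0L
    average_mult_graded[OF one_le_numeral]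
  by (simp_all add: mult.assoc l_coeff_cancel[simplified] max_def)

lemma qint_2: "qint 2 = vv + vv powi (-1)"
proof -
  have "(vv - vv powi (-1)) * (vv + vv powi (-1)) = vv powi int 2 - vv powi (- int 2)"
    by (simp add: power_int_minus field_simps power2_eq_square)
  moreover have "vv - vv powi (-1) \<noteq> 0"
    unfolding vv_minus_inverse using vv_square_neq_one by simp
  ultimately show ?thesis unfolding qint_def by (metis nonzero_mult_div_cancel_left)
qed

text \<open>With \<open>m s = c (s + 1) c s \<^bold>v\<^sup>-\<^sup>2\<^sup>s\<close> the three products have, in terms of the indicators of \<open>W'\<close> and \<open>W\<close>, the
  coefficients \<open>(m, \<^bold>v\<^sup>-\<^sup>2 m)\<close>, \<open>((\<^bold>v\<^sup>2 + 1) m, 0)\<close> and \<open>(0, \<^bold>v\<^sup>-\<^sup>4 (\<^bold>v\<^sup>2 + 1) m)\<close>, and \<open>[2] = \<^bold>v\<^sup>-\<^sup>1 (\<^bold>v\<^sup>2 + 1)\<close>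
  accounts for the factors in the relation.\<close>

lemma serre_identity:
  "qint 2 *\<^sub>v (graded d 1 c 0 \<star>\<^bsub>d\<^esub> chev_l d \<star>\<^bsub>d\<^esub> graded d 1 c 0) =
     vv powi (-1) *\<^sub>v ((graded d 1 c 0 \<star>\<^bsub>d\<^esub> graded d 1 c 0) \<star>\<^bsub>d\<^esub> chev_l d) +
     vv *\<^sub>v (chev_l d \<star>\<^bsub>d\<^esub> (graded d 1 c 0 \<star>\<^bsub>d\<^esub> graded d 1 c 0))" (is ?left)
  "qint 2 *\<^sub>v (graded d 1 c 0 \<star>\<^bsub>d\<^esub> (chev_l d \<star>\<^bsub>d\<^esub> graded d 1 c 0)) =
     vv powi (-1) *\<^sub>v ((graded d 1 c 0 \<star>\<^bsub>d\<^esub> graded d 1 c 0) \<star>\<^bsub>d\<^esub> chev_l d) +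
     vv *\<^sub>v (chev_l d \<star>\<^bsub>d\<^esub> (graded d 1 c 0 \<star>\<^bsub>d\<^esub> graded d 1 c 0))" (is ?right)
proof -
  let ?E = "graded d 1 c 0"
  have next_coeff: "l_coeff (s + n) = l_coeff s * vv powi (- 2 * int n)" for s n
    by (simp add: vv_powi_add[symmetric] algebra_simps)
  let ?m = "\<lambda>s. c (s + 1) * c s * l_coeff s"
  have left: "?E \<star>\<^bsub>d\<^esub> chev_l d \<star>\<^bsub>d\<^esub> ?E = graded d 2 ?m 1 + graded d 2 (\<lambda>s. ?m s * vv powi (-2)) 2"
  proof -
    have "?E \<star>\<^bsub>d\<^esub> chev_l d \<star>\<^bsub>d\<^esub> ?E = graded d 2 (\<lambda>s. c (s + 1) * l_coeff (s + 1) * c s * vv ^ 2) 1 +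
       graded d 2 (\<lambda>s. c (s + 1) * l_coeff (s + 1) * c s) 2"
      unfolding chev_l_graded graded_mult_average[OF zero_le] max_0L
      by (subst step_mult_step_graded(2)) simp_all
    also have "\<dots> = graded d 2 ?m 1 + graded d 2 (\<lambda>s. ?m s * vv powi (-2)) 2"
      unfolding next_coeff
      by (intro arg_cong2[of _ _ _ _ "(+)"] graded_cong) (simp_all add: power_int_minus field_simps)
    finally show ?thesis .
  qed
  have right: "?E \<star>\<^bsub>d\<^esub> (chev_l d \<star>\<^bsub>d\<^esub> ?E) = graded d 2 ?m 1 + graded d 2 (\<lambda>s. ?m s * vv powi (-2)) 2"
  proof -
    have "?E \<star>\<^bsub>d\<^esub> (chev_l d \<star>\<^bsub>d\<^esub> ?E) = graded d 2 (\<lambda>s. c (s + 1) * (l_coeff (s + 1) * c s) * vv ^ 2) 1 +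
       graded d 2 (\<lambda>s. c (s + 1) * (l_coeff (s + 1) * c s)) 2"
      unfolding chev_l_graded average_mult_graded[OF zero_le]
      by (subst step_mult_step_graded(2)) simp_all
    also have "\<dots> = graded d 2 ?m 1 + graded d 2 (\<lambda>s. ?m s * vv powi (-2)) 2"
      unfolding next_coeff
      by (intro arg_cong2[of _ _ _ _ "(+)"] graded_cong) (simp_all add: power_int_minus field_simps)
    finally show ?thesis .
  qed
  have eel: "(?E \<star>\<^bsub>d\<^esub> ?E) \<star>\<^bsub>d\<^esub> chev_l d = graded d 2 (\<lambda>s. ?m s * (vv ^ 2 + 1)) 1"
    unfolding chev_l_graded step_mult_step_graded(1) graded_mult_average[OF zero_le] max_0L
    by (intro graded_cong) (simp add: mult_ac)
  have lee: "chev_l d \<star>\<^bsub>d\<^esub> (?E \<star>\<^bsub>d\<^esub> ?E) = graded d 2 (\<lambda>s. ?m s * (vv ^ 2 + 1) * vv powi (-4)) 2"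
    unfolding chev_l_graded step_mult_step_graded(1) average_mult_graded[OF zero_le] next_coeff
    by (intro graded_cong) (simp add: mult_ac)
  have "qint 2 *\<^sub>v (graded d 2 ?m 1 + graded d 2 (\<lambda>s. ?m s * vv powi (-2)) 2) =
     vv powi (-1) *\<^sub>v graded d 2 (\<lambda>s. ?m s * (vv ^ 2 + 1)) 1 +
     vv *\<^sub>v graded d 2 (\<lambda>s. ?m s * (vv ^ 2 + 1) * vv powi (-4)) 2"
  proof -
    have q1: "qint 2 = vv powi (-1) * (vv ^ 2 + 1)"
      unfolding qint_2 by (simp add: power_int_minus field_simps power2_eq_square)
    have q2: "qint 2 * vv powi (-2) = vv * (vv ^ 2 + 1) * vv powi (-4)"
      unfolding q1 by (simp add: power_int_minus field_simps power2_eq_square eval_nat_numeral)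
    show ?thesis
      unfolding scale_add_right scale_graded
    proof (intro arg_cong2[of _ _ _ _ "(+)"] graded_cong)
      show "qint 2 * ?m r = vv powi (-1) * (?m r * (vv ^ 2 + 1))" for r
        unfolding q1 by (simp only: mult_ac)
      have "qint 2 * (?m r * vv powi (-2)) = ?m r * (qint 2 * vv powi (-2))" for r by (simp only: mult_ac)
      then show "qint 2 * (?m r * vv powi (-2)) = vv * (?m r * (vv ^ 2 + 1) * vv powi (-4))" for r
        unfolding q2 by (simp only: mult_ac)
    qed
  qed
  then show ?left ?right unfolding left right eel lee by simp_all
qed

subsection \<open>The commutator\<close>

lemma gen_elt_f: "r < d \<Longrightarrow> gen_elt d (unit_vec (f_label d r)) = f_elt d r"
proof -
  assume "r < d"
  then have "f_label d r \<in> Xi d" by (simp add: f_label_def Xi_mat4_iff)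
  then show ?thesis
    unfolding gen_elt_unit_vec f_elt_def label_matrices(3) by (simp add: f_label_def)
qed

lemma gen_elt_e: "r < d \<Longrightarrow> gen_elt d (unit_vec (e_label d r)) = e_elt d r"
  using chain_1_0[of r d] by (simp add: chain_def e_label_chain)

text \<open>The value of \<open>qsum n\<close> at \<open>\<^bold>v\<^sup>2\<close>.\<close>

definition geom :: "nat \<Rightarrow> ratfun" where
  "geom n = (\<Sum>i<n. (vv ^ 2) ^ i)"

lemma geom_eq: "geom n = (vv ^ (2 * n) - 1) / (vv ^ 2 - 1)"
  using vv_square_neq_one unfolding geom_def by (simp add: geometric_sum power_mult)

lemma poly_of_int_qsum: "poly (map_poly of_int (qsum n)) (vv ^ 2) = geom n"
  by (simp add: qsum_def of_int_poly_sum poly_sum geom_def)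

definition cross :: "nat \<Rightarrow> nat \<Rightarrow> generic" where
  "cross d r = gen_elt d (unit_vec (cross_label d r))"

lemma e_mult_f:
  assumes "r < d" "t < d"
  shows "e_elt d r \<star>\<^bsub>d\<^esub> f_elt d t = (if r = t then geom (r + 1) *\<^sub>v one_elt d (r + 1) + cross d r else 0)"
proof -
  have "convolves_to d (unit_vec (e_label d r)) (unit_vec (f_label d t))
    (\<lambda>Z. (if r = t then 1 else 0) * (qsum (r + 1) * chain_vec d 0 (r + 1) 0 Z + unit_vec (cross_label d r) Z))"
    by (rule convolves_toI) (rule finite_coord_space.convolution_e_f)
  from unit_vec_mult_unit_vec[OF this] show ?thesis
    using assms unfolding gen_elt_e[OF assms(1)] gen_elt_f[OF assms(2)] gen_elt_mult gen_elt_add poly_of_int_qsum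
    by (simp add: cross_def chain_0_0[symmetric] chain_def)
qed

lemma f_mult_e:
  assumes "r < d" "t < d"
  shows "f_elt d t \<star>\<^bsub>d\<^esub> e_elt d r = (if r = t then geom (d - r) *\<^sub>v one_elt d r +
    (if r = 0 then 0 else cross d (r - 1)) else 0)"
proof -
  have "convolves_to d (unit_vec (f_label d t)) (unit_vec (e_label d r))
    (\<lambda>Z. (if r = t then 1 else 0) * (qsum (d - r) * chain_vec d 0 r 0 Z +
       (if r = 0 then 0 else 1) * unit_vec (cross_label d (r - 1)) Z))"
    by (rule convolves_toI) (rule finite_coord_space.convolution_f_e, use assms in auto)
  from unit_vec_mult_unit_vec[OF this] show ?thesis
    using assms unfolding gen_elt_e[OF assms(1)] gen_elt_f[OF assms(2)] gen_elt_mult gen_elt_add poly_of_int_qsum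
    by (simp add: cross_def chain_0_0[symmetric] chain_def)
qed

text \<open>All products \<open>e\<^sub>r f\<^sub>r\<close> and \<open>f\<^sub>r e\<^sub>r\<close> carry the same weight \<open>\<^bold>v\<^bsup>1-d\<^esup>\<close>. The crossing terms cancel after a shift
  of the index, and the diagonal coefficients are differences of two geometric sums.\<close>

lemma commutator:
  assumes d: "d > 0"
  shows "chev_e d \<star>\<^bsub>d\<^esub> chev_f d - chev_f d \<star>\<^bsub>d\<^esub> chev_e d =
      (1 / (vv - vv powi (-1))) *\<^sub>v (chev_k d - chev_kinv d)"
proof -
  let ?a = "\<lambda>r. vv powi (- int r)" and ?b = "\<lambda>r. vv powi (1 + int r - int d)"
  let ?c = "vv powi (1 - int d)"
  have e: "chev_e d = (\<Sum>r<d. ?a r *\<^sub>v e_elt d r)" and f: "chev_f d = (\<Sum>r<d. ?b r *\<^sub>v f_elt d r)"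
    using d by (simp_all add: chev_e_def chev_f_def sum_atLeast0AtMost)
  have ab: "?a r * ?b r = ?c" "?b r * ?a r = ?c" for r
    by (simp_all add: vv_powi_add[symmetric])
  have "chev_e d \<star>\<^bsub>d\<^esub> chev_f d = (\<Sum>r<d. (?a (r + 0) * ?b r) *\<^sub>v (geom (r + 1) *\<^sub>v one_elt d (r + 1) + cross d r))"
    unfolding e f by (rule sum_mult_graded) (use e_mult_f in auto)
  also have "\<dots> = ?c *\<^sub>v ((\<Sum>r<d. geom (r + 1) *\<^sub>v one_elt d (r + 1)) + (\<Sum>r<d. cross d r))"
    by (simp add: ab scale_sum scale_add_right sum.distrib)
  also have "(\<Sum>r<d. geom (r + 1) *\<^sub>v one_elt d (r + 1)) = (\<Sum>r<d + 1. geom r *\<^sub>v one_elt d r)"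
    unfolding Suc_eq_plus1[symmetric] sum.lessThan_Suc_shift by (simp add: geom_def)
  finally have ef: "chev_e d \<star>\<^bsub>d\<^esub> chev_f d = ?c *\<^sub>v ((\<Sum>r<d + 1. geom r *\<^sub>v one_elt d r) + (\<Sum>r<d. cross d r))" .
  have "chev_f d \<star>\<^bsub>d\<^esub> chev_e d = (\<Sum>r<d. (?b (r + 0) * ?a r) *\<^sub>v (geom (d - r) *\<^sub>v one_elt d r +
      (if r = 0 then 0 else cross d (r - 1))))"
    unfolding e f by (rule sum_mult_graded) (use f_mult_e in auto)
  also have "\<dots> = ?c *\<^sub>v ((\<Sum>r<d. geom (d - r) *\<^sub>v one_elt d r) + (\<Sum>r<d. if r = 0 then 0 else cross d (r - 1)))"
    by (simp add: ab scale_sum scale_add_right sum.distrib)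
  also have "(\<Sum>r<d. geom (d - r) *\<^sub>v one_elt d r) = (\<Sum>r<d + 1. geom (d - r) *\<^sub>v one_elt d r)"
    by (simp add: geom_def)
  also have "(\<Sum>r<d. if r = 0 then 0 else cross d (r - 1)) = (\<Sum>r<d. cross d r)"
  proof -
    obtain n where n: "d = Suc n" using d gr0_implies_Suc by blast
    \<comment> \<open>The last crossing term belongs to no label, its matrix entries sum up to \<open>d + 1\<close>.\<close>
    have "cross_label d n \<notin> Xi d" by (simp add: cross_label_def Xi_mat4_iff n)
    then have top: "cross d n = 0" by (simp add: cross_def gen_elt_unit_vec)
    have "(\<Sum>r<Suc n. if r = 0 then 0 else cross d (r - 1)) = (\<Sum>r<n. cross d r)"
      unfolding sum.lessThan_Suc_shift by simp
    then show ?thesis using top by (simp add: n)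
  qed
  finally have fe: "chev_f d \<star>\<^bsub>d\<^esub> chev_e d =
    ?c *\<^sub>v ((\<Sum>r<d + 1. geom (d - r) *\<^sub>v one_elt d r) + (\<Sum>r<d. cross d r))" .
  have "chev_e d \<star>\<^bsub>d\<^esub> chev_f d - chev_f d \<star>\<^bsub>d\<^esub> chev_e d =
    ?c *\<^sub>v ((\<Sum>r<d + 1. geom r *\<^sub>v one_elt d r) - (\<Sum>r<d + 1. geom (d - r) *\<^sub>v one_elt d r))"
    unfolding ef fe scale_diff_right[symmetric] by (rule arg_cong[of _ _ "scale _"]) simp
  also have "\<dots> = (\<Sum>r<d + 1. (?c * (geom r - geom (d - r))) *\<^sub>v one_elt d r)"
    unfolding sum_subtractf[symmetric] scale_diff_left[symmetric] scale_sum scale_scale ..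
  also have "\<dots> = (\<Sum>r<d + 1. (1 / (vv - vv powi (-1)) * (vv powi (2 * int r - int d) - vv powi (int d - 2 * int r))) *\<^sub>v one_elt d r)"
  proof (intro sum.cong refl arg_cong2[of _ _ _ _ scale])
    fix r assume "r \<in> {..<d + 1}"
    then have r: "int (d - r) = int d - int r" by auto
    have p1: "?c * vv ^ (2 * r) = vv * vv powi (2 * int r - int d)"
    proof -
      have "?c * vv ^ (2 * r) = vv powi (1 - int d + 2 * int r)"
        unfolding vv_power vv_powi_add by simp
      also have "1 - int d + 2 * int r = 1 + (2 * int r - int d)" by simp
      finally show ?thesis unfolding vv_powi_add by simp
    qed
    have p2: "?c * vv ^ (2 * (d - r)) = vv * vv powi (int d - 2 * int r)"
    proof -
      have "?c * vv ^ (2 * (d - r)) = vv powi (1 - int d + 2 * int (d - r))"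
        unfolding vv_power vv_powi_add by simp
      also have "1 - int d + 2 * int (d - r) = 1 + (int d - 2 * int r)" using r by simp
      finally show ?thesis unfolding vv_powi_add by simp
    qed
    have "?c * (geom r - geom (d - r)) = (?c * vv ^ (2 * r) - ?c * vv ^ (2 * (d - r))) / (vv ^ 2 - 1)"
      unfolding geom_eq diff_divide_distrib[symmetric] times_divide_eq_right by (simp add: algebra_simps)
    also have "\<dots> = 1 / (vv - vv powi (-1)) * (vv powi (2 * int r - int d) - vv powi (int d - 2 * int r))"
      unfolding p1 p2 vv_minus_inverse
      by (simp only: divide_divide_eq_right mult_1_left right_diff_distrib[symmetric] times_divide_eq_left)
    finally show "?c * (geom r - geom (d - r)) =
      1 / (vv - vv powi (-1)) * (vv powi (2 * int r - int d) - vv powi (int d - 2 * int r))" .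
  qed
  also have "\<dots> = (1 / (vv - vv powi (-1))) *\<^sub>v (chev_k d - chev_kinv d)"
    unfolding chev_k_def chev_kinv_def sum_atLeast0AtMost sum_subtractf[symmetric] scale_diff_left[symmetric]
      scale_sum scale_scale ..
  finally show ?thesis .
qed

text \<open>The relations for \<open>f\<close> are the transposes of those for \<open>\<Sum> c\<^sub>r e\<^sub>r\<close> with the coefficients \<open>c\<close> of \<open>f\<close>.\<close>

theorem proposition3p6:
  fixes d :: nat
  assumes "d > 0"
  shows "chev_k d \<star>\<^bsub>d\<^esub> chev_kinv d = MU_one d \<and>
    chev_k d \<star>\<^bsub>d\<^esub> chev_e d \<star>\<^bsub>d\<^esub> chev_kinv d = vv ^ 2 *\<^sub>v chev_e d \<and>
    chev_k d \<star>\<^bsub>d\<^esub> chev_f d \<star>\<^bsub>d\<^esub> chev_kinv d = (vv powi (-2)) *\<^sub>v chev_f d \<and>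
    chev_e d \<star>\<^bsub>d\<^esub> chev_f d - chev_f d \<star>\<^bsub>d\<^esub> chev_e d =
      (1 / (vv - vv powi (-1))) *\<^sub>v (chev_k d - chev_kinv d) \<and>
    chev_l d \<star>\<^bsub>d\<^esub> chev_l d = chev_l d \<and>
    chev_k d \<star>\<^bsub>d\<^esub> chev_l d = chev_l d \<star>\<^bsub>d\<^esub> chev_k d \<and>
    chev_l d \<star>\<^bsub>d\<^esub> chev_e d \<star>\<^bsub>d\<^esub> chev_l d = chev_l d \<star>\<^bsub>d\<^esub> chev_e d \<and>
    chev_l d \<star>\<^bsub>d\<^esub> chev_f d \<star>\<^bsub>d\<^esub> chev_l d = chev_f d \<star>\<^bsub>d\<^esub> chev_l d \<and>
    qint 2 *\<^sub>v (chev_e d \<star>\<^bsub>d\<^esub> chev_l d \<star>\<^bsub>d\<^esub> chev_e d) =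
      (vv powi (-1)) *\<^sub>v ((chev_e d \<star>\<^bsub>d\<^esub> chev_e d) \<star>\<^bsub>d\<^esub> chev_l d) +
      vv *\<^sub>v (chev_l d \<star>\<^bsub>d\<^esub> (chev_e d \<star>\<^bsub>d\<^esub> chev_e d)) \<and>
    qint 2 *\<^sub>v (chev_f d \<star>\<^bsub>d\<^esub> chev_l d \<star>\<^bsub>d\<^esub> chev_f d) =
      (vv powi (-1)) *\<^sub>v (chev_l d \<star>\<^bsub>d\<^esub> (chev_f d \<star>\<^bsub>d\<^esub> chev_f d)) +
      vv *\<^sub>v ((chev_f d \<star>\<^bsub>d\<^esub> chev_f d) \<star>\<^bsub>d\<^esub> chev_l d)"
proof (intro conjI)
  define c where "c = (\<lambda>r. vv powi (1 + int r - int d))"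
  have f: "chev_f d = transpose_elt (graded d 1 c 0)"
    using chev_f_graded[OF assms] by (simp add: c_def)
  note e = chev_e_graded[OF assms]
  have tk: "chev_k d = transpose_elt (chev_k d)" "chev_kinv d = transpose_elt (chev_kinv d)"
    "chev_l d = transpose_elt (chev_l d)"
    unfolding chev_k_graded chev_kinv_graded chev_l_graded by (simp_all add: transpose_graded_0)
  show "chev_k d \<star>\<^bsub>d\<^esub> chev_kinv d = MU_one d"
    unfolding chev_k_graded chev_kinv_graded MU_one_graded diagonal_mult_graded[OF zero_le]
    by (intro graded_cong) (simp add: vv_powi_add[symmetric])
  show "chev_k d \<star>\<^bsub>d\<^esub> chev_e d \<star>\<^bsub>d\<^esub> chev_kinv d = vv ^ 2 *\<^sub>v chev_e d"
    unfolding chev_k_graded chev_kinv_graded e diagonal_mult_graded[OF zero_le] graded_mult_diagonal[OF zero_le]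
      scale_graded
    by (intro graded_cong) (simp only: vv_power vv_powi_add[symmetric], simp add: algebra_simps)
  have "chev_kinv d \<star>\<^bsub>d\<^esub> (graded d 1 c 0 \<star>\<^bsub>d\<^esub> chev_k d) = vv powi (-2) *\<^sub>v graded d 1 c 0"
    unfolding chev_k_graded chev_kinv_graded diagonal_mult_graded[OF zero_le] graded_mult_diagonal[OF zero_le]
      scale_graded c_def
    by (intro graded_cong) (simp only: vv_power vv_powi_add[symmetric], simp add: algebra_simps)
  then show "chev_k d \<star>\<^bsub>d\<^esub> chev_f d \<star>\<^bsub>d\<^esub> chev_kinv d = (vv powi (-2)) *\<^sub>v chev_f d"
    by (metis f tk(1,2) transpose_elt_mult transpose_elt_scale)
  show "chev_e d \<star>\<^bsub>d\<^esub> chev_f d - chev_f d \<star>\<^bsub>d\<^esub> chev_e d =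
      (1 / (vv - vv powi (-1))) *\<^sub>v (chev_k d - chev_kinv d)"
    by (rule commutator[OF assms])
  show "chev_l d \<star>\<^bsub>d\<^esub> chev_l d = chev_l d" by (rule l_idempotent)
  show "chev_k d \<star>\<^bsub>d\<^esub> chev_l d = chev_l d \<star>\<^bsub>d\<^esub> chev_k d"
    unfolding chev_k_graded chev_l_graded diagonal_mult_graded[OF one_le_numeral] graded_mult_diagonal[OF one_le_numeral]
    by (intro graded_cong) (simp add: mult.commute)
  show "chev_l d \<star>\<^bsub>d\<^esub> chev_e d \<star>\<^bsub>d\<^esub> chev_l d = chev_l d \<star>\<^bsub>d\<^esub> chev_e d"
    unfolding e by (rule l_absorbs_step)
  show "chev_l d \<star>\<^bsub>d\<^esub> chev_f d \<star>\<^bsub>d\<^esub> chev_l d = chev_f d \<star>\<^bsub>d\<^esub> chev_l d"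
    using l_absorbs_step(2)[of d c] by (metis f tk(3) transpose_elt_mult)
  show "qint 2 *\<^sub>v (chev_e d \<star>\<^bsub>d\<^esub> chev_l d \<star>\<^bsub>d\<^esub> chev_e d) =
      (vv powi (-1)) *\<^sub>v ((chev_e d \<star>\<^bsub>d\<^esub> chev_e d) \<star>\<^bsub>d\<^esub> chev_l d) +
      vv *\<^sub>v (chev_l d \<star>\<^bsub>d\<^esub> (chev_e d \<star>\<^bsub>d\<^esub> chev_e d))"
    unfolding e by (rule serre_identity)
  have "transpose_elt (qint 2 *\<^sub>v (graded d 1 c 0 \<star>\<^bsub>d\<^esub> (chev_l d \<star>\<^bsub>d\<^esub> graded d 1 c 0))) =
     transpose_elt (vv powi (-1) *\<^sub>v ((graded d 1 c 0 \<star>\<^bsub>d\<^esub> graded d 1 c 0) \<star>\<^bsub>d\<^esub> chev_l d) +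
     vv *\<^sub>v (chev_l d \<star>\<^bsub>d\<^esub> (graded d 1 c 0 \<star>\<^bsub>d\<^esub> graded d 1 c 0)))"
    by (rule arg_cong[OF serre_identity(2)])
  then show "qint 2 *\<^sub>v (chev_f d \<star>\<^bsub>d\<^esub> chev_l d \<star>\<^bsub>d\<^esub> chev_f d) =
      (vv powi (-1)) *\<^sub>v (chev_l d \<star>\<^bsub>d\<^esub> (chev_f d \<star>\<^bsub>d\<^esub> chev_f d)) +
      vv *\<^sub>v ((chev_f d \<star>\<^bsub>d\<^esub> chev_f d) \<star>\<^bsub>d\<^esub> chev_l d)"
    unfolding transpose_elt_scale transpose_elt_add transpose_elt_mult f[symmetric] tk(3)[symmetric] .
qed

end
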